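(* Let $f\colon M^n=M^{n-1}\times I\to \mathbb{R}^{n+1}$ be a hypersurface of Enneper type with respect to the product net $\mathcal{E} = (E_0, E_1)$ of $M^n$. Assume that the images by $f$ of the leaves of $E_0$ are contained in either (a) concentric hyperspheres; (b) parallel affine hyperplanes; or (c) affine hyperplanes intersecting along an affine $(n-1)$-dimensional subspace. Then, assuming $M^n$ simply connected in case (c), there exists $F\colon M^n\to \mathbb{Q}_\epsilon^n\times \mathbb{R}$ given by $$F(x,s)=g_s(x)+a(s)\frac{\partial}{\partial t}$$ in terms of a hypersurface $g\colon M^{n-1}\to \mathbb{Q}_\epsilon^n$ (and a smooth function $a\colon I\to\mathbb{R}$ with positive derivative), with $\epsilon=1$ in case (a), $\epsilon=0$ in case (b) and $\epsilon=-1$ in case (c), such that $f=\Phi \circ F$.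
   Context: $I\subset\mathbb{R}$ is an open interval. The product net $(E_0,E_1)$ of $M^{n-1}\times I$ consists of the distributions formed by the tangent spaces to $M^{n-1}$ and to $I$; the leaves of $E_0$ are the sets $M^{n-1}\times\{s\}$. A hypersurface $f\colon M^{n-1}\times I\to\mathbb{R}^{n+1}$ is of Enneper type with respect to $\mathcal{E}$ if: (i) $\mathcal{E}$ is orthogonal with respect to the metric induced by $f$; (ii) the second fundamental form of $f$ is adapted to $\mathcal{E}$, i.e. $\alpha^f(X_0,X_1)=0$ for $X_0\in\Gamma(E_0)$, $X_1\in\Gamma(E_1)$; (iii) the images by $f$ of the leaves of $E_0$ are contained in hyperspheres or affine hyperplanes of $\mathbb{R}^{n+1}$. $\mathbb{Q}^n_\epsilon$ is $\mathbb{S}^n$, $\mathbb{R}^n$ or $\mathbb{H}^n$ for $\epsilon=1,0,-1$, regarded in $\mathbb{R}^{n+|\epsilon|}_\mu$ with $\mu=0$ if $\epsilon=0,1$ and $\mu=1$ (Lorentzian) if $\epsilon=-1$. For a hypersurface $g\colon M^{n-1}\to\mathbb{Q}^n_\epsilon$ with unit normal field $N$, its parallel hypersurfaces are $g_s(x)=C_\epsilon(s)g(x)+S_\epsilon(s)N(x)$, where $(C_\epsilon(s),S_\epsilon(s))=(\cos s,\sin s)$, $(1,s)$, $(\cosh s,\sinh s)$ for $\epsilon=1,0,-1$. $\partial/\partial t$ is the unit vector tangent to the factor $\mathbb{R}$, and $F$ is regarded as taking values in the flat space $\mathbb{R}^{n+1+|\epsilon|}_\mu\supset\mathbb{Q}^n_\epsilon\times\mathbb{R}$.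 The map $\Phi$: for $\epsilon=1$, $\Phi\colon\mathbb{S}^n\times\mathbb{R}\to\mathbb{R}^{n+1}\setminus\{0\}$ is the conformal diffeomorphism $\Phi(x,t)=e^tx$. For $\epsilon=0$, $\Phi\colon\mathbb{R}^n\times\mathbb{R}\to\mathbb{R}^{n+1}$ is the standard isometry. For $\epsilon=-1$, let $e_0,\dots,e_n$ be a pseudo-orthonormal basis of Lorentzian space $\mathbb{R}^{n+1}_1$ with $\langle e_0,e_0\rangle=0=\langle e_n,e_n\rangle$, $\langle e_0,e_n\rangle=-1/2$, $\langle e_i,e_j\rangle=\delta_{ij}$ for $1\le i\le n-1$, $0\le j\le n$; then $\Phi\colon\mathbb{H}^n\times\mathbb{R}\to\mathbb{R}^{n+1}\setminus\mathbb{R}^{n-1}$ is the conformal covering map $$\Phi(x_0e_0+\dots+x_ne_n,t)=\frac1{x_0}(x_1,\dots,x_{n-1},\cos t,\sin t),$$ where $\mathbb{R}^{n-1}=\{y\in\mathbb{R}^{n+1}: y_n=y_{n+1}=0\}$.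
   Formalization: False as printed (e.g. a right circular cylinder in case (b)): proved for connected M^{n-1}, assuming f is nowhere tangent or orthogonal to the spheres/hyperplanes containing the leaves, and with f = Φ∘F up to a Euclidean isometry and a change of the coordinate s on I. *)

theory Defs
  imports "HOL-Analysis.Analysis"
begin

section \<open>Smooth maps and smooth manifolds\<close>

text \<open>For functions between finite-dimensional spaces, and on open sets, \<open>C^k\<close> is tested on
  iterated directional derivatives.\<close>

primrec Ck_on :: "nat \<Rightarrow> 'e::real_normed_vector set \<Rightarrow> ('e \<Rightarrow> 'v::real_normed_vector) \<Rightarrow> bool" where
  "Ck_on 0 S f \<longleftrightarrow> continuous_on S f"
| "Ck_on (Suc k) S f \<longleftrightarrow>
     (\<forall>x\<in>S. f differentiable (at x)) \<and> (\<forall>v. Ck_on k S (\<lambda>x. frechet_derivative f (at x) v))"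

definition smooth_on :: "'e::real_normed_vector set \<Rightarrow> ('e \<Rightarrow> 'v::real_normed_vector) \<Rightarrow> bool" where
  "smooth_on S f \<longleftrightarrow> (\<forall>k. Ck_on k S f)"

text \<open>A chart is a pair of its domain and its coordinate map; the values of the coordinate map
  outside the domain are irrelevant. The model space \<open>'e\<close> fixes the dimension.\<close>

type_synonym ('p, 'e) chart = "'p set \<times> ('p \<Rightarrow> 'e)"

definition is_chart :: "('p::topological_space, 'e::euclidean_space) chart \<Rightarrow> bool" where
  "is_chart c \<longleftrightarrow> (case c of (U, \<phi>) \<Rightarrow>
     open U \<and> open (\<phi> ` U) \<and> homeomorphism U (\<phi> ` U) \<phi> (inv_into U \<phi>))"

definition smooth_atlas :: "('p::topological_space, 'e::euclidean_space) chart set \<Rightarrow> bool" where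
  "smooth_atlas A \<longleftrightarrow>
     (\<forall>c\<in>A. is_chart c) \<and> (\<Union>c\<in>A. fst c) = UNIV \<and>
     (\<forall>(U, \<phi>)\<in>A. \<forall>(V, \<psi>)\<in>A. smooth_on (\<phi> ` (U \<inter> V)) (\<psi> \<circ> inv_into U \<phi>))"

definition coord_rep :: "('p, 'e) chart \<Rightarrow> ('p \<Rightarrow> 'v) \<Rightarrow> 'e \<Rightarrow> 'v" where
  "coord_rep c f = f \<circ> inv_into (fst c) (snd c)"

definition smooth_map :: "('p, 'e::euclidean_space) chart set \<Rightarrow> ('p \<Rightarrow> 'v::euclidean_space) \<Rightarrow> bool"
  where "smooth_map A f \<longleftrightarrow> (\<forall>c\<in>A. smooth_on (snd c ` fst c) (coord_rep c f))"

text \<open>The differential of \<open>f\<close> at the point \<open>p\<close> of the chart domain; tangent vectors at \<open>p\<close>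
  are given by their coordinates in the chart \<open>c\<close>.\<close>

definition differential ::
  "('p, 'e::euclidean_space) chart \<Rightarrow> ('p \<Rightarrow> 'v::euclidean_space) \<Rightarrow> 'p \<Rightarrow> 'e \<Rightarrow> 'v" where
  "differential c f p = frechet_derivative (coord_rep c f) (at (snd c p))"

definition tangent_image ::
  "('p, 'e::euclidean_space) chart \<Rightarrow> ('p \<Rightarrow> 'v::euclidean_space) \<Rightarrow> 'p \<Rightarrow> 'v set" where
  "tangent_image c f p = range (differential c f p)"

definition immersion :: "('p, 'e::euclidean_space) chart set \<Rightarrow> ('p \<Rightarrow> 'v::euclidean_space) \<Rightarrow> bool"
  where "immersion A f \<longleftrightarrow> smooth_map A f \<and> (\<forall>c\<in>A. \<forall>p\<in>fst c. inj (differential c f p))"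

text \<open>The second fundamental form of an immersion into Euclidean space by the Gauss formula: the
  component normal to \<open>f\<close> of the flat derivative of \<open>f\<^sub>*Y\<close> in the direction \<open>X\<close>,
  where \<open>Y\<close> is extended with constant coordinates (the result depends only on the values of
  \<open>X\<close> and \<open>Y\<close> at \<open>p\<close>).\<close>

definition second_fundamental_form ::
  "('p, 'e::euclidean_space) chart \<Rightarrow> ('p \<Rightarrow> 'v::euclidean_space) \<Rightarrow> 'p \<Rightarrow> 'e \<Rightarrow> 'e \<Rightarrow> 'v" where
  "second_fundamental_form c f p X Y =
     (let D = frechet_derivative (\<lambda>y. frechet_derivative (coord_rep c f) (at y) Y) (at (snd c p)) X
      in THE \<xi>. (\<forall>t\<in>tangent_image c f p. \<xi> \<bullet> t = 0) \<and> D - \<xi> \<in> tangent_image c f p)"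


section \<open>Hypersurfaces of Enneper type on a product\<close>

definition open_interval :: "real set \<Rightarrow> bool" where
  "open_interval I \<longleftrightarrow> open I \<and> is_interval I \<and> I \<noteq> {}"

text \<open>Charts of the product of the manifold with the interval \<open>I\<close>; the product manifold is
  \<open>UNIV \<times> I\<close>.\<close>

definition product_atlas :: "('p, 'e) chart set \<Rightarrow> real set \<Rightarrow> ('p \<times> real, 'e \<times> real) chart set" where
  "product_atlas A I = (\<lambda>(U, \<phi>). (U \<times> I, map_prod \<phi> id)) ` A"

text \<open>The product net in the coordinates of a product chart, where both distributions are
  constant.\<close>

definition E0 :: "('e::real_vector \<times> real) set" where "E0 = UNIV \<times> {0}"
definition E1 :: "('e::real_vector \<times> real) set" where "E1 = {0} \<times> UNIV"

definition leaf :: "real \<Rightarrow> ('p \<times> real) set" where "leaf s = UNIV \<times> {s}"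

definition hypersphere :: "'v::euclidean_space set \<Rightarrow> bool" where
  "hypersphere S \<longleftrightarrow> (\<exists>c r. r > 0 \<and> S = sphere c r)"

definition affine_hyperplane :: "'v::euclidean_space set \<Rightarrow> bool" where
  "affine_hyperplane S \<longleftrightarrow> (\<exists>v d. v \<noteq> 0 \<and> S = {y. v \<bullet> y = d})"

definition enneper_type ::
  "('p, 'e::euclidean_space) chart set \<Rightarrow> real set \<Rightarrow> ('p \<times> real \<Rightarrow> 'v::euclidean_space) \<Rightarrow> bool" where
  "enneper_type A I f \<longleftrightarrow>
     (\<forall>c\<in>product_atlas A I. \<forall>p\<in>fst c. \<forall>X0\<in>E0. \<forall>X1\<in>E1.
        differential c f p X0 \<bullet> differential c f p X1 = 0) \<and>
     (\<forall>c\<in>product_atlas A I. \<forall>p\<in>fst c. \<forall>X0\<in>E0. \<forall>X1\<in>E1.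
        second_fundamental_form c f p X0 X1 = 0) \<and>
     (\<forall>s\<in>I. \<exists>S. (hypersphere S \<or> affine_hyperplane S) \<and> f ` leaf s \<subseteq> S)"

definition concentric_hyperspheres :: "'v::euclidean_space \<Rightarrow> 'v set set" where
  "concentric_hyperspheres c = {sphere c r |r. r > 0}"

definition parallel_hyperplanes :: "'v::euclidean_space \<Rightarrow> 'v set set" where
  "parallel_hyperplanes v = {{y. v \<bullet> y = d} |d. True}"

definition hyperplane_pencil :: "'v::euclidean_space set \<Rightarrow> 'v set set" where
  "hyperplane_pencil L = {H. affine_hyperplane H \<and> L \<subseteq> H}"

definition leaves_in :: "real set \<Rightarrow> ('p \<times> real \<Rightarrow> 'v) \<Rightarrow> 'v set set \<Rightarrow> bool" where
  "leaves_in I f \<S> \<longleftrightarrow> (\<forall>s\<in>I. \<exists>S\<in>\<S>. f ` leaf s \<subseteq> S)"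

text \<open>Nondegeneracy: \<open>f\<close> meets the member of the family that contains the image of a leaf
  neither tangentially nor orthogonally along that leaf. Equivalently, the corresponding map into
  the product has nowhere vanishing angle function and its height function has no critical points.
  Without this, the derivative of \<open>a\<close> or the change of the parallel parameter would have to
  be allowed to vanish (as for a cylinder over a hypersurface of a hyperplane, or for a piece of a
  hyperplane foliated by parallel hypersurfaces).\<close>

definition normal_vector :: "'v::euclidean_space set \<Rightarrow> 'v \<Rightarrow> 'v \<Rightarrow> bool" where
  "normal_vector S y \<xi> \<longleftrightarrow>
     (\<exists>c r. r > 0 \<and> S = sphere c r \<and> \<xi> = y - c) \<or>
     (\<exists>v d. v \<noteq> 0 \<and> S = {z. v \<bullet> z = d} \<and> \<xi> = v)"

definition oblique ::
  "('p, 'e::euclidean_space) chart set \<Rightarrow> real set \<Rightarrow> ('p \<times> real \<Rightarrow> 'v::euclidean_space) \<Rightarrow>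
    'v set set \<Rightarrow> bool" where
  "oblique A I f \<S> \<longleftrightarrow>
     (\<forall>s\<in>I. \<forall>S\<in>\<S>. f ` leaf s \<subseteq> S \<longrightarrow>
       (\<forall>c\<in>product_atlas A I. \<forall>p\<in>fst c \<inter> leaf s. \<forall>\<xi>. normal_vector S (f p) \<xi> \<longrightarrow>
          \<xi> \<notin> tangent_image c f p \<and> \<not> (\<forall>t\<in>tangent_image c f p. \<xi> \<bullet> t = 0)))"


section \<open>Space forms, parallel hypersurfaces and the map Phi\<close>

text \<open>With \<open>'m\<close> of cardinality \<open>n - 1\<close>, Euclidean \<open>n\<close>-space is \<open>real^'m \<times> real\<close> and Euclidean
  \<open>(n+1)\<close>-space is \<open>real^'m \<times> real \<times> real\<close>. Lorentzian \<open>(n+1)\<close>-space is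
  \<open>real \<times> real^'m \<times> real\<close>, a vector \<open>(x0, x, xn)\<close> being given by its coordinates in the
  pseudo-orthonormal basis \<open>e0, ..., en\<close> with \<open>e0, en\<close> null and of inner product \<open>-1/2\<close>.\<close>

type_synonym 'm euclid_n = "(real^'m) \<times> real"
type_synonym 'm euclid_n1 = "(real^'m) \<times> real \<times> real"
type_synonym 'm lorentz_n1 = "real \<times> (real^'m) \<times> real"

definition lorentz :: "'m::finite lorentz_n1 \<Rightarrow> 'm lorentz_n1 \<Rightarrow> real" where
  "lorentz = (\<lambda>(x0, x, xn) (y0, y, yn). x \<bullet> y - (x0 * yn + xn * y0) / 2)"

definition unit_sphere :: "'m::finite euclid_n1 set" where
  "unit_sphere = {x. x \<bullet> x = 1}"

text \<open>On the two-sheeted hyperboloid the coordinate \<open>x0\<close> does not vanish, and its sign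
  distinguishes the sheets.\<close>

definition hyperbolic :: "'m::finite lorentz_n1 set" where
  "hyperbolic = {x. lorentz x x = -1 \<and> fst x > 0}"

definition C\<epsilon> :: "int \<Rightarrow> real \<Rightarrow> real" where
  "C\<epsilon> \<epsilon> s = (if \<epsilon> = 1 then cos s else if \<epsilon> = 0 then 1 else cosh s)"

definition S\<epsilon> :: "int \<Rightarrow> real \<Rightarrow> real" where
  "S\<epsilon> \<epsilon> s = (if \<epsilon> = 1 then sin s else if \<epsilon> = 0 then s else sinh s)"

definition parallel_hypersurface ::
  "int \<Rightarrow> ('p \<Rightarrow> 'w::real_vector) \<Rightarrow> ('p \<Rightarrow> 'w) \<Rightarrow> real \<Rightarrow> 'p \<Rightarrow> 'w" where
  "parallel_hypersurface \<epsilon> g N s x = C\<epsilon> \<epsilon> s *\<^sub>R g x + S\<epsilon> \<epsilon> s *\<^sub>R N x"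

text \<open>\<open>g\<close> is a hypersurface of the space form \<open>Q\<close> of curvature \<open>\<epsilon>\<close>, regarded in the flat space
  with scalar product \<open>B\<close>, and \<open>N\<close> is a unit normal field. For \<open>\<epsilon> \<noteq> 0\<close> tangency of \<open>N\<close> to \<open>Q\<close>
  is orthogonality to the position vector. Since tangent spaces of \<open>Q\<close> are positive definite, no
  separate nondegeneracy of the induced metric is needed.\<close>

definition hypersurface_with_normal ::
  "int \<Rightarrow> ('w::euclidean_space \<Rightarrow> 'w \<Rightarrow> real) \<Rightarrow> 'w set \<Rightarrow>
    ('p, 'e::euclidean_space) chart set \<Rightarrow> ('p \<Rightarrow> 'w) \<Rightarrow> ('p \<Rightarrow> 'w) \<Rightarrow> bool" where
  "hypersurface_with_normal \<epsilon> B Q A g N \<longleftrightarrow>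
     immersion A g \<and> range g \<subseteq> Q \<and> smooth_map A N \<and>
     (\<forall>x. B (N x) (N x) = 1) \<and> (\<epsilon> \<noteq> 0 \<longrightarrow> (\<forall>x. B (N x) (g x) = 0)) \<and>
     (\<forall>c\<in>A. \<forall>x\<in>fst c. \<forall>X. B (N x) (differential c g x X) = 0)"

definition \<Phi>_sphere :: "'m::finite euclid_n1 \<times> real \<Rightarrow> 'm euclid_n1" where
  "\<Phi>_sphere = (\<lambda>(x, t). exp t *\<^sub>R x)"

definition \<Phi>_flat :: "'m::finite euclid_n \<times> real \<Rightarrow> 'm euclid_n1" where
  "\<Phi>_flat = (\<lambda>((x, xn), t). (x, xn, t))"

definition \<Phi>_hyperbolic :: "'m::finite lorentz_n1 \<times> real \<Rightarrow> 'm euclid_n1" where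
  "\<Phi>_hyperbolic = (\<lambda>((x0, x, xn), t). (1 / x0) *\<^sub>R (x, cos t, sin t))"

definition diffeo_intervals :: "real set \<Rightarrow> real set \<Rightarrow> (real \<Rightarrow> real) \<Rightarrow> bool" where
  "diffeo_intervals I J \<tau> \<longleftrightarrow>
     bij_betw \<tau> I J \<and> smooth_on I \<tau> \<and> smooth_on J (inv_into I \<tau>)"

text \<open>\<open>F (x, s) = g\<^sub>u x + a u \<partial>/\<partial>t\<close>, with values in the product of \<open>Q\<close> with the line,
  where \<open>u = \<tau> s\<close> is a coordinate on the factor \<open>I\<close>. The existence of \<open>\<tau>\<close> is the freedom to choose
  that coordinate, which leaves the product net unchanged.\<close>

definition parallel_family_map ::
  "int \<Rightarrow> ('w::euclidean_space \<Rightarrow> 'w \<Rightarrow> real) \<Rightarrow> 'w set \<Rightarrow>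
    ('p, 'e::euclidean_space) chart set \<Rightarrow> real set \<Rightarrow> ('p \<times> real \<Rightarrow> 'w \<times> real) \<Rightarrow> bool" where
  "parallel_family_map \<epsilon> B Q A I F \<longleftrightarrow>
     F ` (UNIV \<times> I) \<subseteq> Q \<times> UNIV \<and>
     (\<exists>g N J \<tau> a. hypersurface_with_normal \<epsilon> B Q A g N \<and>
        open_interval J \<and> diffeo_intervals I J \<tau> \<and>
        smooth_on J a \<and> (\<forall>u\<in>J. deriv a u > 0) \<and>
        (\<forall>x. \<forall>s\<in>I. let u = \<tau> s in
           F (x, s) = (parallel_hypersurface \<epsilon> g N u x, 0) + a u *\<^sub>R (0, 1)))"

text \<open>The formulas for \<open>\<Phi>\<close> fix the centre, the direction and the axis of the three families, so
  that \<open>f\<close> equals \<open>\<Phi> \<circ> F\<close> up to a Euclidean isometry.\<close>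

definition euclidean_isometry :: "('v::euclidean_space \<Rightarrow> 'v) \<Rightarrow> bool" where
  "euclidean_isometry T \<longleftrightarrow> (\<forall>y z. dist (T y) (T z) = dist y z)"

end

(* Idea. In each case f is, up to Phi, a pair (y, t) with y(., s) a hypersurface of the space form Q
   and t a function of s alone. Orthogonality of the net makes y_s normal to y(., s) inside Q, and
   adaptedness of the second fundamental form says exactly that the speed |y_s| does not depend on
   the point of M. Obliqueness gives y_s \<noteq> 0 and t' \<noteq> 0. With N the unit normal y_s / psi,
   psi = |y_s| up to a sign, one has y_s = psi N and N_s = - epsilon psi y, so in the parameter
   tau with tau' = psi the curves s -> y(x, s) are geodesics of Q and y(., s) are parallel
   hypersurfaces; the sign of psi is that of t'.

   Spheres: y = (f - c) / |f - c|, t = ln |f - c|. Parallel hyperplanes: split off the last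
   coordinate. Pencil: f avoids the axis, since the components of f(x, s) and f(x1, s) normal to the
   axis are collinear for all s, and differentiating this where the first one vanishes makes f_s
   tangent to the hyperplane. Then cylindrical coordinates around the axis turn f into a map into the
   half-space model together with an angle, which depends on s alone. *)

theory Submission
  imports Defs
begin

section \<open>Calculus of smooth maps\<close>

text \<open>Adaptedness enters in the form f_Xs = f_*W + \<mu> f_s, the mixed derivative being
  tangent, and everything hinges on \<mu>. In the first two cases the component of f_s normal to the
  sphere or hyperplane is nonzero and depends on s alone, which forces \<mu> = 0, so |f_s| is
  constant along leaves. In the third case \<mu> is the logarithmic derivative along the leaf of the
  distance \<rho> to the axis. This is the factor that disappears when the Euclidean metric is
  divided by \<rho>^2, and it is why hyperbolic space appears. Constant speed makes y_ss orthogonal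
  to the leaves, once the order of differentiation is interchanged. The equation for N_s then
  follows by testing against leaf directions, velocity and position. To run this argument once for
  all three space forms, the scalar product is kept abstract and nondegeneracy is assumed in just
  that form: the Lorentzian product leaves no appeal to positivity of the square of a
  vector.\<close>

abbreviation FD :: "('a::real_normed_vector \<Rightarrow> 'b::real_normed_vector) \<Rightarrow> 'a \<Rightarrow> 'a \<Rightarrow> 'b"
  where "FD f x \<equiv> frechet_derivative f (at x)"

section \<open>Iterated differentiability\<close>

lemma Ck_on_Suc_imp: "Ck_on (Suc k) S f \<Longrightarrow> Ck_on k S f"
proof (induction k arbitrary: f)
  case 0
  then show ?case
    by (auto intro!: continuous_at_imp_continuous_on differentiable_imp_continuous_within)
next
  case (Suc k)
  then show ?case by (metis Ck_on.simps(2))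
qed

text \<open>Openness makes the derivatives of \<open>f\<close> and \<open>g\<close> agree:
  \<open>FD\<close> looks at a full neighbourhood, which the values on a general set would not
  determine.\<close>

lemma Ck_on_cong:
  assumes "open S" "\<And>x. x \<in> S \<Longrightarrow> f x = g x" "Ck_on k S f"
  shows "Ck_on k S g"
  using assms(2,3)
proof (induction k arbitrary: f g)
  case 0
  then show ?case by (simp cong: continuous_on_cong)
next
  case (Suc k)
  have dif: "f differentiable (at x)" if "x \<in> S" for x using Suc.prems that by auto
  have "(g has_derivative FD f x) (at x)" if "x \<in> S" for x
    using has_derivative_transform_within_open[OF _ assms(1) that] dif[OF that] Suc.prems(1)
    by (metis frechet_derivative_works)
  then have "g differentiable (at x)" "FD g x = FD f x" if "x \<in> S" for x
    using that by (auto simp: differentiable_def frechet_derivative_at[symmetric])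
  moreover have "Ck_on k S (\<lambda>x. FD g x v)" for v
    using Suc.IH[of "\<lambda>x. FD f x v" "\<lambda>x. FD g x v"] Suc.prems calculation by auto
  ultimately show ?case by simp
qed

lemma Ck_on_subset: "Ck_on k S f \<Longrightarrow> T \<subseteq> S \<Longrightarrow> Ck_on k T f"
  by (induction k arbitrary: f) (auto intro: continuous_on_subset)

text \<open>Inductions on \<open>k\<close> name the derivative by an explicit formula. That formula
  agrees with \<open>FD\<close> only on \<open>S\<close>, hence the passage through
  \<open>Ck_on_cong\<close>.\<close>

lemma Ck_on_derivI:
  assumes "open S" "\<And>x. x \<in> S \<Longrightarrow> (f has_derivative f' x) (at x)"
    "\<And>v. Ck_on k S (\<lambda>x. f' x v)"
  shows "Ck_on (Suc k) S f"
proof -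
  have "FD f x = f' x" if "x \<in> S" for x
    using assms(2)[OF that] frechet_derivative_at by metis
  then have "Ck_on k S (\<lambda>x. FD f x v)" for v
    by (intro Ck_on_cong[OF assms(1) _ assms(3)[of v]]) auto
  then show ?thesis using assms(2) by (auto simp: differentiable_def)
qed

lemma Ck_on_derivD:
  assumes "Ck_on (Suc k) S f" "x \<in> S"
  shows "(f has_derivative FD f x) (at x)"
  using assms by (simp add: frechet_derivative_works[symmetric])

lemma Ck_on_const: "Ck_on k S (\<lambda>x. c)"
  by (induction k arbitrary: c) auto

lemma Ck_on_bounded_linear:
  assumes "bounded_linear L" "open S" shows "Ck_on k S L"
proof (cases k)
  case 0
  then show ?thesis using assms linear_continuous_on by auto
next
  case (Suc j)
  then show ?thesis
    using Ck_on_derivI[OF assms(2), of L "\<lambda>_. L" j] bounded_linear_imp_has_derivative[OF assms(1)]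
    by (simp add: Ck_on_const)
qed

lemma Ck_on_add:
  assumes "open S" "Ck_on k S f" "Ck_on k S g"
  shows "Ck_on k S (\<lambda>x. f x + g x)"
  using assms(2,3)
proof (induction k arbitrary: f g)
  case 0
  then show ?case by (auto intro: continuous_on_add)
next
  case (Suc k)
  show ?case
  proof (rule Ck_on_derivI[OF assms(1)])
    show "((\<lambda>x. f x + g x) has_derivative (\<lambda>v. FD f x v + FD g x v)) (at x)" if "x \<in> S" for x
      using Ck_on_derivD[OF Suc.prems(1) that] Ck_on_derivD[OF Suc.prems(2) that]
      by (rule has_derivative_add)
  qed (use Suc in auto)
qed

lemma Ck_on_sum:
  assumes "open S" "\<And>i. i \<in> A \<Longrightarrow> Ck_on k S (f i)"
  shows "Ck_on k S (\<lambda>x. \<Sum>i\<in>A. f i x)"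
  using assms(2)
  by (induction A rule: infinite_finite_induct) (auto intro: Ck_on_const Ck_on_add[OF assms(1)])

lemma Ck_on_bilinear:
  assumes B: "bounded_bilinear B" and "open S" "Ck_on k S f" "Ck_on k S g"
  shows "Ck_on k S (\<lambda>x. B (f x) (g x))"
  using assms(3,4)
proof (induction k arbitrary: f g)
  case 0
  then show ?case by (auto intro: bounded_bilinear.continuous_on[OF B])
next
  case (Suc k)
  show ?case
  proof (rule Ck_on_derivI[OF assms(2)])
    show "((\<lambda>x. B (f x) (g x)) has_derivative (\<lambda>v. B (f x) (FD g x v) + B (FD f x v) (g x))) (at x)"
      if "x \<in> S" for x
      using Ck_on_derivD[OF Suc.prems(1) that] Ck_on_derivD[OF Suc.prems(2) that]
      by (rule bounded_bilinear.FDERIV[OF B])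
    show "Ck_on k S (\<lambda>x. B (f x) (FD g x v) + B (FD f x v) (g x))" for v
      using Suc.prems Suc.IH Ck_on_Suc_imp[OF Suc.prems(1)] Ck_on_Suc_imp[OF Suc.prems(2)]
      by (intro Ck_on_add[OF assms(2)]) auto
  qed
qed

text \<open>In the chain rule the argument \<open>FD f x v\<close> of \<open>FD g (f x)\<close>
  varies with \<open>x\<close>, whereas \<open>Ck_on\<close> speaks of derivatives in fixed
  directions. Expanding that argument in a basis of the middle space separates the two
  dependences.\<close>

lemma Ck_on_compose:
  fixes f :: "'a::real_normed_vector \<Rightarrow> 'b::euclidean_space"
  assumes "open S" "open T" "f ` S \<subseteq> T" "Ck_on k S f" "Ck_on k T g"
  shows "Ck_on k S (\<lambda>x. g (f x))"
  using assms(4,5)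
proof (induction k arbitrary: g)
  case 0
  then show ?case using assms(3) by (auto intro: continuous_on_compose2)
next
  case (Suc k)
  show ?case
  proof (rule Ck_on_derivI[OF assms(1)])
    fix x assume x: "x \<in> S"
    have g: "(g has_derivative FD g (f x)) (at (f x))"
      using Ck_on_derivD[OF Suc.prems(2)] x assms(3) by blast
    have eq: "FD g (f x) w = (\<Sum>i\<in>Basis. (w \<bullet> i) *\<^sub>R FD g (f x) i)" for w
    proof -
      interpret linear "FD g (f x)" using g has_derivative_linear by blast
      show ?thesis by (metis (no_types, lifting) euclidean_representation scale sum sum.cong)
    qed
    show "((\<lambda>x. g (f x)) has_derivative (\<lambda>v. \<Sum>i\<in>Basis. (FD f x v \<bullet> i) *\<^sub>R FD g (f x) i)) (at x)"
      unfolding eq[symmetric] using diff_chain_at[OF Ck_on_derivD[OF Suc.prems(1) x] g]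
      by (simp add: o_def)
  next
    have "Ck_on k S (\<lambda>x. FD g (f x) i)" for i
      using Suc.IH[of "\<lambda>y. FD g y i"] Suc.prems Ck_on_Suc_imp by auto
    moreover have "Ck_on k S (\<lambda>x. FD f x v \<bullet> i)" for v i
      using Suc.prems by (intro Ck_on_bilinear[OF bounded_bilinear_inner assms(1)]) (auto simp: Ck_on_const)
    ultimately show "Ck_on k S (\<lambda>x. \<Sum>i\<in>Basis. (FD f x v \<bullet> i) *\<^sub>R FD g (f x) i)" for v
      by (intro Ck_on_sum[OF assms(1)] Ck_on_bilinear[OF bounded_bilinear_scaleR assms(1)])
  qed
qed

section \<open>Closure properties of smooth maps\<close>

lemma smooth_on_cong:
  "open S \<Longrightarrow> smooth_on S f \<Longrightarrow> (\<And>x. x \<in> S \<Longrightarrow> f x = g x) \<Longrightarrow> smooth_on S g"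
  unfolding smooth_on_def using Ck_on_cong by metis

lemma smooth_on_subset: "smooth_on S f \<Longrightarrow> T \<subseteq> S \<Longrightarrow> smooth_on T f"
  unfolding smooth_on_def using Ck_on_subset by blast

lemma smooth_on_has_derivative: "smooth_on S f \<Longrightarrow> x \<in> S \<Longrightarrow> (f has_derivative FD f x) (at x)"
  unfolding smooth_on_def using Ck_on_derivD by blast

lemma smooth_on_FD: "smooth_on S f \<Longrightarrow> smooth_on S (\<lambda>x. FD f x v)"
  unfolding smooth_on_def by (metis Ck_on.simps(2))

lemma smooth_on_continuous_on: "smooth_on S f \<Longrightarrow> continuous_on S f"
  unfolding smooth_on_def by (metis Ck_on.simps(1))

lemma smooth_on_const: "smooth_on S (\<lambda>x. c)"
  unfolding smooth_on_def by (simp add: Ck_on_const)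

lemma smooth_on_add: "open S \<Longrightarrow> smooth_on S f \<Longrightarrow> smooth_on S g \<Longrightarrow> smooth_on S (\<lambda>x. f x + g x)"
  unfolding smooth_on_def by (simp add: Ck_on_add)

lemma smooth_on_bilinear:
  "bounded_bilinear B \<Longrightarrow> open S \<Longrightarrow> smooth_on S f \<Longrightarrow> smooth_on S g \<Longrightarrow> smooth_on S (\<lambda>x. B (f x) (g x))"
  unfolding smooth_on_def by (simp add: Ck_on_bilinear)

lemmas smooth_on_scaleR = smooth_on_bilinear[OF bounded_bilinear_scaleR]
lemmas smooth_on_inner = smooth_on_bilinear[OF bounded_bilinear_inner]
lemmas smooth_on_mult = smooth_on_bilinear[OF bounded_bilinear_mult]

lemma smooth_on_compose:
  fixes f :: "'a::real_normed_vector \<Rightarrow> 'b::euclidean_space"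
  shows "open S \<Longrightarrow> open T \<Longrightarrow> f ` S \<subseteq> T \<Longrightarrow> smooth_on S f \<Longrightarrow> smooth_on T g \<Longrightarrow>
    smooth_on S (\<lambda>x. g (f x))"
  unfolding smooth_on_def using Ck_on_compose by blast

lemma smooth_on_bounded_linear: "bounded_linear L \<Longrightarrow> open S \<Longrightarrow> smooth_on S L"
  unfolding smooth_on_def by (simp add: Ck_on_bounded_linear)

lemma smooth_on_linear_compose:
  fixes f :: "'a::real_normed_vector \<Rightarrow> 'b::euclidean_space"
  shows "bounded_linear L \<Longrightarrow> open S \<Longrightarrow> smooth_on S f \<Longrightarrow> smooth_on S (\<lambda>x. L (f x))"
  by (rule smooth_on_compose[of S UNIV]) (auto intro: smooth_on_bounded_linear)

lemma smooth_on_diff: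
  fixes f :: "'a::real_normed_vector \<Rightarrow> 'b::euclidean_space"
  assumes "open S" "smooth_on S f" "smooth_on S g" shows "smooth_on S (\<lambda>x. f x - g x)"
  using smooth_on_add[OF assms(1,2) smooth_on_linear_compose[OF bounded_linear_minus[OF bounded_linear_ident] assms(1,3)]]
  by simp

lemma smooth_on_antiderivative:
  fixes f :: "real \<Rightarrow> 'b::real_normed_vector"
  assumes "open S" "\<And>x. x \<in> S \<Longrightarrow> (f has_vector_derivative f' x) (at x)" "smooth_on S f'"
  shows "smooth_on S f"
  unfolding smooth_on_def
proof
  fix k
  have "Ck_on (Suc k) S f"
  proof (rule Ck_on_derivI[OF assms(1)])
    show "(f has_derivative (\<lambda>v. v *\<^sub>R f' x)) (at x)" if "x \<in> S" for x
      using assms(2)[OF that] by (simp add: has_vector_derivative_def)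
    show "Ck_on k S (\<lambda>x. v *\<^sub>R f' x)" for v
      using assms(3) unfolding smooth_on_def
      by (intro Ck_on_bilinear[OF bounded_bilinear_scaleR assms(1)]) (auto simp: Ck_on_const)
  qed
  then show "Ck_on k S f" by (rule Ck_on_Suc_imp)
qed

lemma smooth_on_has_vector_derivative:
  fixes f :: "real \<Rightarrow> 'b::real_normed_vector"
  assumes "smooth_on S f" "x \<in> S"
  shows "(f has_vector_derivative vector_derivative f (at x)) (at x)"
  using smooth_on_has_derivative[OF assms] vector_derivative_works differentiableI by metis

lemma smooth_on_vector_derivative:
  fixes f :: "real \<Rightarrow> 'b::real_normed_vector"
  assumes "open S" "smooth_on S f"
  shows "smooth_on S (\<lambda>x. vector_derivative f (at x))"
proof (rule smooth_on_cong[OF assms(1) smooth_on_FD[OF assms(2), of 1]])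
  fix x assume "x \<in> S"
  then have "f differentiable (at x)" using smooth_on_has_derivative[OF assms(2)] differentiableI by blast
  then show "FD f x 1 = vector_derivative f (at x)" by (simp add: frechet_derivative_eq_vector_derivative)
qed

section \<open>Smoothness of elementary functions\<close>

lemma smooth_on_inverse_real: "smooth_on (- {0::real}) inverse"
  unfolding smooth_on_def
proof
  have op: "open (- {0::real})" by auto
  fix k show "Ck_on k (- {0::real}) inverse"
  proof (induction k)
    case 0
    then show ?case by (auto intro!: continuous_intros)
  next
    case (Suc k)
    show ?case
    proof (rule Ck_on_derivI[OF op])
      \<comment> \<open>The derivative is a product of copies of \<open>inverse\<close>, so the
        induction hypothesis and the product rule give the next order.\<close>
      show "(inverse has_derivative (\<lambda>v. (- v) * (inverse x * inverse x))) (at x)"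
        if "x \<in> - {0}" for x :: real
        using that has_derivative_inverse'[of x UNIV] by (simp add: mult_ac)
      show "Ck_on k (- {0::real}) (\<lambda>x. (- v) * (inverse x * inverse x))" for v
        by (intro Ck_on_bilinear[OF bounded_bilinear_mult op] Suc Ck_on_const)
    qed
  qed
qed

lemma smooth_on_inverse:
  fixes f :: "'a::real_normed_vector \<Rightarrow> real"
  shows "open S \<Longrightarrow> smooth_on S f \<Longrightarrow> (\<And>x. x \<in> S \<Longrightarrow> f x \<noteq> 0) \<Longrightarrow> smooth_on S (\<lambda>x. inverse (f x))"
  by (rule smooth_on_compose[OF _ _ _ _ smooth_on_inverse_real]) auto

text \<open>The derivative is \<open>inverse\<close> composed with \<open>sqrt\<close> itself, so
  each order of differentiability yields the next.\<close>

lemma smooth_on_sqrt_real: "smooth_on {0<..} sqrt"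
  unfolding smooth_on_def
proof
  have op: "open {0::real<..}" "open (- {0::real})" by auto
  fix k show "Ck_on k {0<..} sqrt"
  proof (induction k)
    case 0
    then show ?case by (auto intro!: continuous_intros)
  next
    case (Suc k)
    show ?case
    proof (rule Ck_on_derivI[OF op(1)])
      show "(sqrt has_derivative (\<lambda>v. (v / 2) * inverse (sqrt x))) (at x)" if "x \<in> {0<..}" for x
        by (rule has_derivative_eq_rhs[OF DERIV_real_sqrt[of x, unfolded has_field_derivative_def]])
          (use that in auto)
      have "Ck_on k (- {0::real}) inverse"
        using smooth_on_inverse_real by (simp add: smooth_on_def)
      then show "Ck_on k {0<..} (\<lambda>x. (v / 2) * inverse (sqrt x))" for v
        by (intro Ck_on_bilinear[OF bounded_bilinear_mult op(1)] Ck_on_const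
            Ck_on_compose[OF op _ Suc]) auto
    qed
  qed
qed

lemma smooth_on_sqrt:
  fixes f :: "'a::real_normed_vector \<Rightarrow> real"
  shows "open S \<Longrightarrow> smooth_on S f \<Longrightarrow> (\<And>x. x \<in> S \<Longrightarrow> f x > 0) \<Longrightarrow> smooth_on S (\<lambda>x. sqrt (f x))"
  by (rule smooth_on_compose[OF _ _ _ _ smooth_on_sqrt_real]) auto

lemma smooth_on_norm:
  fixes f :: "'a::real_normed_vector \<Rightarrow> 'b::euclidean_space"
  assumes "open S" "smooth_on S f" "\<And>x. x \<in> S \<Longrightarrow> f x \<noteq> 0"
  shows "smooth_on S (\<lambda>x. norm (f x))"
  unfolding norm_eq_sqrt_inner using assms by (intro smooth_on_sqrt smooth_on_inner) auto

lemma smooth_on_ln: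
  fixes f :: "'a::real_normed_vector \<Rightarrow> real"
  assumes "open S" "smooth_on S f" "\<And>x. x \<in> S \<Longrightarrow> f x > 0"
  shows "smooth_on S (\<lambda>x. ln (f x))"
proof (rule smooth_on_compose[OF assms(1) _ _ assms(2)])
  show "smooth_on {0<..} (ln :: real \<Rightarrow> real)"
    by (rule smooth_on_antiderivative[OF _ _ smooth_on_subset[OF smooth_on_inverse_real]])
       (auto simp: has_real_derivative_iff_has_vector_derivative[symmetric] DERIV_ln)
qed (use assms in auto)

lemma smooth_on_Pair:
  fixes f :: "'a::real_normed_vector \<Rightarrow> 'b::euclidean_space" and g :: "'a \<Rightarrow> 'c::euclidean_space"
  assumes "open S" "smooth_on S f" "smooth_on S g"
  shows "smooth_on S (\<lambda>x. (f x, g x))"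
proof -
  have b: "bounded_linear (\<lambda>y::'b. (y, 0::'c))" "bounded_linear (\<lambda>y::'c. (0::'b, y))"
    by (auto intro!: bounded_linear_Pair bounded_linear_ident bounded_linear_zero)
  show ?thesis
    using smooth_on_add[OF assms(1) smooth_on_linear_compose[OF b(1) assms(1,2)]
        smooth_on_linear_compose[OF b(2) assms(1,3)]] by simp
qed

section \<open>Derivatives along lines and symmetry of second derivatives\<close>

lemma FD_eq: "(f has_derivative f') (at x) \<Longrightarrow> FD f x = f'"
  by (rule frechet_derivative_at[symmetric])

lemma FD_cong:
  "open S \<Longrightarrow> smooth_on S f \<Longrightarrow> x \<in> S \<Longrightarrow> (\<And>y. y \<in> S \<Longrightarrow> f y = g y) \<Longrightarrow> FD g x = FD f x"
  by (metis smooth_on_has_derivative has_derivative_transform_within_open FD_eq)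

lemma has_vector_derivative_along_line:
  assumes "(g has_derivative g') (at (p + a *\<^sub>R v))"
  shows "((\<lambda>a. g (p + a *\<^sub>R v)) has_vector_derivative g' v) (at a)"
proof -
  have "((\<lambda>a. p + a *\<^sub>R v) has_derivative (\<lambda>h. h *\<^sub>R v)) (at a)"
    by (auto intro!: derivative_eq_intros)
  from diff_chain_at[OF this assms] show ?thesis
    using linear_scale[OF has_derivative_linear[OF assms]]
    by (simp add: has_vector_derivative_def o_def)
qed

text \<open>The second difference is symmetric in \<open>v\<close> and \<open>w\<close>. A mean
  value in the direction \<open>v\<close>, applied to the difference across \<open>w\<close>, and
  then one in the direction \<open>w\<close> turn it into a value of the mixed derivative;
  exchanging the roles gives the other order of differentiation.\<close>

lemma second_difference_mvt:
  fixes g :: "'a::real_normed_vector \<Rightarrow> real"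
  assumes S: "smooth_on S g" and t: "0 < t"
    and in_S: "\<And>a b. a \<in> {0..t} \<Longrightarrow> b \<in> {0..t} \<Longrightarrow> z + a *\<^sub>R v + b *\<^sub>R w \<in> S"
  obtains a b where "a \<in> {0..t}" "b \<in> {0..t}"
    "g (z + t *\<^sub>R v + t *\<^sub>R w) - g (z + t *\<^sub>R v) - g (z + t *\<^sub>R w) + g z
      = t\<^sup>2 * FD (\<lambda>x. FD g x v) (z + a *\<^sub>R v + b *\<^sub>R w) w"
proof -
  have d1: "DERIV (\<lambda>a. g (z + a *\<^sub>R v + b *\<^sub>R w)) a :> FD g (z + a *\<^sub>R v + b *\<^sub>R w) v"
    if "a \<in> {0..t}" "b \<in> {0..t}" for a b
    using has_vector_derivative_along_line[of g _ "z + b *\<^sub>R w" a v]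
      smooth_on_has_derivative[OF S in_S[OF that]]
    by (simp add: has_real_derivative_iff_has_vector_derivative add_ac)
  have d2: "DERIV (\<lambda>b. FD g (z + a *\<^sub>R v + b *\<^sub>R w) v) b :> FD (\<lambda>x. FD g x v) (z + a *\<^sub>R v + b *\<^sub>R w) w"
    if "a \<in> {0..t}" "b \<in> {0..t}" for a b
    using has_vector_derivative_along_line[of "\<lambda>x. FD g x v" _ "z + a *\<^sub>R v" b w]
      smooth_on_has_derivative[OF smooth_on_FD[OF S] in_S[OF that]]
    by (simp add: has_real_derivative_iff_has_vector_derivative add_ac)
  have "\<exists>a>0. a < t \<and> (g (z + t *\<^sub>R v + t *\<^sub>R w) - g (z + t *\<^sub>R v + 0 *\<^sub>R w)) - (g (z + 0 *\<^sub>R v + t *\<^sub>R w) - g (z + 0 *\<^sub>R v + 0 *\<^sub>R w))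
      = (t - 0) * (FD g (z + a *\<^sub>R v + t *\<^sub>R w) v - FD g (z + a *\<^sub>R v + 0 *\<^sub>R w) v)"
    by (rule MVT2[OF t]) (use t in \<open>intro DERIV_diff d1; auto\<close>)
  then obtain a where a: "0 < a" "a < t" "g (z + t *\<^sub>R v + t *\<^sub>R w) - g (z + t *\<^sub>R v) - g (z + t *\<^sub>R w) + g z
      = t * (FD g (z + a *\<^sub>R v + t *\<^sub>R w) v - FD g (z + a *\<^sub>R v + 0 *\<^sub>R w) v)"
    by (auto simp: algebra_simps)
  have "\<exists>b>0. b < t \<and> FD g (z + a *\<^sub>R v + t *\<^sub>R w) v - FD g (z + a *\<^sub>R v + 0 *\<^sub>R w) v
      = (t - 0) * FD (\<lambda>x. FD g x v) (z + a *\<^sub>R v + b *\<^sub>R w) w"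
    by (rule MVT2[OF t]) (use a in \<open>intro d2; auto\<close>)
  then obtain b where b: "0 < b" "b < t" "FD g (z + a *\<^sub>R v + t *\<^sub>R w) v - FD g (z + a *\<^sub>R v + 0 *\<^sub>R w) v
      = t * FD (\<lambda>x. FD g x v) (z + a *\<^sub>R v + b *\<^sub>R w) w"
    by auto
  show ?thesis using that[of a b] a b by (simp add: power2_eq_square)
qed

lemma FD_symmetric_real:
  fixes g :: "'a::real_normed_vector \<Rightarrow> real"
  assumes S: "open S" "smooth_on S g" "z \<in> S"
  shows "FD (\<lambda>x. FD g x v) z w = FD (\<lambda>x. FD g x w) z v"
proof -
  define P Q where "P = (\<lambda>x. FD (\<lambda>x. FD g x v) x w)" and "Q = (\<lambda>x. FD (\<lambda>x. FD g x w) x v)"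
  have cont: "isCont P z" "isCont Q z"
    using S smooth_on_FD[OF smooth_on_FD[OF S(2)]] smooth_on_continuous_on continuous_on_eq_continuous_at
    unfolding P_def Q_def by blast+
  obtain e where e: "e > 0" "ball z e \<subseteq> S" using S(1,3) open_contains_ball by blast
  \<comment> \<open>Side lengths tending to 0 for which the parallelogram at \<open>z\<close>
    spanned by the multiples of \<open>v\<close> and \<open>w\<close> stays inside the ball. The
    summand 1 avoids a zero denominator when both vectors vanish.\<close>
  define t where "t = (\<lambda>n. e / (norm v + norm w + 1) / (real n + 1))"
  have K: "norm v + norm w + 1 > 0" by (simp add: add_nonneg_pos)
  have t0: "t n > 0" for n using e K by (auto simp: t_def)
  have te: "t n * (norm v + norm w) < e" for n
  proof -
    have "t n \<le> e / (norm v + norm w + 1)"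
      unfolding t_def using e K divide_left_mono[of 1 "real n + 1" "e / (norm v + norm w + 1)"] by simp
    then have "t n * (norm v + norm w) \<le> e / (norm v + norm w + 1) * (norm v + norm w)"
      by (intro mult_right_mono) auto
    also have "\<dots> < e" using e K by (simp add: field_simps)
    finally show ?thesis .
  qed
  have near: "dist (z + a *\<^sub>R v + b *\<^sub>R w) z \<le> t n * (norm v + norm w)"
    if "a \<in> {0..t n}" "b \<in> {0..t n}" for a b n
  proof -
    have "dist (z + a *\<^sub>R v + b *\<^sub>R w) z \<le> \<bar>a\<bar> * norm v + \<bar>b\<bar> * norm w"
      by (simp add: dist_norm add.assoc) (metis norm_triangle_ineq norm_scaleR)
    also have "\<dots> \<le> t n * norm v + t n * norm w" using that by (intro add_mono mult_right_mono) auto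
    finally show ?thesis by (simp add: algebra_simps)
  qed
  have in_S: "z + a *\<^sub>R v + b *\<^sub>R w \<in> S" if "a \<in> {0..t n}" "b \<in> {0..t n}" for a b n
    using near[OF that] te[of n] e(2) by (auto simp: dist_commute subset_iff)
  \<comment> \<open>Both mixed derivatives arise as mean values of one and the same second
    difference, at possibly different points; continuity at \<open>z\<close> then identifies their
    limits.\<close>
  have "\<exists>p q. dist p z \<le> t n * (norm v + norm w) \<and> dist q z \<le> t n * (norm v + norm w) \<and> P p = Q q" for n
  proof -
    obtain a b where ab: "a \<in> {0..t n}" "b \<in> {0..t n}"
      "g (z + t n *\<^sub>R v + t n *\<^sub>R w) - g (z + t n *\<^sub>R v) - g (z + t n *\<^sub>R w) + g z
        = (t n)\<^sup>2 * P (z + a *\<^sub>R v + b *\<^sub>R w)"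
      unfolding P_def by (rule second_difference_mvt[OF S(2) t0[of n] in_S])
    have in_S': "z + a *\<^sub>R w + b *\<^sub>R v \<in> S" if "a \<in> {0..t n}" "b \<in> {0..t n}" for a b
      using in_S[OF that(2,1)] by (simp add: add_ac)
    obtain c d where cd: "c \<in> {0..t n}" "d \<in> {0..t n}"
      "g (z + t n *\<^sub>R w + t n *\<^sub>R v) - g (z + t n *\<^sub>R w) - g (z + t n *\<^sub>R v) + g z
        = (t n)\<^sup>2 * Q (z + c *\<^sub>R w + d *\<^sub>R v)"
      unfolding Q_def by (rule second_difference_mvt[OF S(2) t0[of n] in_S'])
    have "(t n)\<^sup>2 * P (z + a *\<^sub>R v + b *\<^sub>R w) = (t n)\<^sup>2 * Q (z + d *\<^sub>R v + c *\<^sub>R w)"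
    proof -
      have eq: "z + t n *\<^sub>R w + t n *\<^sub>R v = z + t n *\<^sub>R v + t n *\<^sub>R w"
        "z + c *\<^sub>R w + d *\<^sub>R v = z + d *\<^sub>R v + c *\<^sub>R w"
        by (simp_all add: add_ac)
      show ?thesis using ab(3) cd(3) unfolding eq by linarith
    qed
    then have "P (z + a *\<^sub>R v + b *\<^sub>R w) = Q (z + d *\<^sub>R v + c *\<^sub>R w)" using t0[of n] by simp
    then show ?thesis using near ab cd by blast
  qed
  then obtain p q where pq: "\<And>n. dist (p n) z \<le> t n * (norm v + norm w)"
    "\<And>n. dist (q n) z \<le> t n * (norm v + norm w)" "\<And>n. P (p n) = Q (q n)"
    by metis
  have "t \<longlonglongrightarrow> 0"
    unfolding t_def using LIMSEQ_Suc[OF lim_const_over_n[of "e / (norm v + norm w + 1)"]]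
    by (simp add: add.commute)
  then have lim: "(\<lambda>n. t n * (norm v + norm w)) \<longlonglongrightarrow> 0" by (rule tendsto_mult_left_zero)
  have "p \<longlonglongrightarrow> z" "q \<longlonglongrightarrow> z"
    using pq(1,2) by (auto simp: tendsto_dist_iff[of _ z] intro!: tendsto_sandwich[OF _ _ tendsto_const lim])
  then have "(\<lambda>n. P (p n)) \<longlonglongrightarrow> P z" "(\<lambda>n. Q (q n)) \<longlonglongrightarrow> Q z"
    using cont isCont_tendsto_compose by blast+
  then show ?thesis using pq(3) LIMSEQ_unique unfolding P_def Q_def by auto
qed

text \<open>Testing against basis vectors reduces this to real values, where the mean value theorem
  applies.\<close>

lemma FD_symmetric:
  fixes h :: "'a::real_normed_vector \<Rightarrow> 'b::euclidean_space"
  assumes S: "open S" "smooth_on S h" "z \<in> S"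
  shows "FD (\<lambda>x. FD h x v) z w = FD (\<lambda>x. FD h x w) z v"
proof (rule euclidean_eqI)
  fix k :: 'b
  have D: "FD (\<lambda>x. f x \<bullet> k) y u = FD f y u \<bullet> k" if "smooth_on S f" "y \<in> S" for f y u
    using FD_eq[OF has_derivative_inner_left[OF smooth_on_has_derivative[OF that]]] by simp
  have s: "smooth_on S (\<lambda>x. h x \<bullet> k)"
    by (intro smooth_on_inner S smooth_on_const)
  have DD: "FD (\<lambda>x. FD (\<lambda>x. h x \<bullet> k) x u) z u' = FD (\<lambda>x. FD h x u) z u' \<bullet> k" for u u'
  proof -
    have "FD (\<lambda>x. FD h x u \<bullet> k) z = FD (\<lambda>x. FD (\<lambda>x. h x \<bullet> k) x u) z"
      by (rule FD_cong[OF S(1) smooth_on_FD[OF s] S(3)]) (simp add: D S)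
    then show ?thesis using D[OF smooth_on_FD[OF S(2)] S(3)] by metis
  qed
  show "FD (\<lambda>x. FD h x v) z w \<bullet> k = FD (\<lambda>x. FD h x w) z v \<bullet> k"
    using FD_symmetric_real[OF S(1) s S(3), of v w] by (simp add: DD)
qed

section \<open>Primitives and changes of parameter on intervals\<close>

lemma open_interval_antiderivative:
  fixes f :: "real \<Rightarrow> real"
  assumes I: "open_interval I" and f: "continuous_on I f" and s0: "s0 \<in> I"
  obtains F where "\<And>s. s \<in> I \<Longrightarrow> (F has_real_derivative f s) (at s)" "F s0 = c"
proof -
  define F where "F = (\<lambda>s. c + (LBINT y=s0..s. f y))"
  have "(F has_real_derivative f s) (at s)" if s: "s \<in> I" for s
  proof -
    obtain e where e: "e > 0" "ball s e \<subseteq> I" using I s open_contains_ball open_interval_def by metis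
    \<comment> \<open>The interval from \<open>a\<close> to \<open>b\<close> contains
      \<open>s0\<close> and has \<open>s\<close> in its interior, so the relative derivative given
      by the fundamental theorem on \<open>{a..b}\<close> is a derivative at
      \<open>s\<close>.\<close>
    define a b where "a = min s0 (s - e / 2)" and "b = max s0 (s + e / 2)"
    have "s - e / 2 \<in> I" "s + e / 2 \<in> I" using e by (auto simp: subset_iff dist_real_def)
    then have "a \<in> I" "b \<in> I" using s0 by (auto simp: a_def b_def min_def max_def)
    then have "{a..b} \<subseteq> I"
      using I mem_is_interval_1_I unfolding open_interval_def by (metis atLeastAtMost_iff subsetI)
    then have "((\<lambda>s. LBINT y=s0..s. f y) has_vector_derivative f s) (at s within {a..b})"
      by (intro interval_integral_FTC2 continuous_on_subset[OF f])
        (use e in \<open>auto simp: a_def b_def\<close>)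
    moreover have "at s within {a..b} = at s"
      by (rule at_within_interior) (use e(1) in \<open>auto simp: a_def b_def\<close>)
    ultimately have "((\<lambda>s. LBINT y=s0..s. f y) has_real_derivative f s) (at s)"
      by (simp add: has_real_derivative_iff_has_vector_derivative)
    then show ?thesis unfolding F_def by (auto intro!: derivative_eq_intros)
  qed
  then show ?thesis using that[of F] by (simp add: F_def)
qed

text \<open>The constant \<open>c\<close> carries the sign of \<psi>, so one argument serves
  increasing and decreasing \<tau>: \<open>c * \<tau> s\<close> increases either way. Smoothness of
  the inverse is a bootstrap, since its derivative is \<open>inverse (\<psi> s)\<close> with
  \<open>s\<close> expressed through the inverse itself.\<close>

lemma diffeo_intervals_of_deriv:
  assumes I: "open_interval I" and d: "\<And>s. s \<in> I \<Longrightarrow> (\<tau> has_real_derivative \<psi> s) (at s)"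
    and \<psi>: "smooth_on I \<psi>" and sgn: "\<And>s. s \<in> I \<Longrightarrow> 0 < c * \<psi> s"
  shows "open_interval (\<tau> ` I)" "diffeo_intervals I (\<tau> ` I) \<tau>"
    "\<And>s. s \<in> I \<Longrightarrow> (inv_into I \<tau> has_real_derivative inverse (\<psi> s)) (at (\<tau> s))"
proof -
  have opI: "open I" "is_interval I" "I \<noteq> {}" using I by (auto simp: open_interval_def)
  have sm: "smooth_on I \<tau>"
    by (rule smooth_on_antiderivative[OF opI(1) _ \<psi>])
      (use d in \<open>simp add: has_real_derivative_iff_has_vector_derivative\<close>)
  note cont = smooth_on_continuous_on[OF sm]
  have mono: "c * \<tau> s < c * \<tau> s'" if "s \<in> I" "s' \<in> I" "s < s'" for s s'
  proof (rule DERIV_pos_imp_increasing[OF that(3)])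
    fix x assume "s \<le> x" "x \<le> s'"
    then have "x \<in> I" using that opI(2) mem_is_interval_1_I by metis
    then show "\<exists>y. ((\<lambda>s. c * \<tau> s) has_real_derivative y) (at x) \<and> 0 < y"
      using DERIV_cmult[OF d] sgn by blast
  qed
  have inj: "inj_on \<tau> I"
    by (rule inj_onI) (metis mono linorder_neq_iff)
  have ne: "\<psi> s \<noteq> 0" if "s \<in> I" for s using sgn[OF that] by auto
  have opJ: "open (\<tau> ` I)" using injective_into_1d_imp_open_map_UNIV[OF opI(1) cont inj] by simp
  show "open_interval (\<tau> ` I)"
    unfolding open_interval_def
    using opJ opI connected_continuous_image[OF cont] is_interval_connected_1 by auto
  show dinv: "(inv_into I \<tau> has_real_derivative inverse (\<psi> s)) (at (\<tau> s))" if "s \<in> I" for s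
    unfolding has_field_derivative_def
    by (rule has_derivative_inverse_strong[OF opI(1) that cont _ d[OF that, unfolded has_field_derivative_def]])
      (use inj ne[OF that] in \<open>auto simp: fun_eq_iff\<close>)
  have "Ck_on k (\<tau> ` I) (inv_into I \<tau>)" for k
  proof (induction k)
    case 0
    show ?case by (auto intro!: continuous_at_imp_continuous_on DERIV_isCont[OF dinv])
  next
    case (Suc k)
    show ?case
    proof (rule Ck_on_derivI[OF opJ])
      show "(inv_into I \<tau> has_derivative (\<lambda>v. v *\<^sub>R inverse (\<psi> (inv_into I \<tau> u)))) (at u)"
        if u: "u \<in> \<tau> ` I" for u
      proof -
        obtain s where s: "s \<in> I" "u = \<tau> s" using u by blast
        show ?thesis
          unfolding s(2)
          by (rule has_derivative_eq_rhs[OF dinv[OF s(1), unfolded has_field_derivative_def]])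
            (use inj s in \<open>simp add: fun_eq_iff\<close>)
      qed
      have "Ck_on k (\<tau> ` I) (\<lambda>u. inverse (\<psi> (inv_into I \<tau> u)))"
        by (rule Ck_on_compose[OF opJ opI(1) _ Suc, of "\<lambda>s. inverse (\<psi> s)"])
          (use smooth_on_inverse[OF opI(1) \<psi> ne] inj in \<open>auto simp: smooth_on_def\<close>)
      then show "Ck_on k (\<tau> ` I) (\<lambda>u. v *\<^sub>R inverse (\<psi> (inv_into I \<tau> u)))" for v
        by (intro Ck_on_bilinear[OF bounded_bilinear_scaleR opJ] Ck_on_const)
    qed
  qed
  then show "diffeo_intervals I (\<tau> ` I) \<tau>"
    using inj sm by (auto simp: diffeo_intervals_def smooth_on_def intro: inj_on_imp_bij_betw)
qed

section \<open>Linear algebra\<close>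

lemma linear_inj_imp_surj_DIM:
  fixes L :: "'k::euclidean_space \<Rightarrow> 'w::euclidean_space"
  assumes "linear L" "inj L" "DIM('k) = DIM('w)"
  shows "surj L"
proof -
  have "dim (range L) = DIM('w)"
    using dim_image_eq[of L UNIV] assms by simp
  then show ?thesis
    using dim_eq_full[of "range L"] linear_subspace_image[OF assms(1) subspace_UNIV] span_eq_iff by metis
qed

text \<open>The range has codimension one and \<xi> lies outside it, so together they span the space
  and \<open>v\<close> is orthogonal to itself. This supplies nondegeneracy for spheres and parallel
  hyperplanes, with the normal of the sphere or hyperplane as \<xi>.\<close>

lemma orthogonal_to_range_and_transversal:
  fixes L :: "'e::euclidean_space \<times> real \<Rightarrow> 'w::euclidean_space"
  assumes L: "linear L" "inj L" and dims: "DIM('w) = DIM('e) + 2" and \<xi>: "\<xi> \<notin> range L"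
    and v: "\<And>Z. v \<bullet> L Z = 0" "v \<bullet> \<xi> = 0"
  shows "v = 0"
proof -
  define K where "K = (\<lambda>p. L (fst p) + snd p *\<^sub>R \<xi>)"
  have "linear K"
    unfolding K_def
    by (rule linearI) (simp_all add: algebra_simps linear_add[OF L(1)] linear_scale[OF L(1)])
  moreover have "inj K"
    unfolding linear_injective_0[OF \<open>linear K\<close>]
  proof (intro allI impI)
    fix p assume "K p = 0"
    then have 0: "L (fst p) + snd p *\<^sub>R \<xi> = 0" by (simp add: K_def)
    have b: "snd p = 0"
    proof (rule ccontr)
      assume "snd p \<noteq> 0"
      then have "\<xi> = L ((- 1 / snd p) *\<^sub>R fst p)"
        using 0 unfolding linear_scale[OF L(1)] by (simp add: add_eq_0_iff2 divide_simps)
      then show False using \<xi> by blast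
    qed
    then have "fst p = 0"
      using 0 L(2) linear_injective_0[OF L(1)] by (metis add.right_neutral scale_zero_left)
    with b show "p = 0" by (simp add: prod_eq_iff)
  qed
  ultimately have "surj K" by (rule linear_inj_imp_surj_DIM) (simp add: dims)
  then obtain k where "v = K k" by (metis surjD)
  then have "v \<bullet> v = 0" using v by (auto simp: K_def inner_right_distrib split: prod.splits)
  then show ?thesis by simp
qed

section \<open>Reflections and the normal part of a second derivative\<close>

lemma orthogonal_transformation_reflection:
  fixes a b :: "'v::euclidean_space"
  assumes "norm a = norm b"
  obtains T where "orthogonal_transformation T" "T a = b" "\<And>x. x \<bullet> a = x \<bullet> b \<Longrightarrow> T x = x"
proof -
  define w where "w = a - b"
  \<comment> \<open>The reflection in the hyperplane orthogonal to \<open>a - b\<close>; for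
    \<open>a = b\<close> the formula degenerates to the identity.\<close>
  define T where "T = (\<lambda>x. x - (2 * (x \<bullet> w) / (w \<bullet> w)) *\<^sub>R w)"
  have "orthogonal_transformation T"
    unfolding orthogonal_transformation_def
  proof
    show "linear T"
      unfolding T_def by (rule linearI) (auto simp: algebra_simps add_divide_distrib)
    show "\<forall>v u. T v \<bullet> T u = v \<bullet> u"
      by (cases "w = 0") (auto simp: T_def algebra_simps inner_commute)
  qed
  moreover have "T a = b"
  proof (cases "w = 0")
    case False
    have "a \<bullet> a = b \<bullet> b" using assms by (simp add: norm_eq)
    then have "2 * (a \<bullet> w) = w \<bullet> w" by (simp add: w_def algebra_simps inner_commute)
    then show ?thesis using False by (simp add: T_def) (simp add: w_def)
  qed (simp add: T_def w_def)
  moreover have "T x = x" if "x \<bullet> a = x \<bullet> b" for x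
    using that by (simp add: T_def w_def inner_diff_right)
  ultimately show ?thesis using that by blast
qed

text \<open>The second reflection carries the image of \<open>b\<close> to \<open>b'\<close> without
  disturbing \<open>a'\<close>: that vector has inner product 0 with both of them and hence lies in
  the mirror.\<close>

lemma orthogonal_transformation_pair:
  fixes a b a' b' :: "'v::euclidean_space"
  assumes "norm a = 1" "norm b = 1" "a \<bullet> b = 0" "norm a' = 1" "norm b' = 1" "a' \<bullet> b' = 0"
  obtains T where "orthogonal_transformation T" "T a = a'" "T b = b'"
proof -
  obtain T1 where T1: "orthogonal_transformation T1" "T1 a = a'"
    using orthogonal_transformation_reflection[of a a'] assms by metis
  have n: "norm (T1 b) = norm b'" using T1 orthogonal_transformation_norm assms by metis
  obtain T2 where T2: "orthogonal_transformation T2" "T2 (T1 b) = b'"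
    "\<And>x. x \<bullet> T1 b = x \<bullet> b' \<Longrightarrow> T2 x = x"
    using orthogonal_transformation_reflection[OF n] by metis
  have "a' \<bullet> T1 b = a' \<bullet> b'"
    using T1 assms unfolding orthogonal_transformation_def by metis
  then have "T2 (T1 a) = a'" using T2(3) T1(2) by simp
  then show ?thesis
    using that[of "T2 \<circ> T1"] orthogonal_transformation_compose[OF T2(1) T1(1)] T2(2) by simp
qed

text \<open>Orthogonal decomposition along the tangent space shows that the description under
  \<open>THE\<close> has exactly one solution, the normal part of \<open>D\<close>. When it is 0,
  only the tangential part is left.\<close>

lemma second_fundamental_form_eq_0D:
  fixes f :: "'p \<Rightarrow> 'v::euclidean_space"
  assumes lin: "linear (differential c f p)" and 0: "second_fundamental_form c f p X Y = 0"
  shows "FD (\<lambda>y. FD (coord_rep c f) y Y) (snd c p) X \<in> tangent_image c f p"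
proof -
  define D S where "D = FD (\<lambda>y. FD (coord_rep c f) y Y) (snd c p) X" and "S = tangent_image c f p"
  have S: "subspace S"
    unfolding S_def tangent_image_def using linear_subspace_image[OF lin subspace_UNIV] .
  define P where "P = (\<lambda>\<xi>. (\<forall>t\<in>S. \<xi> \<bullet> t = 0) \<and> D - \<xi> \<in> S)"
  obtain y z where "y \<in> span S" "\<And>w. w \<in> span S \<Longrightarrow> orthogonal z w" "D = y + z"
    using orthogonal_subspace_decomp_exists by blast
  then have Pz: "P z" using S by (auto simp: P_def orthogonal_def span_eq_iff[THEN iffD2])
  have "\<xi> = z" if "P \<xi>" for \<xi>
  proof -
    have "(D - z) - (D - \<xi>) \<in> S" using that Pz S subspace_diff unfolding P_def by blast
    then have "\<xi> - z \<in> S" by simp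
    then have "(\<xi> - z) \<bullet> (\<xi> - z) = 0" using that Pz unfolding P_def by (metis inner_diff_left diff_self)
    then show ?thesis by simp
  qed
  with Pz have "(THE \<xi>. P \<xi>) = z" by (rule the_equality)
  then have "z = 0" using 0 unfolding second_fundamental_form_def P_def D_def S_def by simp
  then show ?thesis using Pz by (simp add: P_def D_def S_def)
qed

section \<open>Maps on the product of a manifold with an interval\<close>

text \<open>Agrees with \<open>coord_rep\<close> of the product chart on its image, but leaves the
  second coordinate untouched, so that slices in \<open>z\<close> and in \<open>s\<close> are
  immediate.\<close>

definition chart_rep :: "'p set \<Rightarrow> ('p \<Rightarrow> 'e) \<Rightarrow> ('p \<times> real \<Rightarrow> 'v) \<Rightarrow> 'e \<times> real \<Rightarrow> 'v"
  where "chart_rep U \<phi> f = (\<lambda>(z, s). f (inv_into U \<phi> z, s))"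

lemma has_derivative_slice:
  assumes "(h has_derivative h') (at (z, s))"
  shows "((\<lambda>z. h (z, s)) has_derivative (\<lambda>X. h' (X, 0))) (at z)"
proof -
  have "((\<lambda>z. (z, s)) has_derivative (\<lambda>X. (X, 0))) (at z)"
    by (auto intro!: derivative_eq_intros)
  from diff_chain_at[OF this assms] show ?thesis by (simp add: o_def)
qed

lemma has_vector_derivative_slice:
  assumes "(h has_derivative h') (at (z, s))"
  shows "((\<lambda>s. h (z, s)) has_vector_derivative h' (0, 1)) (at s)"
  using has_vector_derivative_along_line[of h h' "(z, 0)" s "(0, 1)"] assms by simp

text \<open>The device for differentiating identities in \<open>s\<close>: \<open>k\<close> is an
  expression known to be constant on \<open>I\<close>, \<open>d\<close> its derivative by the
  product rule, and the conclusion is the new identity.\<close>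

lemma has_vector_derivative_eq_0:
  assumes "open I" "s \<in> I" "\<And>s. s \<in> I \<Longrightarrow> k s = c" "(k has_vector_derivative d) (at s)"
  shows "d = 0"
proof -
  have "((\<lambda>s. c) has_vector_derivative d) (at s)"
    using has_vector_derivative_transform_within_open[OF assms(4,1,2)] assms(3) by metis
  then show ?thesis
    using vector_derivative_unique_at[OF _ has_vector_derivative_const] by metis
qed

section \<open>Charts of the product and functions on it\<close>

locale product_manifold =
  fixes A :: "('p::topological_space, 'e::euclidean_space) chart set" and I :: "real set"
  assumes atlas: "smooth_atlas A" and connected_base: "connected (UNIV :: 'p set)"
    and interval: "open_interval I"
begin

lemma open_I: "open I" and interval_I: "is_interval I" and nonempty_I: "I \<noteq> {}"
  using interval by (auto simp: open_interval_def)

lemma chartD: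
  assumes "(U, \<phi>) \<in> A"
  shows "open U" "open (\<phi> ` U)" "inj_on \<phi> U" "continuous_on U \<phi>"
proof -
  have "is_chart (U, \<phi>)" using atlas assms by (auto simp: smooth_atlas_def)
  then have *: "open U" "open (\<phi> ` U)" "homeomorphism U (\<phi> ` U) \<phi> (inv_into U \<phi>)"
    by (auto simp: is_chart_def)
  show "open U" "open (\<phi> ` U)" by fact+
  show "inj_on \<phi> U" "continuous_on U \<phi>"
    using *(3) by (auto simp: homeomorphism_def intro: inj_on_inverseI)
qed

lemma chart_at: obtains U \<phi> where "(U, \<phi>) \<in> A" "x \<in> U"
proof -
  have "x \<in> (\<Union>c\<in>A. fst c)" using atlas by (auto simp: smooth_atlas_def)
  then show ?thesis using that by auto
qed

lemma open_chart_image: "(U, \<phi>) \<in> A \<Longrightarrow> open (\<phi> ` U \<times> I)"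
  by (intro open_Times chartD open_I)

lemma chart_rep_apply: "(U, \<phi>) \<in> A \<Longrightarrow> x \<in> U \<Longrightarrow> chart_rep U \<phi> f (\<phi> x, s) = f (x, s)"
  by (simp add: chart_rep_def chartD)

lemma coord_rep_product:
  assumes "(U, \<phi>) \<in> A" "z \<in> \<phi> ` U \<times> I"
  shows "coord_rep (U \<times> I, map_prod \<phi> id) f z = chart_rep U \<phi> f z"
proof -
  obtain x s where x: "x \<in> U" "s \<in> I" "z = (\<phi> x, s)" using assms(2) by auto
  have "inv_into (U \<times> I) (map_prod \<phi> id) (\<phi> x, s) = (x, s)"
    using inv_into_f_f[OF map_prod_inj_on[OF chartD(3)[OF assms(1)] inj_on_id[of I]], of "(x, s)"] x
    by simp
  then show ?thesis using x assms(1) by (simp add: coord_rep_def chart_rep_apply)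
qed

lemma product_chart: "(U, \<phi>) \<in> A \<Longrightarrow> (U \<times> I, map_prod \<phi> id) \<in> product_atlas A I"
  by (force simp: product_atlas_def)

lemma smooth_chart_rep:
  assumes "smooth_map (product_atlas A I) f" "(U, \<phi>) \<in> A"
  shows "smooth_on (\<phi> ` U \<times> I) (chart_rep U \<phi> f)"
proof -
  have "map_prod \<phi> id ` (U \<times> I) = \<phi> ` U \<times> I" by (auto simp: image_iff)
  then have "smooth_on (\<phi> ` U \<times> I) (coord_rep (U \<times> I, map_prod \<phi> id) f)"
    using assms product_chart unfolding smooth_map_def by fastforce
  then show ?thesis
    by (rule smooth_on_cong[OF open_chart_image[OF assms(2)]]) (rule coord_rep_product[OF assms(2)])
qed

lemma FD_coord_rep_product:
  assumes "smooth_map (product_atlas A I) f" "(U, \<phi>) \<in> A" "z \<in> \<phi> ` U \<times> I"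
  shows "FD (coord_rep (U \<times> I, map_prod \<phi> id) f) z = FD (chart_rep U \<phi> f) z"
  by (rule FD_cong[OF open_chart_image[OF assms(2)] smooth_chart_rep[OF assms(1,2)] assms(3)])
    (simp add: coord_rep_product[OF assms(2)])

lemma differential_product:
  assumes "smooth_map (product_atlas A I) f" "(U, \<phi>) \<in> A" "x \<in> U" "s \<in> I"
  shows "differential (U \<times> I, map_prod \<phi> id) f (x, s) = FD (chart_rep U \<phi> f) (\<phi> x, s)"
  unfolding differential_def using FD_coord_rep_product[OF assms(1,2)] assms(3,4) by simp

text \<open>A vanishing derivative gives constancy only on coordinate balls; connectedness of the
  base makes these local constants agree.\<close>

lemma locally_constant_on_base:
  fixes b :: "'p \<Rightarrow> 'w::real_normed_vector"
  assumes "\<And>U \<phi> x. (U, \<phi>) \<in> A \<Longrightarrow> x \<in> U \<Longrightarrow> ((b \<circ> inv_into U \<phi>) has_derivative (\<lambda>_. 0)) (at (\<phi> x))"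
  shows "b x = b x'"
proof -
  have "\<exists>T. openin (top_of_set UNIV) T \<and> a \<in> T \<and> (\<forall>x\<in>T. b x = b a)" for a
  proof -
    obtain U \<phi> where U: "(U, \<phi>) \<in> A" "a \<in> U" by (rule chart_at)
    obtain e where e: "e > 0" "ball (\<phi> a) e \<subseteq> \<phi> ` U"
      using chartD(2)[OF U(1)] U(2) open_contains_ball by blast
    have d: "((b \<circ> inv_into U \<phi>) has_derivative (\<lambda>_. 0)) (at z)" if "z \<in> ball (\<phi> a) e" for z
      using subsetD[OF e(2) that] assms[OF U(1)] by blast
    have eq: "(b \<circ> inv_into U \<phi>) z = (b \<circ> inv_into U \<phi>) (\<phi> a)" if "z \<in> ball (\<phi> a) e" for z
      by (rule has_derivative_zero_unique_connected[of "ball (\<phi> a) e"])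
        (use that e d in \<open>simp_all del: o_apply\<close>)
    have "b x = b a" if "x \<in> U \<inter> \<phi> -` ball (\<phi> a) e" for x
      using eq[of "\<phi> x"] that U(2) chartD(3)[OF U(1)] by simp
    moreover have "open (U \<inter> \<phi> -` ball (\<phi> a) e)"
      by (rule continuous_open_preimage[OF chartD(4)[OF U(1)] chartD(1)[OF U(1)] open_ball])
    moreover have "a \<in> U \<inter> \<phi> -` ball (\<phi> a) e" using U(2) e(1) by simp
    ultimately show ?thesis unfolding subtopology_UNIV open_openin[symmetric] by blast
  qed
  then have "b constant_on UNIV"
    by (intro locally_constant_imp_constant[OF connected_base]) blast
  then show ?thesis by (auto simp: constant_on_def)
qed

lemma smooth_on_slice:
  fixes h :: "'e \<times> real \<Rightarrow> 'w::euclidean_space"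
  assumes "(U, \<phi>) \<in> A" "smooth_on (\<phi> ` U \<times> I) h"
  shows "s \<in> I \<Longrightarrow> smooth_on (\<phi> ` U) (\<lambda>z. h (z, s))" "x \<in> U \<Longrightarrow> smooth_on I (\<lambda>s. h (\<phi> x, s))"
proof -
  show "smooth_on (\<phi> ` U) (\<lambda>z. h (z, s))" if "s \<in> I"
    by (rule smooth_on_compose[OF _ open_chart_image[OF assms(1)] _ _ assms(2)])
      (use that chartD[OF assms(1)] in \<open>auto intro!: smooth_on_Pair smooth_on_const smooth_on_bounded_linear[OF bounded_linear_ident]\<close>)
  show "smooth_on I (\<lambda>s. h (\<phi> x, s))" if "x \<in> U"
    by (rule smooth_on_compose[OF _ open_chart_image[OF assms(1)] _ _ assms(2)])
      (use that open_I in \<open>auto intro!: smooth_on_Pair smooth_on_const smooth_on_bounded_linear[OF bounded_linear_ident]\<close>)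
qed

lemma smooth_on_curve:
  fixes f :: "'p \<times> real \<Rightarrow> 'w::euclidean_space"
  assumes "\<And>U \<phi>. (U, \<phi>) \<in> A \<Longrightarrow> smooth_on (\<phi> ` U \<times> I) (chart_rep U \<phi> f)"
  shows "smooth_on I (\<lambda>s. f (x, s))"
proof -
  obtain U \<phi> where U: "(U, \<phi>) \<in> A" "x \<in> U" by (rule chart_at)
  show ?thesis
    using smooth_on_slice(2)[OF U(1) assms[OF U(1)] U(2)] by (simp add: chart_rep_apply[OF U])
qed

lemma curve_derivative:
  assumes "(U, \<phi>) \<in> A" "x \<in> U" "s \<in> I" "smooth_on (\<phi> ` U \<times> I) (chart_rep U \<phi> f)"
  shows "((\<lambda>s. f (x, s)) has_vector_derivative FD (chart_rep U \<phi> f) (\<phi> x, s) (0, 1)) (at s)"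
  using has_vector_derivative_slice[OF smooth_on_has_derivative[OF assms(4)], of "\<phi> x" s] assms(2,3)
  by (simp add: chart_rep_apply[OF assms(1,2)])

end

section \<open>Orthogonal families with parallel leaves\<close>

lemma C\<epsilon>_S\<epsilon>:
  assumes "\<epsilon> \<in> {-1, 0, 1}"
  shows "(C\<epsilon> \<epsilon> has_real_derivative - (of_int \<epsilon> * S\<epsilon> \<epsilon> u)) (at u)"
    "(S\<epsilon> \<epsilon> has_real_derivative C\<epsilon> \<epsilon> u) (at u)"
    "(C\<epsilon> \<epsilon> u)\<^sup>2 + of_int \<epsilon> * (S\<epsilon> \<epsilon> u)\<^sup>2 = 1" "C\<epsilon> \<epsilon> 0 = 1" "S\<epsilon> \<epsilon> 0 = 0"
  using assms
  by (auto simp: C\<epsilon>_def[abs_def] S\<epsilon>_def[abs_def] cosh_square_eq intro!: derivative_eq_intros)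

text \<open>The common core of the three cases: \<open>y\<close> is the space form component of the
  map to be found, and \<open>B\<close> the flat scalar product. \<open>speed_parallel\<close> is
  half of the statement that the squared speed has zero derivative along leaves.
  \<open>nondegenerate\<close> says that leaf directions, velocity and, in the curved cases,
  position leave no room for a further orthogonal vector. Positivity is required only of velocity
  and leaf vectors, because \<open>B\<close> may be indefinite.\<close>

locale orthogonal_family = product_manifold A I
  for A :: "('p::topological_space, 'e::euclidean_space) chart set" and I +
  fixes B :: "'w::euclidean_space \<Rightarrow> 'w \<Rightarrow> real" and \<epsilon> :: int and y :: "'p \<times> real \<Rightarrow> 'w"
  assumes bilinear: "bounded_bilinear B" and sym: "\<And>u v. B u v = B v u"
    and \<epsilon>: "\<epsilon> \<in> {-1, 0, 1}"
    and smooth: "\<And>U \<phi>. (U, \<phi>) \<in> A \<Longrightarrow> smooth_on (\<phi> ` U \<times> I) (chart_rep U \<phi> y)"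
    and curvature: "\<And>x s. \<epsilon> \<noteq> 0 \<Longrightarrow> s \<in> I \<Longrightarrow> B (y (x, s)) (y (x, s)) = of_int \<epsilon>"
    and orth: "\<And>U \<phi> z X. (U, \<phi>) \<in> A \<Longrightarrow> z \<in> \<phi> ` U \<times> I \<Longrightarrow>
      B (FD (chart_rep U \<phi> y) z (X, 0)) (FD (chart_rep U \<phi> y) z (0, 1)) = 0"
    and speed_parallel: "\<And>U \<phi> z X. (U, \<phi>) \<in> A \<Longrightarrow> z \<in> \<phi> ` U \<times> I \<Longrightarrow>
      B (FD (\<lambda>z. FD (chart_rep U \<phi> y) z (0, 1)) z (X, 0)) (FD (chart_rep U \<phi> y) z (0, 1)) = 0"
    and pos_speed: "\<And>U \<phi> z. (U, \<phi>) \<in> A \<Longrightarrow> z \<in> \<phi> ` U \<times> I \<Longrightarrow>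
      B (FD (chart_rep U \<phi> y) z (0, 1)) (FD (chart_rep U \<phi> y) z (0, 1)) > 0"
    and pos_leaf: "\<And>U \<phi> z X. (U, \<phi>) \<in> A \<Longrightarrow> z \<in> \<phi> ` U \<times> I \<Longrightarrow> X \<noteq> 0 \<Longrightarrow>
      B (FD (chart_rep U \<phi> y) z (X, 0)) (FD (chart_rep U \<phi> y) z (X, 0)) > 0"
    and nondegenerate: "\<And>U \<phi> z v. (U, \<phi>) \<in> A \<Longrightarrow> z \<in> \<phi> ` U \<times> I \<Longrightarrow>
      (\<And>X. B v (FD (chart_rep U \<phi> y) z (X, 0)) = 0) \<Longrightarrow> B v (FD (chart_rep U \<phi> y) z (0, 1)) = 0 \<Longrightarrow>
      (\<epsilon> \<noteq> 0 \<Longrightarrow> B v (chart_rep U \<phi> y z) = 0) \<Longrightarrow> v = 0"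
begin

sublocale B: bounded_bilinear B by (rule bilinear)

definition velocity :: "'p \<Rightarrow> real \<Rightarrow> 'w" where
  "velocity x s = vector_derivative (\<lambda>s. y (x, s)) (at s)"

text \<open>The base point \<open>undefined\<close> is arbitrary: the speed does not depend on it.\<close>

definition speed :: "real \<Rightarrow> real" where
  "speed s = sqrt (B (velocity undefined s) (velocity undefined s))"

lemma velocity_eq:
  assumes "(U, \<phi>) \<in> A" "x \<in> U" "s \<in> I"
  shows "velocity x s = FD (chart_rep U \<phi> y) (\<phi> x, s) (0, 1)"
  unfolding velocity_def
  by (rule vector_derivative_at[OF curve_derivative[OF assms smooth[OF assms(1)]]])

lemma has_velocity:
  assumes "s \<in> I" shows "((\<lambda>s. y (x, s)) has_vector_derivative velocity x s) (at s)"
proof -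
  obtain U \<phi> where U: "(U, \<phi>) \<in> A" "x \<in> U" by (rule chart_at)
  show ?thesis
    using curve_derivative[OF U assms smooth[OF U(1)]] velocity_eq[OF U assms] by simp
qed

text \<open>By symmetry of \<open>B\<close>, the derivative of the squared speed along a leaf is
  twice the expression in \<open>speed_parallel\<close>.\<close>

lemma velocity_square_const:
  assumes s: "s \<in> I"
  shows "B (velocity x s) (velocity x s) = B (velocity x' s) (velocity x' s)"
proof (rule locally_constant_on_base)
  fix U \<phi> x assume U: "(U, \<phi>) \<in> A" "x \<in> U"
  define G where "G = (\<lambda>z. FD (chart_rep U \<phi> y) z (0, 1))"
  have z: "(\<phi> x, s) \<in> \<phi> ` U \<times> I" using U s by auto
  have "(G has_derivative FD G (\<phi> x, s)) (at (\<phi> x, s))"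
    using smooth_on_has_derivative[OF smooth_on_FD[OF smooth[OF U(1)]] z] by (simp add: G_def)
  then have d: "((\<lambda>z. G (z, s)) has_derivative (\<lambda>X. FD G (\<phi> x, s) (X, 0))) (at (\<phi> x))"
    by (rule has_derivative_slice)
  have "B (G (\<phi> x, s)) (FD G (\<phi> x, s) (X, 0)) + B (FD G (\<phi> x, s) (X, 0)) (G (\<phi> x, s)) = 0" for X
    using speed_parallel[OF U(1) z, of X] sym[of "G (\<phi> x, s)" "FD G (\<phi> x, s) (X, 0)"]
    unfolding G_def by linarith
  then have d0: "((\<lambda>z. B (G (z, s)) (G (z, s))) has_derivative (\<lambda>_. 0)) (at (\<phi> x))"
    using B.FDERIV[OF d d] by simp
  have "B (G (z, s)) (G (z, s)) = ((\<lambda>x. B (velocity x s) (velocity x s)) \<circ> inv_into U \<phi>) z"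
    if "z \<in> \<phi> ` U" for z
  proof -
    obtain x' where x': "x' \<in> U" "z = \<phi> x'" using \<open>z \<in> \<phi> ` U\<close> by blast
    then show ?thesis
      using velocity_eq[OF U(1) x'(1) s] chartD(3)[OF U(1)] by (simp add: G_def)
  qed
  then show "((\<lambda>x. B (velocity x s) (velocity x s)) \<circ> inv_into U \<phi> has_derivative (\<lambda>_. 0)) (at (\<phi> x))"
    by (rule has_derivative_transform_within_open[OF d0 chartD(2)[OF U(1)] imageI[OF U(2)]])
qed

lemma velocity_square_pos:
  assumes "s \<in> I" shows "B (velocity x s) (velocity x s) > 0"
proof -
  obtain U \<phi> where U: "(U, \<phi>) \<in> A" "x \<in> U" by (rule chart_at)
  show ?thesis
    unfolding velocity_eq[OF U assms] by (rule pos_speed[OF U(1)]) (use U assms in auto)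
qed

lemma speed_pos: "s \<in> I \<Longrightarrow> speed s > 0"
  unfolding speed_def using velocity_square_pos by simp

lemma speed_square: "s \<in> I \<Longrightarrow> B (velocity x s) (velocity x s) = (speed s)\<^sup>2"
  unfolding speed_def using velocity_square_pos[of s undefined] velocity_square_const[of s x undefined] by simp

lemma smooth_velocity: "smooth_on I (velocity x)"
  unfolding velocity_def by (intro smooth_on_vector_derivative open_I smooth_on_curve smooth)

lemma smooth_speed: "smooth_on I speed"
  unfolding speed_def
  by (intro smooth_on_sqrt smooth_on_bilinear[OF bilinear] open_I smooth_velocity velocity_square_pos)

lemma velocity_orth_position:
  assumes "\<epsilon> \<noteq> 0" "s \<in> I" shows "B (y (x, s)) (velocity x s) = 0"
proof -
  have "B (y (x, s)) (velocity x s) + B (velocity x s) (y (x, s)) = 0"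
    by (rule has_vector_derivative_eq_0[OF open_I assms(2) _ B.has_vector_derivative[OF has_velocity[OF assms(2)] has_velocity[OF assms(2)]]])
      (use curvature assms in auto)
  then show ?thesis using sym[of "velocity x s" "y (x, s)"] by simp
qed

lemma leaf_orth_position:
  assumes "\<epsilon> \<noteq> 0" "(U, \<phi>) \<in> A" "z \<in> \<phi> ` U \<times> I"
  shows "B (chart_rep U \<phi> y z) (FD (chart_rep U \<phi> y) z Z) = 0"
proof -
  let ?h = "chart_rep U \<phi> y"
  have d: "(?h has_derivative FD ?h z) (at z)"
    by (rule smooth_on_has_derivative[OF smooth[OF assms(2)] assms(3)])
  have "B (?h u) (?h u) = of_int \<epsilon>" if "u \<in> \<phi> ` U \<times> I" for u
    using that curvature[OF assms(1)] by (auto simp: chart_rep_def)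
  then have "((\<lambda>_. of_int \<epsilon>) has_derivative (\<lambda>Z. B (?h z) (FD ?h z Z) + B (FD ?h z Z) (?h z))) (at z)"
    by (rule has_derivative_transform_within_open[OF B.FDERIV[OF d d] open_chart_image[OF assms(2)] assms(3)])
  from fun_cong[OF has_derivative_unique[OF this has_derivative_const]]
  have "B (?h z) (FD ?h z Z) + B (FD ?h z Z) (?h z) = 0" .
  then show ?thesis using sym[of "FD ?h z Z" "?h z"] by simp
qed

text \<open>Differentiating \<open>orth\<close> in \<open>s\<close> gives B(y_ss, y_X) + B(y_s,
  y_Xs) = 0; after exchanging the derivatives, the second term vanishes by
  \<open>speed_parallel\<close>. Geometrically, the curves \<open>s \<mapsto> y (x, s)\<close> turn
  neither left nor right along the leaf.\<close>

lemma acceleration_orth_leaf: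
  assumes U: "(U, \<phi>) \<in> A" "x \<in> U" and s: "s \<in> I"
    and d: "(velocity x has_vector_derivative a) (at s)"
  shows "B a (FD (chart_rep U \<phi> y) (\<phi> x, s) (X, 0)) = 0"
proof -
  let ?h = "chart_rep U \<phi> y"
  have z: "(\<phi> x, s) \<in> \<phi> ` U \<times> I" using U s by auto
  have dX: "((\<lambda>s. FD ?h (\<phi> x, s) (X, 0)) has_vector_derivative FD (\<lambda>z. FD ?h z (X, 0)) (\<phi> x, s) (0, 1)) (at s)"
    by (rule has_vector_derivative_slice[OF smooth_on_has_derivative[OF smooth_on_FD[OF smooth[OF U(1)]] z]])
  have "B (velocity x r) (FD ?h (\<phi> x, r) (X, 0)) = 0" if "r \<in> I" for r
    using orth[OF U(1), of "(\<phi> x, r)" X] U that sym[of "velocity x r"] velocity_eq[OF U that] by simp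
  then have "B (velocity x s) (FD (\<lambda>z. FD ?h z (X, 0)) (\<phi> x, s) (0, 1)) + B a (FD ?h (\<phi> x, s) (X, 0)) = 0"
    by (rule has_vector_derivative_eq_0[OF open_I s _ B.has_vector_derivative[OF d dX]])
  moreover have "FD (\<lambda>z. FD ?h z (X, 0)) (\<phi> x, s) (0, 1) = FD (\<lambda>z. FD ?h z (0, 1)) (\<phi> x, s) (X, 0)"
    by (rule FD_symmetric[OF open_chart_image[OF U(1)] smooth[OF U(1)] z])
  ultimately show ?thesis
    using speed_parallel[OF U(1) z, of X] velocity_eq[OF U s] sym[of "velocity x s"] by simp
qed

text \<open>The difference of the two sides is orthogonal to everything \<open>nondegenerate\<close>
  asks for: to the leaf since acceleration, velocity and position are, to the velocity because
  \<open>N\<close> has constant length, and to the position by differentiating B(N, y) = 0. The sign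
  \<sigma> is left open; the height function will fix it.\<close>

lemma unit_normal_derivative:
  assumes \<sigma>: "\<sigma>\<^sup>2 = 1" and s: "s \<in> I"
  shows "((\<lambda>s. inverse (\<sigma> * speed s) *\<^sub>R velocity x s) has_vector_derivative
    - (of_int \<epsilon> * (\<sigma> * speed s)) *\<^sub>R y (x, s)) (at s)"
proof -
  define \<psi> where "\<psi> = (\<lambda>s. \<sigma> * speed s)"
  define N where "N = (\<lambda>s. inverse (\<psi> s) *\<^sub>R velocity x s)"
  have \<psi>_sq: "(\<psi> s)\<^sup>2 = B (velocity x s) (velocity x s)" "\<psi> s \<noteq> 0" if "s \<in> I" for s
    using that \<sigma> speed_pos[OF that] speed_square[OF that, of x]
    by (auto simp: \<psi>_def power_mult_distrib power2_eq_1_iff)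
  have sm: "smooth_on I (\<lambda>s. inverse (\<psi> s))"
    unfolding \<psi>_def
    by (intro smooth_on_inverse smooth_on_mult smooth_on_const open_I smooth_speed)
      (use \<psi>_sq in \<open>simp add: \<psi>_def\<close>)
  define c where "c = vector_derivative (\<lambda>s. inverse (\<psi> s)) (at s)"
  define a where "a = vector_derivative (velocity x) (at s)"
  have dv: "(velocity x has_vector_derivative a) (at s)"
    unfolding a_def by (rule smooth_on_has_vector_derivative[OF smooth_velocity s])
  have dc: "((\<lambda>s. inverse (\<psi> s)) has_vector_derivative c) (at s)"
    unfolding c_def by (rule smooth_on_has_vector_derivative[OF sm s])
  define N' where "N' = inverse (\<psi> s) *\<^sub>R a + c *\<^sub>R velocity x s"
  have dN: "(N has_vector_derivative N') (at s)"
    unfolding N_def N'_def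
    by (rule bounded_bilinear.has_vector_derivative[OF bounded_bilinear_scaleR dc dv])
  have unit: "B (N s) (N s) = 1" if "s \<in> I" for s
    using \<psi>_sq(2)[OF that]
    by (simp add: N_def B.scaleR_left B.scaleR_right power2_eq_square field_simps flip: \<psi>_sq(1)[OF that])
  obtain U \<phi> where U: "(U, \<phi>) \<in> A" "x \<in> U" by (rule chart_at)
  let ?h = "chart_rep U \<phi> y"
  have z: "(\<phi> x, s) \<in> \<phi> ` U \<times> I" using U s by auto
  have "N' + (of_int \<epsilon> * \<psi> s) *\<^sub>R y (x, s) = 0"
  proof (rule nondegenerate[OF U(1) z])
    fix X
    have "B N' (FD ?h (\<phi> x, s) (X, 0)) = 0"
      using acceleration_orth_leaf[OF U s dv] orth[OF U(1) z, of X] velocity_eq[OF U s]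
        sym[of "velocity x s"]
      by (simp add: N'_def B.add_left B.scaleR_left)
    moreover have "of_int \<epsilon> * B (y (x, s)) (FD ?h (\<phi> x, s) (X, 0)) = 0"
      using leaf_orth_position[OF _ U(1) z] U by (cases "\<epsilon> = 0") (auto simp: chart_rep_apply)
    ultimately show "B (N' + (of_int \<epsilon> * \<psi> s) *\<^sub>R y (x, s)) (FD ?h (\<phi> x, s) (X, 0)) = 0"
      by (auto simp: B.add_left B.scaleR_left)
  next
    have "B (N s) N' + B N' (N s) = 0"
      by (rule has_vector_derivative_eq_0[OF open_I s unit B.has_vector_derivative[OF dN dN]])
    then have "B N' (N s) = 0" using sym[of N' "N s"] by simp
    then have "B N' (velocity x s) = 0" using \<psi>_sq[OF s] by (simp add: N_def B.scaleR_right)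
    moreover have "of_int \<epsilon> * B (y (x, s)) (velocity x s) = 0"
      using velocity_orth_position[OF _ s] by (cases "\<epsilon> = 0") auto
    ultimately show "B (N' + (of_int \<epsilon> * \<psi> s) *\<^sub>R y (x, s)) (FD ?h (\<phi> x, s) (0, 1)) = 0"
      by (auto simp: B.add_left B.scaleR_left velocity_eq[OF U s, symmetric])
  next
    assume "\<epsilon> \<noteq> 0"
    have "B (N s) (velocity x s) + B N' (y (x, s)) = 0"
      by (rule has_vector_derivative_eq_0[OF open_I s _ B.has_vector_derivative[OF dN has_velocity[OF s]]])
        (use velocity_orth_position[OF \<open>\<epsilon> \<noteq> 0\<close>] sym[of "velocity x _" "y (x, _)"] in \<open>simp add: N_def B.scaleR_left\<close>)
    moreover have "B (N s) (velocity x s) = \<psi> s"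
      using \<psi>_sq[OF s] by (simp add: N_def B.scaleR_left power2_eq_square flip: \<psi>_sq(1)[OF s])
    \<comment> \<open>As B(y, y) = \<epsilon>, the curvature enters squared, and the resulting
      \<psi> cancels against B(N, y_s) = \<psi>.\<close>
    moreover have "of_int \<epsilon> * (of_int \<epsilon> * \<psi> s) = \<psi> s" using \<epsilon> \<open>\<epsilon> \<noteq> 0\<close> by auto
    moreover have "B (N' + (of_int \<epsilon> * \<psi> s) *\<^sub>R y (x, s)) (y (x, s))
        = B N' (y (x, s)) + of_int \<epsilon> * (of_int \<epsilon> * \<psi> s)"
      using curvature[OF \<open>\<epsilon> \<noteq> 0\<close> s] by (simp add: B.add_left B.scaleR_left)
    ultimately show "B (N' + (of_int \<epsilon> * \<psi> s) *\<^sub>R y (x, s)) (?h (\<phi> x, s)) = 0"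
      unfolding chart_rep_apply[OF U] by linarith
  qed
  then have "N' = - (of_int \<epsilon> * \<psi> s) *\<^sub>R y (x, s)" by (simp add: add_eq_0_iff2)
  then show ?thesis using dN by (simp add: N_def \<psi>_def)
qed

text \<open>The pair (y, N) satisfies y' = \<psi> N and N' = -\<epsilon> \<psi> y. Applying the
  inverse of the fundamental matrix of this linear system, whose entries are built from
  \<open>C\<close> and \<open>S\<close>, gives two vectors with derivative 0. They keep their values
  at \<open>s0\<close>, and the identity C^2 + \<epsilon> S^2 = 1 inverts the relation.\<close>

lemma parallel_representation:
  assumes \<sigma>: "\<sigma>\<^sup>2 = 1" and s0: "s0 \<in> I" "\<tau> s0 = 0"
    and \<tau>: "\<And>s. s \<in> I \<Longrightarrow> (\<tau> has_real_derivative \<sigma> * speed s) (at s)" and s: "s \<in> I"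
  shows "y (x, s) = parallel_hypersurface \<epsilon> (\<lambda>x. y (x, s0))
    (\<lambda>x. inverse (\<sigma> * speed s0) *\<^sub>R velocity x s0) (\<tau> s) x"
proof -
  define N where "N = (\<lambda>s. inverse (\<sigma> * speed s) *\<^sub>R velocity x s)"
  define C S where "C = (\<lambda>s. C\<epsilon> \<epsilon> (\<tau> s))" and "S = (\<lambda>s. S\<epsilon> \<epsilon> (\<tau> s))"
  have \<psi>: "\<sigma> * speed s \<noteq> 0" if "s \<in> I" for s using speed_pos[OF that] \<sigma> by auto
  have dy: "((\<lambda>s. y (x, s)) has_vector_derivative (\<sigma> * speed s) *\<^sub>R N s) (at s)" if "s \<in> I" for s
    using has_velocity[OF that] \<psi>[OF that] by (simp add: N_def del: inverse_mult_distrib)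
  have dN: "(N has_vector_derivative - (of_int \<epsilon> * (\<sigma> * speed s)) *\<^sub>R y (x, s)) (at s)" if "s \<in> I" for s
    unfolding N_def by (rule unit_normal_derivative[OF \<sigma> that])
  have dC: "(C has_real_derivative - (of_int \<epsilon> * S s) * (\<sigma> * speed s)) (at s)"
    and dS: "(S has_real_derivative C s * (\<sigma> * speed s)) (at s)" if "s \<in> I" for s
    unfolding C_def S_def
    using DERIV_chain2[OF C\<epsilon>_S\<epsilon>(1)[OF \<epsilon>] \<tau>[OF that]] DERIV_chain2[OF C\<epsilon>_S\<epsilon>(2)[OF \<epsilon>] \<tau>[OF that]]
    by simp_all
  have P': "((\<lambda>s. C s *\<^sub>R y (x, s) - S s *\<^sub>R N s) has_vector_derivative 0) (at s)" if "s \<in> I" for s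
    using has_vector_derivative_diff[OF has_vector_derivative_scaleR[OF dC dy] has_vector_derivative_scaleR[OF dS dN], OF that that that that]
    by (rule has_vector_derivative_eq_rhs) (simp add: algebra_simps)
  have Q': "((\<lambda>s. (of_int \<epsilon> * S s) *\<^sub>R y (x, s) + C s *\<^sub>R N s) has_vector_derivative 0) (at s)" if "s \<in> I" for s
    using has_vector_derivative_add[OF has_vector_derivative_scaleR[OF DERIV_cmult[OF dS, of _ "of_int \<epsilon>"] dy] has_vector_derivative_scaleR[OF dC dN], OF that that that that]
    by (rule has_vector_derivative_eq_rhs) (simp add: algebra_simps)
  have const: "k s = k s0" if "\<And>s. s \<in> I \<Longrightarrow> (k has_vector_derivative 0) (at s)" for k :: "real \<Rightarrow> 'w"
    using has_vector_derivative_zero_constant[of I k] that s s0 interval_I is_interval_convex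
      has_vector_derivative_at_within by metis
  have P: "C s *\<^sub>R y (x, s) - S s *\<^sub>R N s = y (x, s0)"
    and Q: "(of_int \<epsilon> * S s) *\<^sub>R y (x, s) + C s *\<^sub>R N s = N s0"
    using const[OF P'] const[OF Q'] s0(2) C\<epsilon>_S\<epsilon>(4,5)[OF \<epsilon>] by (simp_all add: C_def S_def)
  have "C s *\<^sub>R y (x, s0) + S s *\<^sub>R N s0 = ((C s)\<^sup>2 + of_int \<epsilon> * (S s)\<^sup>2) *\<^sub>R y (x, s)"
    unfolding P[symmetric] Q[symmetric] by (simp add: algebra_simps power2_eq_square)
  also have "\<dots> = y (x, s)" using C\<epsilon>_S\<epsilon>(3)[OF \<epsilon>] by (simp add: C_def S_def)
  finally show ?thesis by (simp add: parallel_hypersurface_def N_def C_def S_def)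
qed

lemma hypersurface_leaf:
  assumes \<sigma>: "\<sigma>\<^sup>2 = 1" and s: "s \<in> I" and Q: "\<And>x. y (x, s) \<in> Q"
  shows "hypersurface_with_normal \<epsilon> B Q A (\<lambda>x. y (x, s)) (\<lambda>x. inverse (\<sigma> * speed s) *\<^sub>R velocity x s)"
proof -
  define g N where "g = (\<lambda>x. y (x, s))" and "N = (\<lambda>x. inverse (\<sigma> * speed s) *\<^sub>R velocity x s)"
  have g_rep: "coord_rep (U, \<phi>) g = (\<lambda>z. chart_rep U \<phi> y (z, s))" for U \<phi>
    by (simp add: coord_rep_def chart_rep_def g_def fun_eq_iff)
  have dg: "differential (U, \<phi>) g x = (\<lambda>X. FD (chart_rep U \<phi> y) (\<phi> x, s) (X, 0))"
    if "(U, \<phi>) \<in> A" "x \<in> U" for U \<phi> x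
    unfolding differential_def g_rep
    using FD_eq[OF has_derivative_slice[OF smooth_on_has_derivative[OF smooth[OF that(1)]]]] that s by auto
  have inj: "inj (differential (U, \<phi>) g x)" if U: "(U, \<phi>) \<in> A" "x \<in> U" for U \<phi> x
  proof -
    let ?D = "FD (chart_rep U \<phi> y) (\<phi> x, s)"
    have z: "(\<phi> x, s) \<in> \<phi> ` U \<times> I" using U s by auto
    have lin: "linear (\<lambda>X. ?D (X, 0))"
      by (rule has_derivative_linear[OF has_derivative_slice[OF smooth_on_has_derivative[OF smooth[OF U(1)] z]]])
    have "X = 0" if "?D (X, 0) = 0" for X
      using pos_leaf[OF U(1) z, of X] that B.zero_left by force
    then show ?thesis unfolding dg[OF U] using linear_injective_0[OF lin] by blast
  qed
  have smg: "smooth_map A g"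
    unfolding smooth_map_def using smooth_on_slice(1)[OF _ smooth s] by (auto simp: g_rep)
  have smN: "smooth_map A N"
    unfolding smooth_map_def
  proof (clarsimp)
    fix U \<phi> assume U: "(U, \<phi>) \<in> A"
    have "smooth_on (\<phi> ` U) (\<lambda>z. inverse (\<sigma> * speed s) *\<^sub>R FD (chart_rep U \<phi> y) (z, s) (0, 1))"
      by (intro smooth_on_scaleR smooth_on_const chartD[OF U] smooth_on_slice(1)[OF U smooth_on_FD[OF smooth[OF U]] s])
    then show "smooth_on (\<phi> ` U) (coord_rep (U, \<phi>) N)"
      by (rule smooth_on_cong[OF chartD(2)[OF U]])
        (use U s in \<open>auto simp: coord_rep_def N_def velocity_eq chartD\<close>)
  qed
  have unit: "B (N x) (N x) = 1" for x
  proof -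
    have "\<sigma> \<noteq> 0" using \<sigma> by auto
    then have "B (N x) (N x) = inverse (\<sigma>\<^sup>2)"
      using speed_square[OF s, of x] speed_pos[OF s]
      by (simp add: N_def B.scaleR_left B.scaleR_right power2_eq_square field_simps)
    then show ?thesis using \<sigma> by simp
  qed
  have pos: "\<epsilon> \<noteq> 0 \<Longrightarrow> B (N x) (g x) = 0" for x
    using velocity_orth_position[OF _ s, of x] sym[of "velocity x s" "y (x, s)"]
    by (simp add: N_def g_def B.scaleR_left)
  have normal: "B (N x) (differential (U, \<phi>) g x X) = 0" if U: "(U, \<phi>) \<in> A" "x \<in> U" for U \<phi> x X
    using orth[OF U(1), of "(\<phi> x, s)" X] U s sym[of "velocity x s"]
    by (simp add: dg N_def B.scaleR_left velocity_eq)
  have inj': "\<forall>c\<in>A. \<forall>x\<in>fst c. inj (differential c g x)"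
    and normal': "\<forall>c\<in>A. \<forall>x\<in>fst c. \<forall>X. B (N x) (differential c g x X) = 0"
    using inj normal by (metis prod.collapse)+
  have "range g \<subseteq> Q" using Q by (auto simp: g_def)
  then have "hypersurface_with_normal \<epsilon> B Q A g N"
    unfolding hypersurface_with_normal_def immersion_def
    by (intro conjI smg smN inj' normal' allI unit impI pos)
  then show ?thesis by (simp only: g_def N_def)
qed

text \<open>In the parameter \<tau> with \<tau>' = \<psi> the height has derivative t' / \<psi>.
  Since t' is continuous and has no zero on an interval, it keeps one sign; giving \<psi> this sign
  makes \<open>a\<close> increasing, and changing \<sigma> only reverses the unit normal.\<close>

theorem parallel_family:
  assumes Q: "\<And>x s. s \<in> I \<Longrightarrow> y (x, s) \<in> Q"
    and t: "smooth_on I t" "\<And>s. s \<in> I \<Longrightarrow> (t has_real_derivative t' s) (at s)" "\<And>s. s \<in> I \<Longrightarrow> t' s \<noteq> 0"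
  shows "parallel_family_map \<epsilon> B Q A I (\<lambda>(x, s). (y (x, s), t s))"
proof -
  obtain s0 where s0: "s0 \<in> I" using nonempty_I by blast
  define \<sigma> where "\<sigma> = sgn (t' s0)"
  have \<sigma>: "\<sigma>\<^sup>2 = 1" using t(3)[OF s0] by (auto simp: \<sigma>_def sgn_if)
  have t'_eq: "t' s = vector_derivative t (at s)" if "s \<in> I" for s
    using vector_derivative_at[of t "t' s" s] t(2)[OF that]
    by (simp add: has_real_derivative_iff_has_vector_derivative)
  have t'_cont: "continuous_on I t'"
    using smooth_on_continuous_on[OF smooth_on_vector_derivative[OF open_I t(1)]] t'_eq
    by (simp cong: continuous_on_cong)
  have same_sign: "\<sigma> * t' s > 0" if s: "s \<in> I" for s
  proof -
    have "is_interval (t' ` I)"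
      using connected_continuous_image[OF t'_cont] interval_I is_interval_connected_1 by blast
    moreover have "0 \<notin> t' ` I" using t(3) by auto
    ultimately have "\<not> (t' s < 0 \<and> 0 < t' s0)" "\<not> (t' s0 < 0 \<and> 0 < t' s)"
      using s s0 mem_is_interval_1_I[of "t' ` I"] by (meson imageI less_imp_le)+
    then show ?thesis using t(3)[OF s] t(3)[OF s0] by (auto simp: \<sigma>_def sgn_if)
  qed
  define \<psi> where "\<psi> = (\<lambda>s. \<sigma> * speed s)"
  have \<psi>: "smooth_on I \<psi>"
    unfolding \<psi>_def by (intro smooth_on_mult smooth_on_const open_I smooth_speed)
  have \<psi>_pos: "0 < \<sigma> * \<psi> s" if "s \<in> I" for s
    using speed_pos[OF that] \<sigma> by (simp add: \<psi>_def power2_eq_square flip: mult.assoc)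
  \<comment> \<open>With \<tau> vanishing at \<open>s0\<close>, the leaf at \<open>s0\<close>
    becomes the base hypersurface of the parallel family.\<close>
  obtain \<tau> where \<tau>: "\<And>s. s \<in> I \<Longrightarrow> (\<tau> has_real_derivative \<psi> s) (at s)" "\<tau> s0 = 0"
    using open_interval_antiderivative[OF interval smooth_on_continuous_on[OF \<psi>] s0] by metis
  have dif: "open_interval (\<tau> ` I)" "diffeo_intervals I (\<tau> ` I) \<tau>"
    "s \<in> I \<Longrightarrow> (inv_into I \<tau> has_real_derivative inverse (\<psi> s)) (at (\<tau> s))" for s
    using diffeo_intervals_of_deriv[OF interval \<tau>(1) \<psi> \<psi>_pos] by blast+
  have bij: "bij_betw \<tau> I (\<tau> ` I)" using dif(2) by (simp add: diffeo_intervals_def)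
  then have inv: "inv_into I \<tau> (\<tau> s) = s" if "s \<in> I" for s
    using that by (simp add: bij_betw_inv_into_left)
  define a where "a = (\<lambda>u. t (inv_into I \<tau> u))"
  have sm_a: "smooth_on (\<tau> ` I) a"
    unfolding a_def
    by (rule smooth_on_compose[OF _ open_I _ _ t(1)])
      (use dif(1,2) inv in \<open>auto simp: diffeo_intervals_def open_interval_def\<close>)
  have "deriv a u > 0" if u: "u \<in> \<tau> ` I" for u
  proof -
    obtain s where s: "s \<in> I" "u = \<tau> s" using u by blast
    have "(a has_real_derivative t' s * inverse (\<psi> s)) (at u)"
      unfolding a_def s(2) using dif(3)[OF s(1)] t(2)[OF s(1)] inv[OF s(1)]
      by (intro DERIV_chain2) simp_all
    moreover have "t' s * inverse (\<psi> s) > 0"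
      using same_sign[OF s(1)] \<psi>_pos[OF s(1)] by (auto simp: zero_less_mult_iff)
    ultimately show ?thesis using DERIV_imp_deriv by metis
  qed
  moreover have "(case (x, s) of (x, s) \<Rightarrow> (y (x, s), t s)) =
      (parallel_hypersurface \<epsilon> (\<lambda>x. y (x, s0)) (\<lambda>x. inverse (\<sigma> * speed s0) *\<^sub>R velocity x s0) (\<tau> s) x, 0)
        + a (\<tau> s) *\<^sub>R (0, 1)" if "s \<in> I" for x s
    using parallel_representation[OF \<sigma> s0 \<tau>(2) \<tau>(1)[unfolded \<psi>_def] that] inv[OF that]
    by (simp add: a_def)
  ultimately show ?thesis
    unfolding parallel_family_map_def Let_def
    using Q hypersurface_leaf[OF \<sigma> s0 Q[OF s0]] dif(1,2) sm_a
    by (intro conjI exI[of _ "\<lambda>x. y (x, s0)"] exI[of _ "\<lambda>x. inverse (\<sigma> * speed s0) *\<^sub>R velocity x s0"]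
        exI[of _ "\<tau> ` I"] exI[of _ \<tau>] exI[of _ a]) auto
qed

end

section \<open>Hypersurfaces of Enneper type in charts\<close>

lemma has_derivative_eq_0_of_const:
  assumes "open V" "z \<in> V" "\<And>z. z \<in> V \<Longrightarrow> k z = c" "(k has_derivative k') (at z)"
  shows "k' X = 0"
proof -
  have "((\<lambda>z. c) has_derivative k') (at z)"
    using has_derivative_transform_within_open[OF assms(4,1,2)] assms(3) by metis
  then show ?thesis using has_derivative_unique[OF _ has_derivative_const] by metis
qed

lemma has_derivative_scaleR_second:
  assumes "(k has_vector_derivative k') (at (snd z))" "(h has_derivative h') (at z)"
  shows "((\<lambda>z. k (snd z) *\<^sub>R h z) has_derivative (\<lambda>Z. k (snd z) *\<^sub>R h' Z + (snd Z * k') *\<^sub>R h z)) (at z)"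
proof -
  have "((\<lambda>z. k (snd z)) has_derivative (\<lambda>Z. snd Z *\<^sub>R k')) (at z)"
    using diff_chain_at[OF has_derivative_snd[OF has_derivative_ident] assms(1)[unfolded has_vector_derivative_def]]
    by (simp add: o_def)
  from has_derivative_scaleR[OF this assms(2)] show ?thesis by (simp add: mult.commute)
qed

text \<open>The Enneper conditions in charts, with adaptedness read as tangency of the mixed
  derivative. The condition on the leaves is left out, since each case brings its own.\<close>

locale enneper_hypersurface = product_manifold A I
  for A :: "('p::topological_space, 'e::euclidean_space) chart set" and I +
  fixes f :: "'p \<times> real \<Rightarrow> 'v::euclidean_space"
  assumes smooth_f: "\<And>U \<phi>. (U, \<phi>) \<in> A \<Longrightarrow> smooth_on (\<phi> ` U \<times> I) (chart_rep U \<phi> f)"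
    and inj_f: "\<And>U \<phi> z. (U, \<phi>) \<in> A \<Longrightarrow> z \<in> \<phi> ` U \<times> I \<Longrightarrow> inj (FD (chart_rep U \<phi> f) z)"
    and orth_f: "\<And>U \<phi> z X. (U, \<phi>) \<in> A \<Longrightarrow> z \<in> \<phi> ` U \<times> I \<Longrightarrow>
      FD (chart_rep U \<phi> f) z (X, 0) \<bullet> FD (chart_rep U \<phi> f) z (0, 1) = 0"
    and adapted_f: "\<And>U \<phi> z X. (U, \<phi>) \<in> A \<Longrightarrow> z \<in> \<phi> ` U \<times> I \<Longrightarrow>
      FD (\<lambda>z. FD (chart_rep U \<phi> f) z (0, 1)) z (X, 0) \<in> range (FD (chart_rep U \<phi> f) z)"
begin

lemma has_derivative_f:
  "(U, \<phi>) \<in> A \<Longrightarrow> z \<in> \<phi> ` U \<times> I \<Longrightarrow> (chart_rep U \<phi> f has_derivative FD (chart_rep U \<phi> f) z) (at z)"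
  using smooth_on_has_derivative[OF smooth_f] .

lemma has_derivative_velocity:
  "(U, \<phi>) \<in> A \<Longrightarrow> z \<in> \<phi> ` U \<times> I \<Longrightarrow> ((\<lambda>z. FD (chart_rep U \<phi> f) z (0, 1)) has_derivative
    FD (\<lambda>z. FD (chart_rep U \<phi> f) z (0, 1)) z) (at z)"
  using smooth_on_has_derivative[OF smooth_on_FD[OF smooth_f]] .

lemma linear_f: "(U, \<phi>) \<in> A \<Longrightarrow> z \<in> \<phi> ` U \<times> I \<Longrightarrow> linear (FD (chart_rep U \<phi> f) z)"
  using has_derivative_linear[OF has_derivative_f] .

lemma FD_f_split:
  assumes "(U, \<phi>) \<in> A" "z \<in> \<phi> ` U \<times> I"
  shows "FD (chart_rep U \<phi> f) z (X, a) = FD (chart_rep U \<phi> f) z (X, 0) + a *\<^sub>R FD (chart_rep U \<phi> f) z (0, 1)"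
proof -
  interpret linear "FD (chart_rep U \<phi> f) z" by (rule linear_f[OF assms])
  show ?thesis using add[of "(X, 0)" "a *\<^sub>R (0, 1)"] scale[of a "(0, 1)"] by simp
qed

lemma FD_f_eq_0:
  assumes "(U, \<phi>) \<in> A" "z \<in> \<phi> ` U \<times> I"
  shows "FD (chart_rep U \<phi> f) z Z = 0 \<longleftrightarrow> Z = 0"
  using linear_injective_0[OF linear_f[OF assms]] inj_f[OF assms] linear_0[OF linear_f[OF assms]] by blast

text \<open>The coefficient \<mu> is the quantity each case has to determine: it is 0 for spheres
  and parallel hyperplanes, and for a pencil it is the logarithmic derivative of the distance to the
  axis.\<close>

lemma adapted_decomp:
  assumes "(U, \<phi>) \<in> A" "z \<in> \<phi> ` U \<times> I"
  obtains W \<mu> where "FD (\<lambda>z. FD (chart_rep U \<phi> f) z (0, 1)) z (X, 0)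
    = FD (chart_rep U \<phi> f) z (W, 0) + \<mu> *\<^sub>R FD (chart_rep U \<phi> f) z (0, 1)"
proof -
  obtain Z where "FD (\<lambda>z. FD (chart_rep U \<phi> f) z (0, 1)) z (X, 0) = FD (chart_rep U \<phi> f) z Z"
    using adapted_f[OF assms, of X] by (rule rangeE)
  then show ?thesis using that[of "fst Z" "snd Z"] FD_f_split[OF assms, of "fst Z" "snd Z"] by simp
qed

text \<open>A covector that kills the leaf but not the whole tangent space must see the one
  remaining direction. This turns the non-orthogonality half of obliqueness into a statement about
  f_s.\<close>

lemma transversal_velocity:
  assumes "(U, \<phi>) \<in> A" "z \<in> \<phi> ` U \<times> I" "\<And>X. \<xi> \<bullet> FD (chart_rep U \<phi> f) z (X, 0) = 0"
    "\<xi> \<bullet> FD (chart_rep U \<phi> f) z Z \<noteq> 0"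
  shows "\<xi> \<bullet> FD (chart_rep U \<phi> f) z (0, 1) \<noteq> 0"
  using assms(3,4) FD_f_split[OF assms(1,2), of "fst Z" "snd Z"] by (auto simp: inner_right_distrib)

lemma const_on_leaf_derivative:
  fixes k :: "'e \<times> real \<Rightarrow> 'w::real_normed_vector"
  assumes "(U, \<phi>) \<in> A" "z \<in> \<phi> ` U \<times> I" "(k has_derivative k') (at z)"
    "\<And>w. w \<in> \<phi> ` U \<Longrightarrow> k (w, snd z) = c"
  shows "k' (X, 0) = 0"
proof -
  have "((\<lambda>w. k (w, snd z)) has_derivative (\<lambda>X. k' (X, 0))) (at (fst z))"
    using has_derivative_slice[of k k' "fst z" "snd z"] assms(3) by simp
  then show ?thesis
    using has_derivative_eq_0_of_const[OF chartD(2)[OF assms(1)] _ assms(4), of "fst z"] assms(2) by auto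
qed

end

lemma (in product_manifold) enneper_hypersurfaceI:
  assumes imm: "immersion (product_atlas A I) f" and enn: "enneper_type A I f"
  shows "enneper_hypersurface A I f"
proof (unfold_locales)
  have sm: "smooth_map (product_atlas A I) f" using imm by (simp add: immersion_def)
  fix U \<phi> assume U: "(U, \<phi>) \<in> A"
  let ?h = "chart_rep U \<phi> f" and ?c = "(U \<times> I, map_prod \<phi> id)"
  show smh: "smooth_on (\<phi> ` U \<times> I) ?h" by (rule smooth_chart_rep[OF sm U])
  fix z and X :: 'e assume "z \<in> \<phi> ` U \<times> I"
  then obtain x s where x: "x \<in> U" "s \<in> I" "z = (\<phi> x, s)" by auto
  have z: "z \<in> \<phi> ` U \<times> I" by fact
  have p: "?c \<in> product_atlas A I" "(x, s) \<in> fst ?c" using product_chart[OF U] x by auto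
  have d: "differential ?c f (x, s) = FD ?h z"
    using differential_product[OF sm U x(1,2)] x(3) by simp
  show "inj (FD ?h z)" using imm p unfolding immersion_def d[symmetric] by blast
  have E: "(X, 0) \<in> E0" "(0, 1) \<in> E1" by (auto simp: E0_def E1_def)
  show "FD ?h z (X, 0) \<bullet> FD ?h z (0, 1) = 0"
    using enn p E unfolding enneper_type_def d[symmetric] by blast
  have "second_fundamental_form ?c f (x, s) (X, 0) (0, 1) = 0"
    using enn p E unfolding enneper_type_def by blast
  moreover have "linear (differential ?c f (x, s))"
    unfolding d by (rule has_derivative_linear[OF smooth_on_has_derivative[OF smh z]])
  ultimately have "FD (\<lambda>y. FD (coord_rep ?c f) y (0, 1)) (snd ?c (x, s)) (X, 0) \<in> tangent_image ?c f (x, s)"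
    by (intro second_fundamental_form_eq_0D)
  moreover have "FD (\<lambda>y. FD (coord_rep ?c f) y (0, 1)) z = FD (\<lambda>y. FD ?h y (0, 1)) z"
    by (rule FD_cong[OF open_chart_image[OF U] smooth_on_FD[OF smh] z])
      (simp add: FD_coord_rep_product[OF sm U])
  ultimately show "FD (\<lambda>y. FD ?h y (0, 1)) z (X, 0) \<in> range (FD ?h z)"
    using x(3) by (simp add: tangent_image_def d)
qed

lemma (in enneper_hypersurface) isometric_image_FD:
  fixes b :: 'v
  assumes T: "orthogonal_transformation T" and U: "(U, \<phi>) \<in> A" and z: "z \<in> \<phi> ` U \<times> I"
  shows "FD (chart_rep U \<phi> (\<lambda>p. T (f p - b))) z = (\<lambda>Z. T (FD (chart_rep U \<phi> f) z Z))"
proof -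
  have bl: "bounded_linear T"
    using T linear_conv_bounded_linear by (auto simp: orthogonal_transformation_def)
  have rep: "chart_rep U \<phi> (\<lambda>p. T (f p - b)) = (\<lambda>z. T (chart_rep U \<phi> f z - b))"
    by (auto simp: chart_rep_def)
  have "((\<lambda>z. chart_rep U \<phi> f z - b) has_derivative FD (chart_rep U \<phi> f) z) (at z)"
    using has_derivative_diff[OF has_derivative_f[OF U z] has_derivative_const[of b]] by simp
  from FD_eq[OF bounded_linear.has_derivative[OF bl this]] show ?thesis unfolding rep .
qed

text \<open>Allows the centre, direction or axis to be moved to the standard position built into
  \<Phi>. Derivatives are merely composed with an orthogonal map, which preserves inner products and
  tangency.\<close>

lemma (in enneper_hypersurface) isometric_image:
  fixes b :: 'v
  assumes T: "orthogonal_transformation T"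
  shows "enneper_hypersurface A I (\<lambda>p. T (f p - b))"
proof (unfold_locales)
  have lin: "linear T" and inner: "T u \<bullet> T v = u \<bullet> v" for u v
    using T by (auto simp: orthogonal_transformation_def)
  have bl: "bounded_linear T" using lin linear_conv_bounded_linear by blast
  fix U \<phi> assume U: "(U, \<phi>) \<in> A"
  let ?h = "chart_rep U \<phi> f" and ?h' = "chart_rep U \<phi> (\<lambda>p. T (f p - b))"
  have rep: "?h' = (\<lambda>z. T (?h z - b))" by (auto simp: chart_rep_def)
  show "smooth_on (\<phi> ` U \<times> I) ?h'"
    unfolding rep
    by (rule smooth_on_linear_compose[OF bl open_chart_image[OF U]
          smooth_on_diff[OF open_chart_image[OF U] smooth_f[OF U] smooth_on_const]])
  fix z and X :: 'e assume z: "z \<in> \<phi> ` U \<times> I"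
  note D = isometric_image_FD[OF T U]
  have "((\<lambda>z. T (FD ?h z (0, 1))) has_derivative (\<lambda>Z. T (FD (\<lambda>z. FD ?h z (0, 1)) z Z))) (at z)"
    by (rule bounded_linear.has_derivative[OF bl has_derivative_velocity[OF U z]])
  moreover have "FD (\<lambda>z. FD ?h' z (0, 1)) z = FD (\<lambda>z. T (FD ?h z (0, 1))) z"
    by (rule FD_cong[OF open_chart_image[OF U]
          smooth_on_linear_compose[OF bl open_chart_image[OF U] smooth_on_FD[OF smooth_f[OF U]]] z])
      (simp add: D)
  ultimately have D2: "FD (\<lambda>z. FD ?h' z (0, 1)) z = (\<lambda>Z. T (FD (\<lambda>z. FD ?h z (0, 1)) z Z))"
    by (simp add: FD_eq)
  show "inj (FD ?h' z)"
    unfolding D[OF z] using inj_compose[OF orthogonal_transformation_inj[OF T] inj_f[OF U z]]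
    by (simp add: o_def)
  show "FD ?h' z (X, 0) \<bullet> FD ?h' z (0, 1) = 0"
    unfolding D[OF z] inner by (rule orth_f[OF U z])
  show "FD (\<lambda>z. FD ?h' z (0, 1)) z (X, 0) \<in> range (FD ?h' z)"
    unfolding D[OF z] D2 using adapted_f[OF U z, of X] by auto
qed

section \<open>Leaves in concentric spheres\<close>

text \<open>With the centre at the origin the position vector is itself the normal of the sphere, so
  both halves of obliqueness are stated for \<open>chart_rep U \<phi> f z\<close>.\<close>

lemma (in enneper_hypersurface) concentric_case:
  assumes dims: "DIM('v) = DIM('e) + 2"
    and leaves: "\<And>s. s \<in> I \<Longrightarrow> \<exists>r>0. \<forall>x. norm (f (x, s)) = r"
    and not_tangent: "\<And>U \<phi> z. (U, \<phi>) \<in> A \<Longrightarrow> z \<in> \<phi> ` U \<times> I \<Longrightarrow> chart_rep U \<phi> f z \<notin> range (FD (chart_rep U \<phi> f) z)"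
    and not_normal: "\<And>U \<phi> z. (U, \<phi>) \<in> A \<Longrightarrow> z \<in> \<phi> ` U \<times> I \<Longrightarrow> \<exists>Z. chart_rep U \<phi> f z \<bullet> FD (chart_rep U \<phi> f) z Z \<noteq> 0"
  shows "\<exists>F. parallel_family_map 1 inner {x::'v. x \<bullet> x = 1} A I F \<and>
    (\<forall>x. \<forall>s\<in>I. f (x, s) = exp (snd (F (x, s))) *\<^sub>R fst (F (x, s)))"
proof -
  define r where "r = (\<lambda>s. norm (f (undefined, s)))"
  have r: "norm (f (x, s)) = r s" "r s > 0" if "s \<in> I" for x s
    using leaves[OF that] unfolding r_def by metis+
  have sm_curve: "smooth_on I (\<lambda>s. f (undefined, s))" by (rule smooth_on_curve[OF smooth_f])
  have sm_r: "smooth_on I r"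
    unfolding r_def by (rule smooth_on_norm[OF open_I sm_curve]) (metis norm_zero r less_irrefl)
  define k where "k = (\<lambda>s. inverse (r s))"
  have k_ne: "k s \<noteq> 0" if "s \<in> I" for s using r(2)[OF that] by (simp add: k_def)
  have sm_k: "smooth_on I k"
    unfolding k_def by (rule smooth_on_inverse[OF open_I sm_r]) (metis r(2) less_irrefl)
  define k' where "k' = (\<lambda>s. vector_derivative k (at s))"
  have sm_k': "smooth_on I k'"
    unfolding k'_def by (rule smooth_on_vector_derivative[OF open_I sm_k])
  have dk: "(k has_vector_derivative k' s) (at s)" if "s \<in> I" for s
    unfolding k'_def by (rule smooth_on_has_vector_derivative[OF sm_k that])
  define r' where "r' = (\<lambda>s. vector_derivative r (at s))"
  have dr: "(r has_vector_derivative r' s) (at s)" if "s \<in> I" for s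
    unfolding r'_def by (rule smooth_on_has_vector_derivative[OF sm_r that])
  define y where "y = (\<lambda>(x, s). k s *\<^sub>R f (x, s))"
  have rep: "chart_rep U \<phi> y = (\<lambda>z. k (snd z) *\<^sub>R chart_rep U \<phi> f z)" for U \<phi>
    by (auto simp: chart_rep_def y_def)
  have sm_snd: "smooth_on (V \<times> I) (\<lambda>z. c (snd z))" if "open V" "smooth_on I c" for V :: "'e set" and c :: "real \<Rightarrow> real"
    by (rule smooth_on_compose[OF _ open_I _ _ that(2)])
      (auto intro!: open_Times that open_I smooth_on_bounded_linear bounded_linear_snd)
  have sphere: "chart_rep U \<phi> f z \<bullet> chart_rep U \<phi> f z = (r (snd z))\<^sup>2" if "z \<in> \<phi> ` U \<times> I" for U \<phi> z
    using that r(1) by (auto simp: chart_rep_def dot_square_norm)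
  \<comment> \<open>Both come from differentiating |f|^2 = r^2, along the leaf and along
    \<open>s\<close> respectively.\<close>
  have perp: "chart_rep U \<phi> f z \<bullet> FD (chart_rep U \<phi> f) z (X, 0) = 0"
    and radial: "chart_rep U \<phi> f z \<bullet> FD (chart_rep U \<phi> f) z (0, 1) = r (snd z) * r' (snd z)"
    if U: "(U, \<phi>) \<in> A" and z: "z \<in> \<phi> ` U \<times> I" for U \<phi> z X
  proof -
    let ?h = "chart_rep U \<phi> f"
    have d: "((\<lambda>z. ?h z \<bullet> ?h z) has_derivative (\<lambda>Z. 2 * (?h z \<bullet> FD ?h z Z))) (at z)"
      using has_derivative_inner[OF has_derivative_f[OF U z] has_derivative_f[OF U z]]
      by (simp add: inner_commute)
    have "2 * (?h z \<bullet> FD ?h z (X, 0)) = 0"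
    proof (rule const_on_leaf_derivative[OF U z d])
      fix w assume "w \<in> \<phi> ` U"
      then show "?h (w, snd z) \<bullet> ?h (w, snd z) = (r (snd z))\<^sup>2"
        using sphere[of "(w, snd z)" \<phi> U] z by auto
    qed
    then show "?h z \<bullet> FD ?h z (X, 0) = 0" by simp
    have "((\<lambda>s. ?h (fst z, s) \<bullet> ?h (fst z, s)) has_vector_derivative 2 * (?h z \<bullet> FD ?h z (0, 1))) (at (snd z))"
      using has_vector_derivative_slice[of _ _ "fst z" "snd z"] d by simp
    moreover have "((\<lambda>s. (r s)\<^sup>2) has_vector_derivative 2 * (r (snd z) * r' (snd z))) (at (snd z))"
      using dr[of "snd z"] z unfolding has_real_derivative_iff_has_vector_derivative[symmetric]
      by (auto intro!: derivative_eq_intros)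
    ultimately have d2: "((\<lambda>s. ?h (fst z, s) \<bullet> ?h (fst z, s) - (r s)\<^sup>2) has_vector_derivative
        2 * (?h z \<bullet> FD ?h z (0, 1)) - 2 * (r (snd z) * r' (snd z))) (at (snd z))"
      by (rule has_vector_derivative_diff)
    have const: "?h (fst z, s) \<bullet> ?h (fst z, s) - (r s)\<^sup>2 = 0" if "s \<in> I" for s
      using sphere[of "(fst z, s)" \<phi> U] that z by auto
    have s: "snd z \<in> I" using z by auto
    have "2 * (?h z \<bullet> FD ?h z (0, 1)) - 2 * (r (snd z) * r' (snd z)) = 0"
      by (rule has_vector_derivative_eq_0[OF open_I s _ d2]) (rule const)
    then show "?h z \<bullet> FD ?h z (0, 1) = r (snd z) * r' (snd z)" by simp
  qed
  have radial_ne: "chart_rep U \<phi> f z \<bullet> FD (chart_rep U \<phi> f) z (0, 1) \<noteq> 0"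
    if U: "(U, \<phi>) \<in> A" and z: "z \<in> \<phi> ` U \<times> I" for U \<phi> z
    using not_normal[OF U z] transversal_velocity[OF U z perp[OF U z]] by blast
  have r'_ne: "r' s \<noteq> 0" if s: "s \<in> I" for s
  proof -
    obtain U \<phi> where U: "(U, \<phi>) \<in> A" "undefined \<in> U" by (rule chart_at)
    show ?thesis using radial_ne[OF U(1), of "(\<phi> undefined, s)"] radial[OF U(1), of "(\<phi> undefined, s)"] U s by auto
  qed
  have Dy: "FD (chart_rep U \<phi> y) z = (\<lambda>Z. k (snd z) *\<^sub>R FD (chart_rep U \<phi> f) z Z + (snd Z * k' (snd z)) *\<^sub>R chart_rep U \<phi> f z)"
    if U: "(U, \<phi>) \<in> A" and z: "z \<in> \<phi> ` U \<times> I" for U \<phi> z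
    unfolding rep
    by (rule FD_eq[OF has_derivative_scaleR_second[OF dk has_derivative_f[OF U z]]]) (use z in auto)
  have sm_y: "smooth_on (\<phi> ` U \<times> I) (chart_rep U \<phi> y)" if U: "(U, \<phi>) \<in> A" for U \<phi>
    unfolding rep by (intro smooth_on_scaleR open_chart_image[OF U] sm_snd chartD[OF U] sm_k smooth_f[OF U])
  have D2y: "FD (\<lambda>z. FD (chart_rep U \<phi> y) z (0, 1)) z (X, 0)
      = k (snd z) *\<^sub>R FD (\<lambda>z. FD (chart_rep U \<phi> f) z (0, 1)) z (X, 0) + k' (snd z) *\<^sub>R FD (chart_rep U \<phi> f) z (X, 0)"
    if U: "(U, \<phi>) \<in> A" and z: "z \<in> \<phi> ` U \<times> I" for U \<phi> z X
  proof -
    let ?G = "\<lambda>z. k (snd z) *\<^sub>R FD (chart_rep U \<phi> f) z (0, 1) + k' (snd z) *\<^sub>R chart_rep U \<phi> f z"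
    have smG: "smooth_on (\<phi> ` U \<times> I) ?G"
      by (intro smooth_on_add smooth_on_scaleR open_chart_image[OF U] sm_snd chartD[OF U] sm_k sm_k' smooth_on_FD smooth_f[OF U])
    have "FD (\<lambda>z. FD (chart_rep U \<phi> y) z (0, 1)) z = FD ?G z"
      by (rule FD_cong[OF open_chart_image[OF U] smG z]) (simp add: Dy[OF U])
    moreover have s: "snd z \<in> I" using z by auto
    have "(k' has_vector_derivative vector_derivative k' (at (snd z))) (at (snd z))"
      by (rule smooth_on_has_vector_derivative[OF sm_k' s])
    note FD_eq[OF has_derivative_add[OF has_derivative_scaleR_second[OF dk[OF s] has_derivative_velocity[OF U z]]
        has_derivative_scaleR_second[OF this has_derivative_f[OF U z]]]]
    ultimately show ?thesis by simp
  qed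
  have family: "orthogonal_family A I inner 1 y"
  proof (intro orthogonal_family.intro orthogonal_family_axioms.intro product_manifold_axioms)
    fix x s assume "s \<in> I"
    then have "norm (y (x, s)) = 1" using r(1)[of s x] r(2)[of s] by (simp add: y_def k_def)
    then show "y (x, s) \<bullet> y (x, s) = of_int 1" by (simp add: dot_square_norm)
  next
    fix U \<phi> assume U: "(U, \<phi>) \<in> A"
    show "smooth_on (\<phi> ` U \<times> I) (chart_rep U \<phi> y)" by (rule sm_y[OF U])
    fix z and X :: 'e assume z: "z \<in> \<phi> ` U \<times> I"
    let ?h = "chart_rep U \<phi> f"
    have s: "snd z \<in> I" using z by auto
    have kz: "k (snd z) \<noteq> 0" by (rule k_ne[OF s])
    have ps: "FD ?h z (X, 0) \<bullet> ?h z = 0" for X using perp[OF U z] by (simp add: inner_commute)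
    show "FD (chart_rep U \<phi> y) z (X, 0) \<bullet> FD (chart_rep U \<phi> y) z (0, 1) = 0"
      using orth_f[OF U z] ps by (simp add: Dy[OF U z] inner_right_distrib)
    \<comment> \<open>By \<open>radial\<close> the product <f, f_s> is constant on the leaf. Its
      derivative along X has two terms, and <f_X, f_s> vanishes by orthogonality of the net.\<close>
    have mixed: "FD (\<lambda>z. FD ?h z (0, 1)) z (X, 0) \<bullet> ?h z = 0"
    proof -
      have "((\<lambda>z. ?h z \<bullet> FD ?h z (0, 1)) has_derivative
          (\<lambda>Z. ?h z \<bullet> FD (\<lambda>z. FD ?h z (0, 1)) z Z + FD ?h z Z \<bullet> FD ?h z (0, 1))) (at z)"
        by (rule has_derivative_inner[OF has_derivative_f[OF U z] has_derivative_velocity[OF U z]])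
      from const_on_leaf_derivative[OF U z this, of "r (snd z) * r' (snd z)" X]
      have "?h z \<bullet> FD (\<lambda>z. FD ?h z (0, 1)) z (X, 0) + FD ?h z (X, 0) \<bullet> FD ?h z (0, 1) = 0"
        using radial[OF U] s by simp
      then show ?thesis using orth_f[OF U z, of X] inner_commute[of "?h z"] by simp
    qed
    obtain W \<mu> where W: "FD (\<lambda>z. FD ?h z (0, 1)) z (X, 0) = FD ?h z (W, 0) + \<mu> *\<^sub>R FD ?h z (0, 1)"
      by (rule adapted_decomp[OF U z])
    \<comment> \<open>Leaf vectors are orthogonal to f, so pairing the decomposition with f isolates
      \<mu>.\<close>
    have "\<mu> * (?h z \<bullet> FD ?h z (0, 1)) = 0"
      using mixed ps by (simp add: W inner_add_left inner_commute[of "?h z"])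
    then have "\<mu> = 0" using radial_ne[OF U z] by simp
    then have "FD (\<lambda>z. FD ?h z (0, 1)) z (X, 0) \<bullet> FD ?h z (0, 1) = 0"
      using orth_f[OF U z] by (simp add: W)
    then show "FD (\<lambda>z. FD (chart_rep U \<phi> y) z (0, 1)) z (X, 0) \<bullet> FD (chart_rep U \<phi> y) z (0, 1) = 0"
      using orth_f[OF U z] ps mixed
      by (simp add: D2y[OF U z] Dy[OF U z] inner_add_left inner_add_right)
    have "FD (chart_rep U \<phi> y) z (0, 1) \<noteq> 0"
    proof
      assume "FD (chart_rep U \<phi> y) z (0, 1) = 0"
      then have 0: "k (snd z) *\<^sub>R FD ?h z (0, 1) + k' (snd z) *\<^sub>R ?h z = 0" by (simp add: Dy[OF U z])
      \<comment> \<open>If k' vanished here, so would f_s, against injectivity of the differential.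
        Hence the relation can be solved for f, which would then be tangent.\<close>
      have "k' (snd z) \<noteq> 0" using 0 kz FD_f_eq_0[OF U z, of "(0, 1)"] by (auto simp: zero_prod_def)
      have "k' (snd z) *\<^sub>R ?h z = - (k (snd z) *\<^sub>R FD ?h z (0, 1))" using 0 by (simp add: add_eq_0_iff)
      then have "inverse (k' (snd z)) *\<^sub>R k' (snd z) *\<^sub>R ?h z = inverse (k' (snd z)) *\<^sub>R - (k (snd z) *\<^sub>R FD ?h z (0, 1))"
        by simp
      then have "?h z = FD ?h z ((- (inverse (k' (snd z)) * k (snd z))) *\<^sub>R (0, 1))"
        using \<open>k' (snd z) \<noteq> 0\<close> unfolding linear_scale[OF linear_f[OF U z]] by simp
      then show False using not_tangent[OF U z] by blast
    qed
    then show "FD (chart_rep U \<phi> y) z (0, 1) \<bullet> FD (chart_rep U \<phi> y) z (0, 1) > 0" by simp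
    show "FD (chart_rep U \<phi> y) z (X, 0) \<bullet> FD (chart_rep U \<phi> y) z (X, 0) > 0" if "X \<noteq> 0"
    proof -
      have "FD (chart_rep U \<phi> y) z (X, 0) \<noteq> 0"
        using that kz FD_f_eq_0[OF U z, of "(X, 0)"] by (simp add: Dy[OF U z] zero_prod_def)
      then show ?thesis by simp
    qed
    fix v
    assume vX: "\<And>X. v \<bullet> FD (chart_rep U \<phi> y) z (X, 0) = 0" and vs: "v \<bullet> FD (chart_rep U \<phi> y) z (0, 1) = 0"
      and vy: "(1::int) \<noteq> 0 \<Longrightarrow> v \<bullet> chart_rep U \<phi> y z = 0"
    have vh: "v \<bullet> ?h z = 0" using vy kz by (simp add: rep)
    have "v \<bullet> FD ?h z (X, 0) = 0" for X using vX[of X] kz by (simp add: Dy[OF U z])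
    moreover have "v \<bullet> FD ?h z (0, 1) = 0" using vs vh kz by (simp add: Dy[OF U z] inner_add_right)
    ultimately have "v \<bullet> FD ?h z Z = 0" for Z
      using FD_f_split[OF U z, of "fst Z" "snd Z"] by (simp add: inner_add_right)
    then show "v = 0"
      by (rule orthogonal_to_range_and_transversal[OF linear_f[OF U z] inj_f[OF U z] dims not_tangent[OF U z] _ vh])
  qed (auto simp: inner_commute bounded_bilinear_inner)
  then interpret orthogonal_family A I inner 1 y .
  have "parallel_family_map 1 inner {x. x \<bullet> x = 1} A I (\<lambda>(x, s). (y (x, s), ln (r s)))"
  proof (rule parallel_family)
    show "smooth_on I (\<lambda>s. ln (r s))" by (rule smooth_on_ln[OF open_I sm_r]) (rule r(2))
    fix s assume s: "s \<in> I"
    show "y (x, s) \<in> {x. x \<bullet> x = 1}" for x using curvature[OF _ s] by simp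
    show "((\<lambda>s. ln (r s)) has_real_derivative r' s / r s) (at s)"
      using dr[OF s] r(2)[OF s] unfolding has_real_derivative_iff_has_vector_derivative[symmetric]
      by (auto intro!: derivative_eq_intros)
    show "r' s / r s \<noteq> 0" using r'_ne[OF s] r(2)[OF s] by simp
  qed
  moreover have "f (x, s) = exp (ln (r s)) *\<^sub>R y (x, s)" if "s \<in> I" for x s
    using r(2)[OF that] by (simp add: y_def k_def)
  ultimately show ?thesis
    by (intro exI[of _ "\<lambda>(x, s). (y (x, s), ln (r s))"]) simp
qed

section \<open>Leaves in parallel hyperplanes\<close>

text \<open>With the last basis vector as common normal, \<Phi> is the splitting into the projection
  \<open>P\<close> and the height, and the height depends on \<open>s\<close> only. One half of
  obliqueness gives t' \<noteq> 0, the other a nonzero projection of f_s.\<close>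

lemma parallel_hyperplanes_case:
  fixes A :: "('p::topological_space, 'e::euclidean_space) chart set"
    and f :: "'p \<times> real \<Rightarrow> 'm::finite euclid_n1"
  assumes enn: "enneper_hypersurface A I f" and dims: "DIM('e) = CARD('m)"
    and leaves: "\<And>s. s \<in> I \<Longrightarrow> \<exists>d. \<forall>x. snd (snd (f (x, s))) = d"
    and not_tangent: "\<And>U \<phi> z. (U, \<phi>) \<in> A \<Longrightarrow> z \<in> \<phi> ` U \<times> I \<Longrightarrow>
      (0, 0, 1) \<notin> range (FD (chart_rep U \<phi> f) z)"
    and not_normal: "\<And>U \<phi> z. (U, \<phi>) \<in> A \<Longrightarrow> z \<in> \<phi> ` U \<times> I \<Longrightarrow>
      \<exists>Z. snd (snd (FD (chart_rep U \<phi> f) z Z)) \<noteq> 0"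
  shows "\<exists>F. parallel_family_map 0 inner UNIV A I F \<and> (\<forall>x. \<forall>s\<in>I. f (x, s) = \<Phi>_flat (F (x, s)))"
proof -
  interpret enneper_hypersurface A I f by (rule enn)
  define P where "P = (\<lambda>v::'m euclid_n1. (fst v, fst (snd v)))"
  have bP: "bounded_linear P"
    unfolding P_def
    by (intro bounded_linear_Pair bounded_linear_fst bounded_linear_compose[OF bounded_linear_fst bounded_linear_snd])
  have bH: "bounded_linear (\<lambda>v::'m euclid_n1. snd (snd v))"
    by (rule bounded_linear_compose[OF bounded_linear_snd bounded_linear_snd])
  have inner_P: "P u \<bullet> P v = u \<bullet> v - snd (snd u) * snd (snd v)" for u v
    by (simp add: P_def inner_prod_def)
  define t where "t = (\<lambda>s. snd (snd (f (undefined, s))))"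
  have t: "snd (snd (f (x, s))) = t s" if "s \<in> I" for x s
    using leaves[OF that] by (auto simp: t_def)
  have sm_t: "smooth_on I t"
    unfolding t_def by (rule smooth_on_linear_compose[OF bH open_I smooth_on_curve[OF smooth_f]])
  define t' where "t' = (\<lambda>s. vector_derivative t (at s))"
  have dt: "(t has_vector_derivative t' s) (at s)" if "s \<in> I" for s
    unfolding t'_def by (rule smooth_on_has_vector_derivative[OF sm_t that])
  define y where "y = (\<lambda>p. P (f p))"
  have rep: "chart_rep U \<phi> y = (\<lambda>z. P (chart_rep U \<phi> f z))" for U \<phi>
    by (auto simp: chart_rep_def y_def)
  have height: "snd (snd (chart_rep U \<phi> f z)) = t (snd z)" if "z \<in> \<phi> ` U \<times> I" for U \<phi> z
    using that t by (auto simp: chart_rep_def)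
  have HX: "snd (snd (FD (chart_rep U \<phi> f) z (X, 0))) = 0"
    and Hs: "snd (snd (FD (chart_rep U \<phi> f) z (0, 1))) = t' (snd z)"
    if U: "(U, \<phi>) \<in> A" and z: "z \<in> \<phi> ` U \<times> I" for U \<phi> z X
  proof -
    let ?h = "chart_rep U \<phi> f"
    have d: "((\<lambda>z. snd (snd (?h z))) has_derivative (\<lambda>Z. snd (snd (FD ?h z Z)))) (at z)"
      by (rule bounded_linear.has_derivative[OF bH has_derivative_f[OF U z]])
    show "snd (snd (FD ?h z (X, 0))) = 0"
    proof (rule const_on_leaf_derivative[OF U z d])
      fix w assume "w \<in> \<phi> ` U"
      then show "snd (snd (?h (w, snd z))) = t (snd z)" using height[of "(w, snd z)" \<phi> U] z by auto
    qed
    have s: "snd z \<in> I" using z by auto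
    have "((\<lambda>s. snd (snd (?h (fst z, s)))) has_vector_derivative snd (snd (FD ?h z (0, 1)))) (at (snd z))"
      using has_vector_derivative_slice[of "\<lambda>z. snd (snd (?h z))" _ "fst z" "snd z"] d by simp
    from has_vector_derivative_diff[OF this dt[OF s]]
    have d2: "((\<lambda>s. snd (snd (?h (fst z, s))) - t s) has_vector_derivative snd (snd (FD ?h z (0, 1))) - t' (snd z)) (at (snd z))" .
    have const: "snd (snd (?h (fst z, s))) - t s = 0" if "s \<in> I" for s
      using height[of "(fst z, s)" \<phi> U] that z by auto
    have "snd (snd (FD ?h z (0, 1))) - t' (snd z) = 0"
      by (rule has_vector_derivative_eq_0[OF open_I s _ d2]) (rule const)
    then show "snd (snd (FD ?h z (0, 1))) = t' (snd z)" by simp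
  qed
  have t'_ne: "t' (snd z) \<noteq> 0" if U: "(U, \<phi>) \<in> A" and z: "z \<in> \<phi> ` U \<times> I" for U \<phi> z
  proof -
    obtain Z where Z: "snd (snd (FD (chart_rep U \<phi> f) z Z)) \<noteq> 0" using not_normal[OF U z] by blast
    have "snd (snd (FD (chart_rep U \<phi> f) z Z)) = snd Z * t' (snd z)"
      using FD_f_split[OF U z, of "fst Z" "snd Z"] HX[OF U z] Hs[OF U z] by simp
    then show ?thesis using Z by auto
  qed
  have Dy: "FD (chart_rep U \<phi> y) z = (\<lambda>Z. P (FD (chart_rep U \<phi> f) z Z))"
    if U: "(U, \<phi>) \<in> A" and z: "z \<in> \<phi> ` U \<times> I" for U \<phi> z
    unfolding rep by (rule FD_eq[OF bounded_linear.has_derivative[OF bP has_derivative_f[OF U z]]])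
  have D2y: "FD (\<lambda>z. FD (chart_rep U \<phi> y) z (0, 1)) z = (\<lambda>Z. P (FD (\<lambda>z. FD (chart_rep U \<phi> f) z (0, 1)) z Z))"
    if U: "(U, \<phi>) \<in> A" and z: "z \<in> \<phi> ` U \<times> I" for U \<phi> z
  proof -
    have "FD (\<lambda>z. FD (chart_rep U \<phi> y) z (0, 1)) z = FD (\<lambda>z. P (FD (chart_rep U \<phi> f) z (0, 1))) z"
      by (rule FD_cong[OF open_chart_image[OF U]
            smooth_on_linear_compose[OF bP open_chart_image[OF U] smooth_on_FD[OF smooth_f[OF U]]] z])
        (simp add: Dy[OF U])
    then show ?thesis
      using FD_eq[OF bounded_linear.has_derivative[OF bP has_derivative_velocity[OF U z]]] by simp
  qed
  have family: "orthogonal_family A I inner 0 y"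
  proof (intro orthogonal_family.intro orthogonal_family_axioms.intro product_manifold_axioms)
    fix U \<phi> assume U: "(U, \<phi>) \<in> A"
    show "smooth_on (\<phi> ` U \<times> I) (chart_rep U \<phi> y)"
      unfolding rep by (rule smooth_on_linear_compose[OF bP open_chart_image[OF U] smooth_f[OF U]])
    fix z and X :: 'e assume z: "z \<in> \<phi> ` U \<times> I"
    let ?h = "chart_rep U \<phi> f"
    show "FD (chart_rep U \<phi> y) z (X, 0) \<bullet> FD (chart_rep U \<phi> y) z (0, 1) = 0"
      using orth_f[OF U z] HX[OF U z] by (simp add: Dy[OF U z] inner_P)
    obtain W \<mu> where W: "FD (\<lambda>z. FD ?h z (0, 1)) z (X, 0) = FD ?h z (W, 0) + \<mu> *\<^sub>R FD ?h z (0, 1)"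
      by (rule adapted_decomp[OF U z])
    \<comment> \<open>The height of f_s is t'(s), constant along the leaf, so f_Xs has height 0.
      Leaf vectors have height 0 too, which leaves \<mu> t' = 0.\<close>
    have "snd (snd (FD (\<lambda>z. FD ?h z (0, 1)) z (X, 0))) = 0"
      by (rule const_on_leaf_derivative[OF U z bounded_linear.has_derivative[OF bH has_derivative_velocity[OF U z]], of "t' (snd z)"])
        (use Hs[OF U] z in auto)
    then have "\<mu> * t' (snd z) = 0" using HX[OF U z] Hs[OF U z] by (simp add: W)
    then have "\<mu> = 0" using t'_ne[OF U z] by simp
    then show "FD (\<lambda>z. FD (chart_rep U \<phi> y) z (0, 1)) z (X, 0) \<bullet> FD (chart_rep U \<phi> y) z (0, 1) = 0"
      using orth_f[OF U z] HX[OF U z] by (simp add: Dy[OF U z] D2y[OF U z] W inner_P)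
    have "FD (chart_rep U \<phi> y) z (0, 1) \<noteq> 0"
    proof
      assume "FD (chart_rep U \<phi> y) z (0, 1) = 0"
      \<comment> \<open>With zero projection, f_s is a nonzero multiple of the normal, which would
        make the normal tangent.\<close>
      then have "FD ?h z (0, 1) = t' (snd z) *\<^sub>R (0, 0, 1)"
        using Hs[OF U z] by (simp add: Dy[OF U z] P_def prod_eq_iff)
      then have "FD ?h z (inverse (t' (snd z)) *\<^sub>R (0, 1)) = (0, 0, 1)"
        unfolding linear_scale[OF linear_f[OF U z]] using t'_ne[OF U z] by simp
      then show False using not_tangent[OF U z] by (metis rangeI)
    qed
    then show "FD (chart_rep U \<phi> y) z (0, 1) \<bullet> FD (chart_rep U \<phi> y) z (0, 1) > 0" by simp
    show "FD (chart_rep U \<phi> y) z (X, 0) \<bullet> FD (chart_rep U \<phi> y) z (X, 0) > 0" if "X \<noteq> 0"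
      using that HX[OF U z] FD_f_eq_0[OF U z, of "(X, 0)"] by (simp add: Dy[OF U z] inner_P zero_prod_def)
    fix v
    assume vX: "\<And>X. v \<bullet> FD (chart_rep U \<phi> y) z (X, 0) = 0" and vs: "v \<bullet> FD (chart_rep U \<phi> y) z (0, 1) = 0"
    \<comment> \<open>Lifting \<open>v\<close> to height 0 is the adjoint of \<open>P\<close>. The
      lift is orthogonal to the tangent space of \<open>f\<close> and to the normal, so the
      codimension-one lemma applies in the ambient space.\<close>
    have vP: "(fst v, snd v, 0) \<bullet> w = v \<bullet> P w" for w by (simp add: P_def inner_prod_def)
    have "(fst v, snd v, 0) \<bullet> FD ?h z Z = 0" for Z
      using FD_f_split[OF U z, of "fst Z" "snd Z"] vX[of "fst Z"] vs
      by (simp add: inner_add_right vP[symmetric] Dy[OF U z])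
    moreover have "(fst v, snd v, 0) \<bullet> (0, 0, 1::real) = 0" by (simp add: inner_prod_def)
    ultimately have "(fst v, snd v, 0::real) = 0"
      by (rule orthogonal_to_range_and_transversal[OF linear_f[OF U z] inj_f[OF U z] _ not_tangent[OF U z], rotated]) (simp add: dims)
    then show "v = 0" by (simp add: prod_eq_iff)
  qed (auto simp: inner_commute bounded_bilinear_inner)
  then interpret orthogonal_family A I inner 0 y .
  have "parallel_family_map 0 inner UNIV A I (\<lambda>(x, s). (y (x, s), t s))"
  proof (rule parallel_family)
    show "smooth_on I t" by (rule sm_t)
    fix s assume s: "s \<in> I"
    show "(t has_real_derivative t' s) (at s)"
      using dt[OF s] by (simp add: has_real_derivative_iff_has_vector_derivative)
    obtain U \<phi> where U: "(U, \<phi>) \<in> A" "undefined \<in> U" by (rule chart_at)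
    show "t' s \<noteq> 0" using t'_ne[OF U(1), of "(\<phi> undefined, s)"] U s by auto
  qed simp
  moreover have "f (x, s) = \<Phi>_flat (y (x, s), t s)" if "s \<in> I" for x s
    using t[OF that, of x] by (simp add: \<Phi>_flat_def y_def P_def prod_eq_iff)
  ultimately show ?thesis
    by (intro exI[of _ "\<lambda>(x, s). (y (x, s), t s)"]) simp
qed

section \<open>Leaves in a pencil of hyperplanes\<close>

lemma plane_orthogonal_collinear:
  fixes u v \<omega> :: "real \<times> real"
  assumes "\<omega> \<noteq> 0" "\<omega> \<bullet> u = 0" "\<omega> \<bullet> v = 0"
  shows "fst u * snd v = snd u * fst v"
proof -
  obtain p q a b c d where v: "\<omega> = (p, q)" "u = (a, b)" "v = (c, d)" by (metis prod.exhaust)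
  have 1: "p * a + q * b = 0" "p * c + q * d = 0" using assms v by (auto simp: inner_prod_def)
  have "p * (a * d - b * c) = 0" "q * (a * d - b * c) = 0" using 1 by algebra+
  moreover have "p \<noteq> 0 \<or> q \<noteq> 0" using assms(1) v by (auto simp: zero_prod_def)
  ultimately show ?thesis using v by auto
qed

lemma plane_collinear_orthogonal:
  fixes u v \<omega> :: "real \<times> real"
  assumes "u \<noteq> 0" "\<omega> \<bullet> u = 0" "fst v * snd u = snd v * fst u"
  shows "\<omega> \<bullet> v = 0"
proof -
  obtain p q a b c d where v: "\<omega> = (p, q)" "u = (a, b)" "v = (c, d)" by (metis prod.exhaust)
  have 1: "p * a + q * b = 0" "c * b = d * a" using assms v by (auto simp: inner_prod_def)
  have "a * (p * c + q * d) = 0" "b * (p * c + q * d) = 0" using 1 by algebra+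
  moreover have "a \<noteq> 0 \<or> b \<noteq> 0" using assms(1) v by (auto simp: zero_prod_def)
  ultimately show ?thesis using v by (auto simp: inner_prod_def)
qed

lemma plane_collinear_unit:
  fixes u e \<omega> :: "real \<times> real"
  assumes "\<omega> \<noteq> 0" "\<omega> \<bullet> u = 0" "\<omega> \<bullet> e = 0" "e \<bullet> e = 1"
  shows "u = (u \<bullet> e) *\<^sub>R e"
proof -
  obtain a b c d where v: "u = (a, b)" "e = (c, d)" by (metis prod.exhaust)
  have 1: "a * d = b * c" "c * c + d * d = 1"
    using plane_orthogonal_collinear[OF assms(1-3)] assms(4) v by (auto simp: inner_prod_def)
  have "a = (a * c + b * d) * c" "b = (a * c + b * d) * d" using 1 by algebra+
  then show ?thesis using v by (simp add: inner_prod_def)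
qed

text \<open>The angle is obtained by integrating the angular velocity, the determinant of
  \<open>e\<close> and \<open>e'\<close>, from a suitable initial angle. The inner product
  \<open>k\<close> of \<open>e\<close> with the unit vector at this angle then has derivative 0 and
  starts at 1.\<close>

lemma unit_circle_lift:
  fixes e :: "real \<Rightarrow> real \<times> real"
  assumes I: "open_interval I" and sm: "smooth_on I e" and unit: "\<And>s. s \<in> I \<Longrightarrow> e s \<bullet> e s = 1"
  shows "\<exists>\<theta> \<theta>'. smooth_on I \<theta> \<and> (\<forall>s\<in>I. (\<theta> has_real_derivative \<theta>' s) (at s) \<and>
    e s = (cos (\<theta> s), sin (\<theta> s)) \<and>
    vector_derivative e (at s) = \<theta>' s *\<^sub>R (- snd (e s), fst (e s)))"
proof -
  have opI: "open I" "is_interval I" "I \<noteq> {}" using I by (auto simp: open_interval_def)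
  obtain s0 where s0: "s0 \<in> I" using opI(3) by blast
  define e' where "e' = (\<lambda>s. vector_derivative e (at s))"
  have de: "(e has_vector_derivative e' s) (at s)" if "s \<in> I" for s
    unfolding e'_def by (rule smooth_on_has_vector_derivative[OF sm that])
  have sm': "smooth_on I e'" unfolding e'_def by (rule smooth_on_vector_derivative[OF opI(1) sm])
  define \<theta>' where "\<theta>' = (\<lambda>s. fst (e s) * snd (e' s) - snd (e s) * fst (e' s))"
  have sm_\<theta>': "smooth_on I \<theta>'"
    unfolding \<theta>'_def
    by (intro smooth_on_diff smooth_on_mult opI(1) smooth_on_linear_compose[OF bounded_linear_fst]
        smooth_on_linear_compose[OF bounded_linear_snd] sm sm')
  have perp: "e s \<bullet> e' s = 0" if "s \<in> I" for s
  proof -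
    have "e s \<bullet> e' s + e' s \<bullet> e s = 0"
      by (rule has_vector_derivative_eq_0[OF opI(1) that _
            bounded_bilinear.has_vector_derivative[OF bounded_bilinear_inner de[OF that] de[OF that]]])
        (rule unit)
    then show ?thesis by (simp add: inner_commute)
  qed
  have e'_eq: "e' s = \<theta>' s *\<^sub>R (- snd (e s), fst (e s))" if "s \<in> I" for s
  proof -
    obtain a b a' b' where v: "e s = (a, b)" "e' s = (a', b')" by (metis prod.exhaust)
    have 1: "a * a + b * b = 1" "a * a' + b * b' = 0"
      using unit[OF that] perp[OF that] v by (auto simp: inner_prod_def)
    have "(a * b' - b * a') * b = - a'" "(a * b' - b * a') * a = b'" using 1 by algebra+
    then show ?thesis using v by (simp add: \<theta>'_def)
  qed
  have "(fst (e s0))\<^sup>2 + (snd (e s0))\<^sup>2 = 1" using unit[OF s0] by (simp add: inner_prod_def power2_eq_square)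
  then obtain c where c: "fst (e s0) = cos c" "snd (e s0) = sin c" by (rule sincos_total_2pi)
  obtain \<theta> where \<theta>: "\<And>s. s \<in> I \<Longrightarrow> (\<theta> has_real_derivative \<theta>' s) (at s)" "\<theta> s0 = c"
    using open_interval_antiderivative[OF I smooth_on_continuous_on[OF sm_\<theta>'] s0] by metis
  have sm_\<theta>: "smooth_on I \<theta>"
    by (rule smooth_on_antiderivative[OF opI(1) _ sm_\<theta>'])
      (use \<theta>(1) in \<open>simp add: has_real_derivative_iff_has_vector_derivative\<close>)
  define k where "k = (\<lambda>s. fst (e s) * cos (\<theta> s) + snd (e s) * sin (\<theta> s))"
  have "(k has_real_derivative 0) (at s)" if "s \<in> I" for s
  proof -
    have "((\<lambda>s. fst (e s)) has_real_derivative fst (e' s)) (at s)"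
      "((\<lambda>s. snd (e s)) has_real_derivative snd (e' s)) (at s)"
      using bounded_linear.has_vector_derivative[OF bounded_linear_fst de[OF that]]
        bounded_linear.has_vector_derivative[OF bounded_linear_snd de[OF that]]
      by (simp_all add: has_real_derivative_iff_has_vector_derivative)
    then show ?thesis
      unfolding k_def using \<theta>(1)[OF that] e'_eq[OF that]
      by (auto intro!: derivative_eq_intros simp: algebra_simps)
  qed
  then have "k s = k s0" if "s \<in> I" for s
    using has_field_derivative_zero_constant[of I k] opI(2) is_interval_convex that s0
      has_field_derivative_at_within by metis
  moreover have "k s0 = 1" by (simp add: k_def \<theta>(2) c flip: power2_eq_square)
  ultimately have k: "k s = 1" if "s \<in> I" for s using that by simp
  have "e s = (cos (\<theta> s), sin (\<theta> s))" if "s \<in> I" for s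
  proof -
    \<comment> \<open>For unit vectors the squared distance is 2 - 2 k, so \<open>k s = 1\<close>
      forces equality.\<close>
    have "(fst (e s) - cos (\<theta> s))\<^sup>2 + (snd (e s) - sin (\<theta> s))\<^sup>2
        = e s \<bullet> e s + ((cos (\<theta> s))\<^sup>2 + (sin (\<theta> s))\<^sup>2) - 2 * k s"
      by (simp add: k_def inner_prod_def power2_eq_square algebra_simps)
    then have "(fst (e s) - cos (\<theta> s))\<^sup>2 + (snd (e s) - sin (\<theta> s))\<^sup>2 = 0"
      using unit[OF that] k[OF that] by simp
    then show ?thesis by (simp add: sum_power2_eq_zero_iff prod_eq_iff)
  qed
  then show ?thesis using sm_\<theta> \<theta>(1) e'_eq unfolding e'_def by blast
qed

section \<open>The hyperboloid and the half-space model\<close>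

lemma bounded_bilinear_lorentz: "bounded_bilinear (lorentz :: 'm::finite lorentz_n1 \<Rightarrow> _)"
  unfolding bilinear_conv_bounded_bilinear[symmetric] bilinear_def
  by (auto intro!: linearI simp: lorentz_def inner_add_left inner_add_right algebra_simps add_divide_distrib diff_divide_distrib)

lemma lorentz_commute: "lorentz u v = lorentz v u"
  by (auto simp: lorentz_def inner_commute split: prod.splits)

text \<open>The upper half-space model, mapped isometrically onto the hyperboloid; the last coordinate
  \<open>snd w\<close> is the distance to the boundary, hence the distance to the axis of the pencil.\<close>

definition half_space :: "(real^'m::finite) \<times> real \<Rightarrow> 'm lorentz_n1" where
  "half_space w = inverse (snd w) *\<^sub>R (1, fst w, w \<bullet> w)"

definition half_space_deriv :: "(real^'m::finite) \<times> real \<Rightarrow> (real^'m) \<times> real \<Rightarrow> 'm lorentz_n1" where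
  "half_space_deriv w v = inverse (snd w) *\<^sub>R (0, fst v, 2 * (w \<bullet> v))
     - (inverse (snd w) * snd v * inverse (snd w)) *\<^sub>R (1, fst w, w \<bullet> w)"

lemma half_space_has_derivative:
  assumes "snd w \<noteq> 0"
  shows "(half_space has_derivative half_space_deriv w) (at w)"
  unfolding half_space_def half_space_deriv_def
  by (rule has_derivative_eq_rhs, (rule derivative_eq_intros refl assms | simp add: assms)+)
    (auto simp: fun_eq_iff inner_commute)

lemma lorentz_half_space:
  assumes "snd w \<noteq> 0"
  shows "lorentz (half_space w) (half_space w) = -1"
  using assms by (cases w) (simp add: half_space_def lorentz_def inner_prod_def field_simps)

text \<open>Conformality is what the half-space model is used for: orthogonality and nonvanishing of
  derivatives can be checked in Euclidean terms, and only speeds acquire the factor 1 /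
  \<open>snd w\<close>.\<close>

lemma lorentz_half_space_deriv:
  assumes "snd w \<noteq> 0"
  shows "lorentz (half_space_deriv w u) (half_space_deriv w v) = (u \<bullet> v) / (snd w)\<^sup>2"
proof -
  obtain p r a b c d where v: "w = (p, r)" "u = (a, b)" "v = (c, d)" by (metis prod.exhaust)
  have r: "r \<noteq> 0" using assms v by simp
  show ?thesis
    unfolding v half_space_deriv_def lorentz_def
    using r by (simp add: inner_prod_def inner_diff_left inner_diff_right inner_commute power2_eq_square field_simps)
qed

text \<open>The form is indefinite, so the coordinates of \<open>v\<close> are read off one by one:
  the vertical direction gives the first, horizontal directions the middle one, and the position
  vector the last.\<close>

lemma lorentz_half_space_nondegenerate:
  assumes w: "snd w \<noteq> 0" and 0: "lorentz v (half_space w) = 0"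
    and d: "\<And>u. lorentz v (half_space_deriv w u) = 0"
  shows "v = 0"
proof -
  interpret bounded_bilinear "lorentz :: 'a lorentz_n1 \<Rightarrow> _" by (rule bounded_bilinear_lorentz)
  obtain v0 v1 v2 where v: "v = (v0, v1, v2)" by (metis prod.exhaust)
  have 1: "lorentz v (1, fst w, w \<bullet> w) = 0" using 0 w unfolding half_space_def scaleR_right by simp
  have 2: "v1 \<bullet> fst u - v0 * (w \<bullet> u) = 0" for u
  proof -
    have "lorentz v (0, fst u, 2 * (w \<bullet> u)) = 0"
      using d[of u] w 1 unfolding half_space_deriv_def diff_right scaleR_right by simp
    then show ?thesis by (simp add: v lorentz_def)
  qed
  have v0: "v0 = 0" using 2[of "(0, 1)"] w by (simp add: inner_prod_def)
  have v1: "v1 = 0" using 2[of "(v1, 0)"] v0 by simp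
  have "v2 = 0" using 1 by (simp add: v v0 v1 lorentz_def)
  then show ?thesis using v v0 v1 by (simp add: zero_prod_def)
qed

text \<open>The assumption \<open>parallel\<close> is constancy of the hyperbolic speed |w_s| / r
  along leaves, r being the last coordinate of w: differentiating |w_s|^2 / r^2 and clearing
  denominators gives r <w_Xs, w_s> = r_X |w_s|^2.\<close>

lemma (in product_manifold) half_space_family:
  fixes w :: "'p \<times> real \<Rightarrow> (real^'m::finite) \<times> real"
  assumes dims: "DIM('e) = CARD('m)"
    and smooth: "\<And>U \<phi>. (U, \<phi>) \<in> A \<Longrightarrow> smooth_on (\<phi> ` U \<times> I) (chart_rep U \<phi> w)"
    and pos: "\<And>x s. s \<in> I \<Longrightarrow> snd (w (x, s)) > 0"
    and orth: "\<And>U \<phi> z X. (U, \<phi>) \<in> A \<Longrightarrow> z \<in> \<phi> ` U \<times> I \<Longrightarrow>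
      FD (chart_rep U \<phi> w) z (X, 0) \<bullet> FD (chart_rep U \<phi> w) z (0, 1) = 0"
    and velocity_ne: "\<And>U \<phi> z. (U, \<phi>) \<in> A \<Longrightarrow> z \<in> \<phi> ` U \<times> I \<Longrightarrow> FD (chart_rep U \<phi> w) z (0, 1) \<noteq> 0"
    and leaf_ne: "\<And>U \<phi> z X. (U, \<phi>) \<in> A \<Longrightarrow> z \<in> \<phi> ` U \<times> I \<Longrightarrow> X \<noteq> 0 \<Longrightarrow>
      FD (chart_rep U \<phi> w) z (X, 0) \<noteq> 0"
    and parallel: "\<And>U \<phi> z X. (U, \<phi>) \<in> A \<Longrightarrow> z \<in> \<phi> ` U \<times> I \<Longrightarrow>
      snd (chart_rep U \<phi> w z) * (FD (\<lambda>z. FD (chart_rep U \<phi> w) z (0, 1)) z (X, 0) \<bullet> FD (chart_rep U \<phi> w) z (0, 1))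
      = snd (FD (chart_rep U \<phi> w) z (X, 0)) * (FD (chart_rep U \<phi> w) z (0, 1) \<bullet> FD (chart_rep U \<phi> w) z (0, 1))"
  shows "orthogonal_family A I lorentz (-1) (\<lambda>p. half_space (w p))"
proof (intro orthogonal_family.intro orthogonal_family_axioms.intro product_manifold_axioms)
  let ?y = "\<lambda>p. half_space (w p)"
  show "lorentz (?y (x, s)) (?y (x, s)) = of_int (- 1)" if "s \<in> I" for x s
    using lorentz_half_space[of "w (x, s)"] pos[OF that, of x] by simp
  fix U \<phi> assume U: "(U, \<phi>) \<in> A"
  let ?w = "chart_rep U \<phi> w" and ?D = "\<phi> ` U \<times> I"
  have op: "open ?D" by (rule open_chart_image[OF U])
  have rep: "chart_rep U \<phi> ?y = (\<lambda>z. half_space (?w z))" by (auto simp: chart_rep_def)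
  have r: "snd (?w z) > 0" if "z \<in> ?D" for z using that pos by (auto simp: chart_rep_def)
  have sm_r: "smooth_on ?D (\<lambda>z. snd (?w z))"
    by (rule smooth_on_linear_compose[OF bounded_linear_snd op smooth[OF U]])
  have sm_k: "smooth_on ?D (\<lambda>z. inverse (snd (?w z)))"
    by (rule smooth_on_inverse[OF op sm_r]) (use r in force)
  show sm_y: "smooth_on ?D (chart_rep U \<phi> ?y)"
    unfolding rep unfolding half_space_def
    by (intro smooth_on_scaleR[OF op sm_k] smooth_on_Pair[OF op] smooth_on_const
        smooth_on_inner[OF op smooth[OF U] smooth[OF U]]
        smooth_on_linear_compose[OF bounded_linear_fst op smooth[OF U]])
  have dw: "(?w has_derivative FD ?w z) (at z)" if "z \<in> ?D" for z
    by (rule smooth_on_has_derivative[OF smooth[OF U] that])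
  have Dy: "FD (chart_rep U \<phi> ?y) z = (\<lambda>Z. half_space_deriv (?w z) (FD ?w z Z))" if "z \<in> ?D" for z
  proof -
    have "snd (?w z) \<noteq> 0" using r[OF that] by simp
    from diff_chain_at[OF dw[OF that] half_space_has_derivative[OF this]]
    show ?thesis unfolding rep by (intro FD_eq) (simp add: o_def)
  qed
  have conformal: "lorentz (FD (chart_rep U \<phi> ?y) z Z) (FD (chart_rep U \<phi> ?y) z Z')
      = (FD ?w z Z \<bullet> FD ?w z Z') / (snd (?w z))\<^sup>2" if "z \<in> ?D" for z Z Z'
    using r[OF that] by (simp add: Dy[OF that] lorentz_half_space_deriv)
  fix z and X :: 'e assume z: "z \<in> ?D"
  have rz: "snd (?w z) > 0" by (rule r[OF z])
  show "lorentz (FD (chart_rep U \<phi> ?y) z (X, 0)) (FD (chart_rep U \<phi> ?y) z (0, 1)) = 0"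
    by (simp add: conformal[OF z] orth[OF U z])
  show "lorentz (FD (chart_rep U \<phi> ?y) z (0, 1)) (FD (chart_rep U \<phi> ?y) z (0, 1)) > 0"
    using velocity_ne[OF U z] rz by (simp add: conformal[OF z])
  show "lorentz (FD (chart_rep U \<phi> ?y) z (X, 0)) (FD (chart_rep U \<phi> ?y) z (X, 0)) > 0" if "X \<noteq> 0"
    using leaf_ne[OF U z that] rz by (simp add: conformal[OF z])
  define G where "G = (\<lambda>z. FD (chart_rep U \<phi> ?y) z (0, 1))"
  define V where "V = (\<lambda>z. FD ?w z (0, 1))"
  have dG: "(G has_derivative FD G z) (at z)"
    unfolding G_def by (rule smooth_on_has_derivative[OF smooth_on_FD[OF sm_y] z])
  have dV: "(V has_derivative FD V z) (at z)"
    unfolding V_def by (rule smooth_on_has_derivative[OF smooth_on_FD[OF smooth[OF U]] z])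
  have dr: "((\<lambda>z. snd (?w z)) has_derivative (\<lambda>Z. snd (FD ?w z Z))) (at z)"
    by (rule has_derivative_snd[OF dw[OF z]])
  have d: "((\<lambda>z. lorentz (G z) (G z) * (snd (?w z) * snd (?w z)) - V z \<bullet> V z) has_derivative
      (\<lambda>Z. lorentz (G z) (G z) * (snd (?w z) * snd (FD ?w z Z) + snd (FD ?w z Z) * snd (?w z))
        + (lorentz (G z) (FD G z Z) + lorentz (FD G z Z) (G z)) * (snd (?w z) * snd (?w z))
        - (V z \<bullet> FD V z Z + FD V z Z \<bullet> V z))) (at z)"
    by (intro has_derivative_diff has_derivative_mult bounded_bilinear.FDERIV[OF bounded_bilinear_lorentz dG dG]
        dr has_derivative_inner[OF dV dV])
  \<comment> \<open>The conformal relation between the two squared speeds is kept in product form,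
    so that differentiating it along X requires no quotient rule.\<close>
  have zero: "lorentz (G z) (G z) * (snd (?w z) * snd (?w z)) - V z \<bullet> V z = 0" if "z \<in> ?D" for z
    using conformal[OF that, of "(0, 1)" "(0, 1)"] r[OF that] by (simp add: G_def V_def power2_eq_square)
  have "lorentz (G z) (G z) * (snd (?w z) * snd (FD ?w z (X, 0)) + snd (FD ?w z (X, 0)) * snd (?w z))
        + (lorentz (G z) (FD G z (X, 0)) + lorentz (FD G z (X, 0)) (G z)) * (snd (?w z) * snd (?w z))
        - (V z \<bullet> FD V z (X, 0) + FD V z (X, 0) \<bullet> V z) = 0"
    by (rule has_derivative_eq_0_of_const[OF op z _ d]) (rule zero)
  moreover have "lorentz (G z) (G z) * (snd (?w z) * snd (?w z)) = V z \<bullet> V z"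
    using conformal[OF z, of "(0, 1)" "(0, 1)"] rz by (simp add: G_def V_def power2_eq_square)
  moreover have "snd (?w z) * (FD V z (X, 0) \<bullet> V z) = snd (FD ?w z (X, 0)) * (V z \<bullet> V z)"
    using parallel[OF U z, of X] by (simp add: V_def)
  moreover have "lorentz (G z) (FD G z (X, 0)) = lorentz (FD G z (X, 0)) (G z)" by (rule lorentz_commute)
  moreover have "V z \<bullet> FD V z (X, 0) = FD V z (X, 0) \<bullet> V z" by (rule inner_commute)
  \<comment> \<open>Multiplying the differentiated relation by r makes \<open>parallel\<close>
    applicable; the Euclidean terms then cancel and r^3 remains as a factor.\<close>
  ultimately have "lorentz (FD G z (X, 0)) (G z) * (snd (?w z) * snd (?w z) * snd (?w z)) = 0"
    by algebra
  then show "lorentz (FD (\<lambda>z. FD (chart_rep U \<phi> ?y) z (0, 1)) z (X, 0)) (FD (chart_rep U \<phi> ?y) z (0, 1)) = 0"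
    using rz by (simp add: G_def)
  fix v
  assume vX: "\<And>X. lorentz v (FD (chart_rep U \<phi> ?y) z (X, 0)) = 0"
    and vs: "lorentz v (FD (chart_rep U \<phi> ?y) z (0, 1)) = 0"
    and vy: "(-1::int) \<noteq> 0 \<Longrightarrow> lorentz v (chart_rep U \<phi> ?y z) = 0"
  have lin: "linear (FD ?w z)" by (rule has_derivative_linear[OF dw[OF z]])
  have split: "L (Y, a) = L (Y, 0) + a *\<^sub>R L (0, 1)" if "linear L" for L :: "'e \<times> real \<Rightarrow> 'w::real_vector" and Y a
    using linear_add[OF that, of "(Y, 0)" "a *\<^sub>R (0, 1)"] linear_scale[OF that, of a "(0, 1)"] by simp
  \<comment> \<open>Pairing with w_s removes the leaf part by orthogonality, so the differential of
    \<open>w\<close> is injective, and bijective by dimension. Hence testing along the family covers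
    every direction \<open>u\<close> of the half-space.\<close>
  have "Z = 0" if "FD ?w z Z = 0" for Z
  proof -
    have 0: "FD ?w z (fst Z, 0) + snd Z *\<^sub>R FD ?w z (0, 1) = 0"
      using split[OF lin, of "fst Z" "snd Z"] that by simp
    have "(FD ?w z (fst Z, 0) + snd Z *\<^sub>R FD ?w z (0, 1)) \<bullet> FD ?w z (0, 1) = 0" unfolding 0 by simp
    then have "snd Z = 0" using orth[OF U z] velocity_ne[OF U z] by (simp add: inner_add_left)
    moreover from this have "fst Z = 0" using 0 leaf_ne[OF U z] by auto
    ultimately show ?thesis by (simp add: prod_eq_iff)
  qed
  then have "inj (FD ?w z)" using linear_injective_0[OF lin] by blast
  then have surj: "surj (FD ?w z)" by (rule linear_inj_imp_surj_DIM[OF lin]) (simp add: dims)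
  have liny: "linear (FD (chart_rep U \<phi> ?y) z)"
    by (rule has_derivative_linear[OF smooth_on_has_derivative[OF sm_y z]])
  interpret lorentz: bounded_bilinear "lorentz :: 'm lorentz_n1 \<Rightarrow> _" by (rule bounded_bilinear_lorentz)
  have vZ: "lorentz v (FD (chart_rep U \<phi> ?y) z Z) = 0" for Z
    using split[OF liny, of "fst Z" "snd Z"] vX vs by (simp add: lorentz.add_right lorentz.scaleR_right)
  show "v = 0"
  proof (rule lorentz_half_space_nondegenerate)
    show "snd (?w z) \<noteq> 0" using rz by simp
    show "lorentz v (half_space (?w z)) = 0" using vy by (simp add: rep)
    fix u
    obtain Z where "u = FD ?w z Z" using surj by (rule surjE)
    then show "lorentz v (half_space_deriv (?w z) u) = 0" using vZ[of Z] by (simp add: Dy[OF z])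
  qed
qed (auto intro: lorentz_commute bounded_bilinear_lorentz)

lemma (in product_manifold) continuous_on_leaf:
  fixes f :: "'p \<times> real \<Rightarrow> 'w::euclidean_space"
  assumes "\<And>U \<phi>. (U, \<phi>) \<in> A \<Longrightarrow> smooth_on (\<phi> ` U \<times> I) (chart_rep U \<phi> f)" and s: "s \<in> I"
  shows "continuous_on UNIV (\<lambda>x. f (x, s))"
proof -
  have "continuous_on (fst c) (\<lambda>x. f (x, s))" if "c \<in> A" for c
  proof -
    obtain U \<phi> where c: "c = (U, \<phi>)" by (cases c)
    then have U: "(U, \<phi>) \<in> A" using that by simp
    have "continuous_on (\<phi> ` U) (\<lambda>z. chart_rep U \<phi> f (z, s))"
      by (rule smooth_on_continuous_on[OF smooth_on_slice(1)[OF U assms(1)[OF U] s]])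
    then have "continuous_on U (\<lambda>x. chart_rep U \<phi> f (\<phi> x, s))"
      by (rule continuous_on_compose2[OF _ chartD(4)[OF U]]) simp
    then show ?thesis
      unfolding c fst_conv by (rule continuous_on_eq) (rule chart_rep_apply[OF U])
  qed
  moreover have "open (fst c)" if "c \<in> A" for c using chartD(1)[of "fst c" "snd c"] that by simp
  moreover have "(\<Union>c\<in>A. fst c) = UNIV" using atlas by (simp add: smooth_atlas_def)
  ultimately show ?thesis using continuous_on_open_UN[of A fst "\<lambda>x. f (x, s)"] by simp
qed

text \<open>The axis is normalised to vectors with \<open>snd y = 0\<close>, so normals of the
  pencil are the vectors (0, \<omega>). Obliqueness is assumed for each \<omega> whose hyperplane
  contains the leaf: a leaf inside the axis would lie in all of them, and the argument excluding it
  picks its own \<omega>.\<close>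

lemma hyperplane_pencil_case:
  fixes A :: "('p::topological_space, 'e::euclidean_space) chart set"
    and f :: "'p \<times> real \<Rightarrow> 'm::finite euclid_n1"
  assumes enn: "enneper_hypersurface A I f" and dims: "DIM('e) = CARD('m)"
    and leaves: "\<And>s. s \<in> I \<Longrightarrow> \<exists>\<omega>. \<omega> \<noteq> 0 \<and> (\<forall>x. \<omega> \<bullet> snd (f (x, s)) = 0)"
    and not_tangent: "\<And>U \<phi> x s \<omega>. s \<in> I \<Longrightarrow> \<omega> \<noteq> 0 \<Longrightarrow> (\<And>x. \<omega> \<bullet> snd (f (x, s)) = 0) \<Longrightarrow>
      (U, \<phi>) \<in> A \<Longrightarrow> x \<in> U \<Longrightarrow> (0, \<omega>) \<notin> range (FD (chart_rep U \<phi> f) (\<phi> x, s))"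
    and not_normal: "\<And>U \<phi> x s \<omega>. s \<in> I \<Longrightarrow> \<omega> \<noteq> 0 \<Longrightarrow> (\<And>x. \<omega> \<bullet> snd (f (x, s)) = 0) \<Longrightarrow>
      (U, \<phi>) \<in> A \<Longrightarrow> x \<in> U \<Longrightarrow> \<exists>Z. \<omega> \<bullet> snd (FD (chart_rep U \<phi> f) (\<phi> x, s) Z) \<noteq> 0"
  shows "\<exists>F. parallel_family_map (-1) lorentz hyperbolic A I F \<and> (\<forall>x. \<forall>s\<in>I. f (x, s) = \<Phi>_hyperbolic (F (x, s)))"
proof -
  interpret enneper_hypersurface A I f by (rule enn)
  define q where "q = (\<lambda>x s. snd (f (x, s)))"
  have rep_f: "chart_rep U \<phi> f (\<phi> x, s) = f (x, s)" if "(U, \<phi>) \<in> A" "x \<in> U" for U \<phi> x s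
    by (rule chart_rep_apply[OF that])
  have velocity_component: "\<omega> \<bullet> snd (FD (chart_rep U \<phi> f) (\<phi> x, s) (0, 1)) \<noteq> 0"
    if s: "s \<in> I" and \<omega>: "\<omega> \<noteq> 0" "\<And>x. \<omega> \<bullet> q x s = 0" and U: "(U, \<phi>) \<in> A" "x \<in> U" for U \<phi> x s \<omega>
  proof -
    let ?h = "chart_rep U \<phi> f"
    have z: "(\<phi> x, s) \<in> \<phi> ` U \<times> I" using U s by auto
    have d: "((\<lambda>z. (0, \<omega>) \<bullet> ?h z) has_derivative (\<lambda>Z. (0, \<omega>) \<bullet> FD ?h (\<phi> x, s) Z)) (at (\<phi> x, s))"
      by (rule has_derivative_inner_right[OF has_derivative_f[OF U(1) z]])
    have "(0, \<omega>) \<bullet> FD ?h (\<phi> x, s) (X, 0) = 0" for X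
    proof (rule const_on_leaf_derivative[OF U(1) z d])
      fix u assume "u \<in> \<phi> ` U"
      then show "(0, \<omega>) \<bullet> ?h (u, snd (\<phi> x, s)) = 0"
        using \<omega>(2) by (auto simp: rep_f[OF U(1)] q_def inner_prod_def)
    qed
    moreover obtain Z where "(0, \<omega>) \<bullet> FD ?h (\<phi> x, s) Z \<noteq> 0"
      using not_normal[OF s \<omega>(1) _ U] \<omega>(2) by (auto simp: q_def inner_prod_def)
    ultimately have "(0, \<omega>) \<bullet> FD ?h (\<phi> x, s) (0, 1) \<noteq> 0"
      by (rule transversal_velocity[OF U(1) z])
    then show ?thesis by (simp add: inner_prod_def)
  qed
  \<comment> \<open>A leaf inside the axis would have the same dimension as the axis, so its tangent
    space would be the whole direction space of the axis. Orthogonality of the net then gives f_s =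
    (0, \<omega>), a tangent normal to a hyperplane of the pencil that contains this leaf.\<close>
  have leaf_off_axis: "\<exists>x. q x s \<noteq> 0" if s: "s \<in> I" for s
  proof (rule ccontr)
    assume "\<not> (\<exists>x. q x s \<noteq> 0)"
    then have q0: "q x s = 0" for x by blast
    obtain U \<phi> where U: "(U, \<phi>) \<in> A" "undefined \<in> U" by (rule chart_at)
    let ?h = "chart_rep U \<phi> f" and ?z = "(\<phi> undefined, s)"
    have z: "?z \<in> \<phi> ` U \<times> I" using U s by auto
    have qX: "snd (FD ?h ?z (X, 0)) = 0" for X
    proof (rule const_on_leaf_derivative[OF U(1) z has_derivative_snd[OF has_derivative_f[OF U(1) z]]])
      fix u assume "u \<in> \<phi> ` U"
      then show "snd (?h (u, snd ?z)) = 0" using q0 by (auto simp: rep_f[OF U(1)] q_def)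
    qed
    interpret D: linear "FD ?h ?z" by (rule linear_f[OF U(1) z])
    have lin: "linear (\<lambda>X. fst (FD ?h ?z (X, 0)))"
    proof (rule linearI)
      show "fst (FD ?h ?z (X + Y, 0)) = fst (FD ?h ?z (X, 0)) + fst (FD ?h ?z (Y, 0))" for X Y
        using D.add[of "(X, 0)" "(Y, 0)"] by simp
      show "fst (FD ?h ?z (a *\<^sub>R X, 0)) = a *\<^sub>R fst (FD ?h ?z (X, 0))" for a X
        using D.scale[of a "(X, 0)"] by simp
    qed
    have "X = 0" if "fst (FD ?h ?z (X, 0)) = 0" for X
      using that qX[of X] FD_f_eq_0[OF U(1) z, of "(X, 0)"] by (simp add: prod_eq_iff)
    then have "inj (\<lambda>X. fst (FD ?h ?z (X, 0)))" using linear_injective_0[OF lin] by blast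
    then have "surj (\<lambda>X. fst (FD ?h ?z (X, 0)))"
      by (rule linear_inj_imp_surj_DIM[OF lin]) (simp add: dims)
    then obtain X where X: "fst (FD ?h ?z (0, 1)) = fst (FD ?h ?z (X, 0))" by (rule surjE)
    have "fst (FD ?h ?z (X, 0)) \<bullet> fst (FD ?h ?z (0, 1)) = 0"
      using orth_f[OF U(1) z, of X] qX[of X] by (simp add: inner_prod_def)
    then have p0: "fst (FD ?h ?z (0, 1)) = 0" using X by simp
    define \<omega> where "\<omega> = snd (FD ?h ?z (0, 1))"
    have eq: "FD ?h ?z (0, 1) = (0, \<omega>)" using p0 by (simp add: \<omega>_def prod_eq_iff)
    then have "\<omega> \<noteq> 0" using FD_f_eq_0[OF U(1) z, of "(0, 1)"] by (auto simp: zero_prod_def)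
    then have "(0, \<omega>) \<notin> range (FD ?h ?z)"
      using not_tangent[OF s _ _ U] q0 by (simp add: q_def)
    then show False using eq by (metis rangeI)
  qed
  have q_ne: "q x s \<noteq> 0" if s: "s \<in> I" for x s
  proof
    assume q0: "q x s = 0"
    \<comment> \<open>The comparison point fixes the direction of the leaf's hyperplane; at the
      point \<open>x\<close> itself that information is lost.\<close>
    obtain x1 where x1: "q x1 s \<noteq> 0" using leaf_off_axis[OF s] by blast
    obtain \<omega> where \<omega>: "\<omega> \<noteq> 0" "\<And>x. \<omega> \<bullet> q x s = 0" using leaves[OF s] by (auto simp: q_def)
    obtain U \<phi> where U: "(U, \<phi>) \<in> A" "x \<in> U" by (rule chart_at)
    define D where "D = snd (FD (chart_rep U \<phi> f) (\<phi> x, s) (0, 1))"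
    have dx: "((\<lambda>s. q x s) has_vector_derivative D) (at s)"
      unfolding q_def D_def
      by (rule bounded_linear.has_vector_derivative[OF bounded_linear_snd curve_derivative[OF U s smooth_f[OF U(1)]]])
    obtain D1 where dx1: "((\<lambda>s. q x1 s) has_vector_derivative D1) (at s)"
      unfolding q_def
      using smooth_on_has_vector_derivative[OF smooth_on_linear_compose[OF bounded_linear_snd open_I smooth_on_curve[OF smooth_f]] s]
      by blast
    note comp = bounded_linear.has_vector_derivative[OF bounded_linear_fst]
      bounded_linear.has_vector_derivative[OF bounded_linear_snd]
    \<comment> \<open>Collinearity is written as a vanishing determinant, which can be
      differentiated although the normals \<omega> are given only leaf by leaf. Where
      \<open>q x s = 0\<close>, just the terms with \<open>D\<close> survive, and they make
      \<open>D\<close> collinear with \<open>q x1 s\<close>.\<close>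
    have d: "((\<lambda>s. fst (q x s) * snd (q x1 s) - snd (q x s) * fst (q x1 s)) has_vector_derivative
        (fst (q x s) * snd D1 + fst D * snd (q x1 s)) - (snd (q x s) * fst D1 + snd D * fst (q x1 s))) (at s)"
      by (rule has_vector_derivative_diff[OF has_vector_derivative_mult[OF comp(1)[OF dx] comp(2)[OF dx1]]
            has_vector_derivative_mult[OF comp(2)[OF dx] comp(1)[OF dx1]]])
    have "(fst (q x s) * snd D1 + fst D * snd (q x1 s)) - (snd (q x s) * fst D1 + snd D * fst (q x1 s)) = 0"
    proof (rule has_vector_derivative_eq_0[OF open_I s _ d])
      fix r assume "r \<in> I"
      then obtain \<omega> where "\<omega> \<noteq> 0" "\<And>x. \<omega> \<bullet> q x r = 0" using leaves[of r] by (auto simp: q_def)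
      then show "fst (q x r) * snd (q x1 r) - snd (q x r) * fst (q x1 r) = 0"
        using plane_orthogonal_collinear[of \<omega> "q x r" "q x1 r"] by simp
    qed
    then have "fst D * snd (q x1 s) = snd D * fst (q x1 s)" using q0 by simp
    then have "\<omega> \<bullet> D = 0" using plane_collinear_orthogonal[OF x1 \<omega>(2)] by simp
    then show False using velocity_component[OF s \<omega> U] by (simp add: D_def)
  qed
  \<comment> \<open>The unit direction from the axis to the leaf, read off at an arbitrary base
    point; \<open>q_polar\<close> shows that every point of the leaf gives the same one.\<close>
  define e where "e = (\<lambda>s. inverse (norm (q undefined s)) *\<^sub>R q undefined s)"
  have sm_q: "smooth_on I (q x)" for x
    unfolding q_def by (rule smooth_on_linear_compose[OF bounded_linear_snd open_I smooth_on_curve[OF smooth_f]])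
  have sm_e: "smooth_on I e"
    unfolding e_def
    by (rule smooth_on_scaleR[OF open_I smooth_on_inverse[OF open_I smooth_on_norm[OF open_I sm_q]] sm_q])
      (simp_all add: q_ne)
  have unit: "e s \<bullet> e s = 1" if "s \<in> I" for s
  proof -
    have "norm (e s) = 1" using q_ne[OF that] by (simp add: e_def)
    then show ?thesis by (simp add: dot_square_norm)
  qed
  have q_polar: "q x s = norm (q x s) *\<^sub>R e s" if s: "s \<in> I" for x s
  proof -
    obtain \<omega> where \<omega>: "\<omega> \<noteq> 0" "\<And>x. \<omega> \<bullet> q x s = 0" using leaves[OF s] by (auto simp: q_def)
    have "\<omega> \<bullet> e s = 0" using \<omega>(2) by (simp add: e_def)
    then have q: "q x s = (q x s \<bullet> e s) *\<^sub>R e s" for x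
      by (rule plane_collinear_unit[OF \<omega> _ unit[OF s]])
    have ne: "q x s \<bullet> e s \<noteq> 0" for x using q[of x] q_ne[OF s, of x] by auto
    \<comment> \<open>Collinearity leaves a sign open. The coefficient is continuous on a connected
      space, never 0, and positive at the base point, so the leaf stays on one side of the
      axis.\<close>
    have "continuous_on UNIV (\<lambda>x. q x s \<bullet> e s)"
      unfolding q_def by (intro continuous_intros continuous_on_leaf[OF smooth_f s])
    then have iv: "is_interval (range (\<lambda>x. q x s \<bullet> e s))"
      using connected_continuous_image connected_base is_interval_connected_1 by blast
    have pos0: "q undefined s \<bullet> e s > 0"
      using q_ne[OF s, of undefined] by (simp add: e_def)
    have "q x s \<bullet> e s > 0"
    proof (rule ccontr)
      assume "\<not> q x s \<bullet> e s > 0"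
      then have "0 \<in> range (\<lambda>x. q x s \<bullet> e s)"
        using iv pos0 unfolding is_interval_1 by (meson less_imp_le not_less rangeI)
      then show False using ne by auto
    qed
    moreover have "norm (e s) = 1" using unit[OF s] by (simp add: norm_eq_1)
    ultimately have "norm (q x s) = q x s \<bullet> e s" using arg_cong[OF q[of x], of norm] by simp
    then show ?thesis using q[of x] by simp
  qed
  obtain \<theta> \<theta>' where \<theta>: "smooth_on I \<theta>" "\<And>s. s \<in> I \<Longrightarrow> (\<theta> has_real_derivative \<theta>' s) (at s)"
    "\<And>s. s \<in> I \<Longrightarrow> e s = (cos (\<theta> s), sin (\<theta> s))"
    "\<And>s. s \<in> I \<Longrightarrow> vector_derivative e (at s) = \<theta>' s *\<^sub>R (- snd (e s), fst (e s))"
    using unit_circle_lift[OF interval sm_e unit] by blast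
  define e' where "e' = (\<lambda>s. vector_derivative e (at s))"
  have de: "(e has_vector_derivative e' s) (at s)" if "s \<in> I" for s
    unfolding e'_def by (rule smooth_on_has_vector_derivative[OF sm_e that])
  have sm_e': "smooth_on I e'" unfolding e'_def by (rule smooth_on_vector_derivative[OF open_I sm_e])
  have ee': "e s \<bullet> e' s = 0" if "s \<in> I" for s
    using \<theta>(4)[OF that] by (simp add: e'_def inner_prod_def)
  \<comment> \<open>Position along the axis and distance from it: with the angle \<theta> these are
    cylindrical coordinates of \<open>f\<close>.\<close>
  define w where "w = (\<lambda>p. (fst (f p), norm (snd (f p))))"
  define \<rho> :: "'p set \<Rightarrow> ('p \<Rightarrow> 'e) \<Rightarrow> 'e \<times> real \<Rightarrow> real" where "\<rho> = (\<lambda>U \<phi> z. norm (snd (chart_rep U \<phi> f z)))"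
  have rep: "chart_rep U \<phi> w = (\<lambda>z. (fst (chart_rep U \<phi> f z), \<rho> U \<phi> z))" for U \<phi>
    by (auto simp: chart_rep_def w_def \<rho>_def)
  have snd_ne: "snd (chart_rep U \<phi> f z) \<noteq> 0" if "z \<in> \<phi> ` U \<times> I" for U \<phi> z
    using that q_ne by (auto simp: chart_rep_def q_def)
  have \<rho>_pos: "\<rho> U \<phi> z > 0" if "z \<in> \<phi> ` U \<times> I" for U \<phi> z
    using snd_ne[OF that] by (simp add: \<rho>_def)
  have sm_\<rho>: "smooth_on (\<phi> ` U \<times> I) (\<rho> U \<phi>)" if "(U, \<phi>) \<in> A" for U \<phi>
    unfolding \<rho>_def
    by (rule smooth_on_norm[OF open_chart_image[OF that]
          smooth_on_linear_compose[OF bounded_linear_snd open_chart_image[OF that] smooth_f[OF that]]])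
      (rule snd_ne)
  have polar: "snd (chart_rep U \<phi> f z) = \<rho> U \<phi> z *\<^sub>R e (snd z)" if "z \<in> \<phi> ` U \<times> I" for U \<phi> z
    using that q_polar by (auto simp: chart_rep_def \<rho>_def q_def)
  have d\<rho>: "(\<rho> U \<phi> has_derivative FD (\<rho> U \<phi>) z) (at z)" if "(U, \<phi>) \<in> A" "z \<in> \<phi> ` U \<times> I" for U \<phi> z
    by (rule smooth_on_has_derivative[OF sm_\<rho>[OF that(1)] that(2)])
  have d\<rho>s: "((\<lambda>z. FD (\<rho> U \<phi>) z (0, 1)) has_derivative FD (\<lambda>z. FD (\<rho> U \<phi>) z (0, 1)) z) (at z)"
    if "(U, \<phi>) \<in> A" "z \<in> \<phi> ` U \<times> I" for U \<phi> z
    by (rule smooth_on_has_derivative[OF smooth_on_FD[OF sm_\<rho>[OF that(1)]] that(2)])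
  have dcurve: "((\<lambda>z. c (snd z)) has_derivative (\<lambda>Z. snd Z *\<^sub>R c')) (at z)"
    if "(c has_vector_derivative c') (at (snd z))" for c :: "real \<Rightarrow> real \<times> real" and c' and z :: "'e \<times> real"
    using diff_chain_at[OF has_derivative_snd[OF has_derivative_ident] that[unfolded has_vector_derivative_def]]
    by (simp add: o_def)
  \<comment> \<open>As \<open>e\<close> depends on \<open>s\<close> alone, leaf vectors have no
    \<open>e'\<close> term, while f_s has one with coefficient \<rho>.\<close>
  have Dq: "snd (FD (chart_rep U \<phi> f) z Z) = FD (\<rho> U \<phi>) z Z *\<^sub>R e (snd z) + (snd Z * \<rho> U \<phi> z) *\<^sub>R e' (snd z)"
    if U: "(U, \<phi>) \<in> A" and z: "z \<in> \<phi> ` U \<times> I" for U \<phi> z Z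
  proof -
    have s: "snd z \<in> I" using z by auto
    have 1: "((\<lambda>z. snd (chart_rep U \<phi> f z)) has_derivative (\<lambda>Z. snd (FD (chart_rep U \<phi> f) z Z))) (at z)"
      by (rule has_derivative_snd[OF has_derivative_f[OF U z]])
    have 2: "((\<lambda>z. \<rho> U \<phi> z *\<^sub>R e (snd z)) has_derivative
        (\<lambda>Z. \<rho> U \<phi> z *\<^sub>R (snd Z *\<^sub>R e' (snd z)) + FD (\<rho> U \<phi>) z Z *\<^sub>R e (snd z))) (at z)"
      by (rule has_derivative_scaleR[OF d\<rho>[OF U z] dcurve[OF de[OF s]]])
    have "((\<lambda>z. snd (chart_rep U \<phi> f z)) has_derivative
        (\<lambda>Z. \<rho> U \<phi> z *\<^sub>R (snd Z *\<^sub>R e' (snd z)) + FD (\<rho> U \<phi>) z Z *\<^sub>R e (snd z))) (at z)"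
      by (rule has_derivative_transform_within_open[OF 2 open_chart_image[OF U] z]) (simp add: polar)
    from fun_cong[OF has_derivative_unique[OF 1 this], of Z]
    show ?thesis by (simp add: mult.commute)
  qed
  have D2q: "snd (FD (\<lambda>z. FD (chart_rep U \<phi> f) z (0, 1)) z (X, 0))
      = FD (\<lambda>z. FD (\<rho> U \<phi>) z (0, 1)) z (X, 0) *\<^sub>R e (snd z) + FD (\<rho> U \<phi>) z (X, 0) *\<^sub>R e' (snd z)"
    if U: "(U, \<phi>) \<in> A" and z: "z \<in> \<phi> ` U \<times> I" for U \<phi> z X
  proof -
    have s: "snd z \<in> I" using z by auto
    have 1: "((\<lambda>z. snd (FD (chart_rep U \<phi> f) z (0, 1))) has_derivative
        (\<lambda>Z. snd (FD (\<lambda>z. FD (chart_rep U \<phi> f) z (0, 1)) z Z))) (at z)"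
      by (rule has_derivative_snd[OF has_derivative_velocity[OF U z]])
    define e'' where "e'' = vector_derivative e' (at (snd z))"
    have de': "(e' has_vector_derivative e'') (at (snd z))"
      unfolding e''_def by (rule smooth_on_has_vector_derivative[OF sm_e' s])
    have 2: "((\<lambda>z. FD (\<rho> U \<phi>) z (0, 1) *\<^sub>R e (snd z) + \<rho> U \<phi> z *\<^sub>R e' (snd z)) has_derivative
        (\<lambda>Z. (FD (\<rho> U \<phi>) z (0, 1) *\<^sub>R (snd Z *\<^sub>R e' (snd z)) + FD (\<lambda>z. FD (\<rho> U \<phi>) z (0, 1)) z Z *\<^sub>R e (snd z))
          + (\<rho> U \<phi> z *\<^sub>R (snd Z *\<^sub>R e'') + FD (\<rho> U \<phi>) z Z *\<^sub>R e' (snd z)))) (at z)"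
      by (rule has_derivative_add[OF has_derivative_scaleR[OF d\<rho>s[OF U z] dcurve[OF de[OF s]]]
            has_derivative_scaleR[OF d\<rho>[OF U z] dcurve[OF de']]])
    have "((\<lambda>z. snd (FD (chart_rep U \<phi> f) z (0, 1))) has_derivative
        (\<lambda>Z. (FD (\<rho> U \<phi>) z (0, 1) *\<^sub>R (snd Z *\<^sub>R e' (snd z)) + FD (\<lambda>z. FD (\<rho> U \<phi>) z (0, 1)) z Z *\<^sub>R e (snd z))
          + (\<rho> U \<phi> z *\<^sub>R (snd Z *\<^sub>R e'') + FD (\<rho> U \<phi>) z Z *\<^sub>R e' (snd z)))) (at z)"
      by (rule has_derivative_transform_within_open[OF 2 open_chart_image[OF U] z]) (simp add: Dq[OF U])
    from fun_cong[OF has_derivative_unique[OF 1 this], of "(X, 0)"]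
    show ?thesis by simp
  qed
  \<comment> \<open>Otherwise the part of f_s normal to the axis would point along \<open>e\<close>
    and be annihilated by \<omega>, against \<open>velocity_component\<close>. This is what gives
    \<theta>' \<noteq> 0.\<close>
  have e'_ne: "e' s \<noteq> 0" if s: "s \<in> I" for s
  proof
    assume 0: "e' s = 0"
    obtain \<omega> where \<omega>: "\<omega> \<noteq> 0" "\<And>x. \<omega> \<bullet> q x s = 0" using leaves[OF s] by (auto simp: q_def)
    obtain U \<phi> where U: "(U, \<phi>) \<in> A" "undefined \<in> U" by (rule chart_at)
    have z: "(\<phi> undefined, s) \<in> \<phi> ` U \<times> I" using U s by auto
    have "\<omega> \<bullet> e s = 0" using \<omega>(2) by (simp add: e_def)
    then show False
      using velocity_component[OF s \<omega> U] Dq[OF U(1) z, of "(0, 1)"] 0 by simp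
  qed
  \<comment> \<open>Makes \<open>e' s\<close> an admissible normal of the leaf's hyperplane in
    \<open>not_tangent\<close>.\<close>
  have e'_perp: "e' s \<bullet> q x s = 0" if "s \<in> I" for s x
  proof -
    have "e' s \<bullet> (norm (q x s) *\<^sub>R e s) = 0" using ee'[OF that] by (simp add: inner_commute)
    then show ?thesis unfolding q_polar[OF that, symmetric] .
  qed
  have Dw: "FD (chart_rep U \<phi> w) z = (\<lambda>Z. (fst (FD (chart_rep U \<phi> f) z Z), FD (\<rho> U \<phi>) z Z))"
    if U: "(U, \<phi>) \<in> A" and z: "z \<in> \<phi> ` U \<times> I" for U \<phi> z
    unfolding rep by (rule FD_eq[OF has_derivative_Pair[OF has_derivative_fst[OF has_derivative_f[OF U z]] d\<rho>[OF U z]]])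
  have sm_w: "smooth_on (\<phi> ` U \<times> I) (chart_rep U \<phi> w)" if U: "(U, \<phi>) \<in> A" for U \<phi>
    unfolding rep
    by (rule smooth_on_Pair[OF open_chart_image[OF U]
          smooth_on_linear_compose[OF bounded_linear_fst open_chart_image[OF U] smooth_f[OF U]] sm_\<rho>[OF U]])
  have D2w: "FD (\<lambda>z. FD (chart_rep U \<phi> w) z (0, 1)) z
      = (\<lambda>Z. (fst (FD (\<lambda>z. FD (chart_rep U \<phi> f) z (0, 1)) z Z), FD (\<lambda>z. FD (\<rho> U \<phi>) z (0, 1)) z Z))"
    if U: "(U, \<phi>) \<in> A" and z: "z \<in> \<phi> ` U \<times> I" for U \<phi> z
  proof -
    have "((\<lambda>z. (fst (FD (chart_rep U \<phi> f) z (0, 1)), FD (\<rho> U \<phi>) z (0, 1))) has_derivative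
       (\<lambda>Z. (fst (FD (\<lambda>z. FD (chart_rep U \<phi> f) z (0, 1)) z Z), FD (\<lambda>z. FD (\<rho> U \<phi>) z (0, 1)) z Z))) (at z)"
      by (rule has_derivative_Pair[OF has_derivative_fst[OF has_derivative_velocity[OF U z]] d\<rho>s[OF U z]])
    then have "((\<lambda>z. FD (chart_rep U \<phi> w) z (0, 1)) has_derivative
       (\<lambda>Z. (fst (FD (\<lambda>z. FD (chart_rep U \<phi> f) z (0, 1)) z Z), FD (\<lambda>z. FD (\<rho> U \<phi>) z (0, 1)) z Z))) (at z)"
      by (rule has_derivative_transform_within_open[OF _ open_chart_image[OF U] z]) (simp add: Dw[OF U])
    then show ?thesis by (rule FD_eq)
  qed
  have "orthogonal_family A I lorentz (-1) (\<lambda>p. half_space (w p))"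
  proof (rule half_space_family[OF dims sm_w])
    show "snd (w (x, s)) > 0" if "s \<in> I" for x s using q_ne[OF that, of x] by (simp add: w_def q_def)
    fix U \<phi> z and X :: 'e assume U: "(U, \<phi>) \<in> A" and z: "z \<in> \<phi> ` U \<times> I"
    let ?h = "chart_rep U \<phi> f" and ?r = "\<rho> U \<phi>"
    obtain x s where x: "x \<in> U" "s \<in> I" "z = (\<phi> x, s)" using z by auto
    have sz: "snd z = s" and s: "snd z \<in> I" using x by simp_all
    have un: "e (snd z) \<bullet> e (snd z) = 1" "e (snd z) \<bullet> e' (snd z) = 0" "e' (snd z) \<bullet> e (snd z) = 0"
      using unit[OF s] ee'[OF s] by (simp_all add: inner_commute)
    show orth_w: "FD (chart_rep U \<phi> w) z (X, 0) \<bullet> FD (chart_rep U \<phi> w) z (0, 1) = 0" for X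
    proof -
      have "FD ?h z (X, 0) \<bullet> FD ?h z (0, 1) = FD (chart_rep U \<phi> w) z (X, 0) \<bullet> FD (chart_rep U \<phi> w) z (0, 1)"
        unfolding inner_prod_def[of "FD ?h z (X, 0)"] Dq[OF U z] Dw[OF U z]
        by (simp add: inner_add_right un)
      then show ?thesis using orth_f[OF U z, of X] by simp
    qed
    show "FD (chart_rep U \<phi> w) z (0, 1) \<noteq> 0"
    proof
      assume "FD (chart_rep U \<phi> w) z (0, 1) = 0"
      then have "fst (FD ?h z (0, 1)) = 0" "FD ?r z (0, 1) = 0" by (simp_all add: Dw[OF U z] zero_prod_def)
      \<comment> \<open>Only the rotational part of f_s would remain, a nonzero multiple of the
        normal (0, e').\<close>
      then have "FD ?h z (0, 1) = ?r z *\<^sub>R (0, e' s)"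
        using Dq[OF U z, of "(0, 1)"] sz by (intro prod_eqI) simp_all
      then have "FD ?h z (inverse (?r z) *\<^sub>R (0, 1)) = (0, e' s)"
        unfolding linear_scale[OF linear_f[OF U z]] using \<rho>_pos[OF z] by simp
      then have "(0, e' s) \<in> range (FD ?h (\<phi> x, s))" unfolding x(3) by (metis rangeI)
      then show False
        using not_tangent[OF x(2) e'_ne[OF x(2)] _ U x(1)] e'_perp[OF x(2)] by (simp add: q_def)
    qed
    show "FD (chart_rep U \<phi> w) z (X, 0) \<noteq> 0" if "X \<noteq> 0"
    proof
      assume "FD (chart_rep U \<phi> w) z (X, 0) = 0"
      then have "FD ?h z (X, 0) = 0"
        using Dq[OF U z, of "(X, 0)"] by (simp add: Dw[OF U z] zero_prod_def prod_eq_iff)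
      then show False using that FD_f_eq_0[OF U z] by (simp add: zero_prod_def)
    qed
    obtain W \<mu> where W: "FD (\<lambda>z. FD ?h z (0, 1)) z (X, 0) = FD ?h z (W, 0) + \<mu> *\<^sub>R FD ?h z (0, 1)"
      by (rule adapted_decomp[OF U z])
    \<comment> \<open>Comparing \<open>e'\<close> components gives \<mu> = \<rho>_X / \<rho>;
      comparing \<open>e\<close> components shows that \<open>w\<close> obeys the same decomposition
      as \<open>f\<close>. Paired with w_s, the latter leaves \<mu> |w_s|^2, which is the condition
      \<open>parallel\<close>.\<close>
    have eq: "FD (\<lambda>z. FD ?r z (0, 1)) z (X, 0) *\<^sub>R e (snd z) + FD ?r z (X, 0) *\<^sub>R e' (snd z)
        = FD ?r z (W, 0) *\<^sub>R e (snd z) + \<mu> *\<^sub>R (FD ?r z (0, 1) *\<^sub>R e (snd z) + ?r z *\<^sub>R e' (snd z))"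
      using arg_cong[OF W, of snd] by (simp add: D2q[OF U z] Dq[OF U z])
    have 1: "FD (\<lambda>z. FD ?r z (0, 1)) z (X, 0) = FD ?r z (W, 0) + \<mu> * FD ?r z (0, 1)"
      using arg_cong[OF eq, of "\<lambda>v. v \<bullet> e (snd z)"] by (simp add: inner_add_left un)
    have "FD ?r z (X, 0) * (e' (snd z) \<bullet> e' (snd z)) = \<mu> * ?r z * (e' (snd z) \<bullet> e' (snd z))"
      using arg_cong[OF eq, of "\<lambda>v. v \<bullet> e' (snd z)"] by (simp add: inner_add_left un)
    then have 2: "FD ?r z (X, 0) = \<mu> * ?r z" using e'_ne[OF s] by simp
    have "FD (\<lambda>z. FD (chart_rep U \<phi> w) z (0, 1)) z (X, 0)
        = FD (chart_rep U \<phi> w) z (W, 0) + \<mu> *\<^sub>R FD (chart_rep U \<phi> w) z (0, 1)"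
      by (simp add: D2w[OF U z] Dw[OF U z] W 1)
    then have "FD (\<lambda>z. FD (chart_rep U \<phi> w) z (0, 1)) z (X, 0) \<bullet> FD (chart_rep U \<phi> w) z (0, 1)
        = \<mu> * (FD (chart_rep U \<phi> w) z (0, 1) \<bullet> FD (chart_rep U \<phi> w) z (0, 1))"
      by (simp add: inner_add_left orth_w)
    moreover have "snd (chart_rep U \<phi> w z) = ?r z" "snd (FD (chart_rep U \<phi> w) z (X, 0)) = \<mu> * ?r z"
      unfolding Dw[OF U z] by (simp_all add: rep 2)
    ultimately show "snd (chart_rep U \<phi> w z) * (FD (\<lambda>z. FD (chart_rep U \<phi> w) z (0, 1)) z (X, 0) \<bullet> FD (chart_rep U \<phi> w) z (0, 1))
      = snd (FD (chart_rep U \<phi> w) z (X, 0)) * (FD (chart_rep U \<phi> w) z (0, 1) \<bullet> FD (chart_rep U \<phi> w) z (0, 1))"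
      by simp
  qed
  then interpret orthogonal_family A I lorentz "-1" "\<lambda>p. half_space (w p)" .
  have "parallel_family_map (-1) lorentz hyperbolic A I (\<lambda>(x, s). (half_space (w (x, s)), \<theta> s))"
  proof (rule parallel_family[OF _ \<theta>(1,2)])
    fix s assume s: "s \<in> I"
    have pos: "snd (w (x, s)) > 0" for x using q_ne[OF s, of x] by (simp add: w_def q_def)
    show "half_space (w (x, s)) \<in> hyperbolic" for x
      using pos[of x] lorentz_half_space[of "w (x, s)"] by (simp add: hyperbolic_def half_space_def)
    show "\<theta>' s \<noteq> 0" using e'_ne[OF s] \<theta>(4)[OF s] by (auto simp: e'_def zero_prod_def)
  qed
  moreover have "f (x, s) = \<Phi>_hyperbolic (half_space (w (x, s)), \<theta> s)" if "s \<in> I" for x s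
  proof -
    define n where "n = norm (snd (f (x, s)))"
    have n: "n \<noteq> 0" using q_ne[OF that, of x] by (simp add: n_def q_def)
    have "snd (f (x, s)) = n *\<^sub>R (cos (\<theta> s), sin (\<theta> s))"
      using q_polar[OF that, of x] \<theta>(3)[OF that] by (simp only: n_def q_def)
    then have "f (x, s) = (fst (f (x, s)), n * cos (\<theta> s), n * sin (\<theta> s))"
      by (intro prod_eqI) simp_all
    moreover have "w (x, s) = (fst (f (x, s)), n)" by (simp add: w_def n_def)
    moreover have "\<Phi>_hyperbolic (half_space (p, n), t) = (p, n * cos t, n * sin t)" for p t
      using n by (simp add: \<Phi>_hyperbolic_def half_space_def divide_inverse mult.commute)
    ultimately show ?thesis by metis
  qed
  ultimately show ?thesis
    by (intro exI[of _ "\<lambda>(x, s). (half_space (w (x, s)), \<theta> s)"]) simp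
qed

section \<open>The three families of leaves\<close>

lemma (in product_manifold) obliqueD:
  assumes imm: "immersion (product_atlas A I) f" and obl: "oblique A I f \<S>"
    and S: "S \<in> \<S>" "s \<in> I" "f ` leaf s \<subseteq> S" and U: "(U, \<phi>) \<in> A" "x \<in> U"
    and \<xi>: "normal_vector S (f (x, s)) \<xi>"
  shows "\<xi> \<notin> range (FD (chart_rep U \<phi> f) (\<phi> x, s))"
    "\<exists>Z. \<xi> \<bullet> FD (chart_rep U \<phi> f) (\<phi> x, s) Z \<noteq> 0"
proof -
  let ?c = "(U \<times> I, map_prod \<phi> id)"
  have p: "?c \<in> product_atlas A I" "(x, s) \<in> fst ?c \<inter> leaf s"
    using product_chart[OF U(1)] U S(2) by (auto simp: leaf_def)
  have "tangent_image ?c f (x, s) = range (FD (chart_rep U \<phi> f) (\<phi> x, s))"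
    unfolding tangent_image_def
    using differential_product[OF imm[unfolded immersion_def, THEN conjunct1] U S(2)] by simp
  moreover have "\<xi> \<notin> tangent_image ?c f (x, s) \<and> \<not> (\<forall>t\<in>tangent_image ?c f (x, s). \<xi> \<bullet> t = 0)"
    using obl S p \<xi> unfolding oblique_def by blast
  ultimately show "\<xi> \<notin> range (FD (chart_rep U \<phi> f) (\<phi> x, s))"
    "\<exists>Z. \<xi> \<bullet> FD (chart_rep U \<phi> f) (\<phi> x, s) Z \<noteq> 0"
    by auto
qed

lemma orthogonal_transformation_imp_isometry:
  assumes "orthogonal_transformation T" shows "euclidean_isometry (\<lambda>y. T (y - b))"
  unfolding euclidean_isometry_def dist_norm
  using orthogonal_transformation_norm[OF assms] linear_diff[OF orthogonal_transformation_linear[OF assms]]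
  by (metis diff_diff_eq2 diff_add_cancel)

text \<open>The orthogonal complement of the direction space of \<open>L\<close> is a plane, and
  \<open>a\<close>, \<open>b\<close> form an orthonormal basis of it. The spanning clause lets every
  hyperplane of the pencil be described by two coordinates of its normal.\<close>

lemma affine_codim_2_normals:
  fixes L :: "'v::euclidean_space set"
  assumes L: "affine L" "aff_dim L + 2 = int DIM('v)" "l \<in> L"
  obtains a b where "norm a = 1" "norm b = 1" "a \<bullet> b = 0"
    "\<And>x. x \<in> L \<Longrightarrow> a \<bullet> (x - l) = 0" "\<And>x. x \<in> L \<Longrightarrow> b \<bullet> (x - l) = 0"
    "\<And>w. (\<And>x. x \<in> L \<Longrightarrow> w \<bullet> (x - l) = 0) \<Longrightarrow> \<exists>p q. w = p *\<^sub>R a + q *\<^sub>R b"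
proof -
  define V where "V = (\<lambda>x. x - l) ` L"
  have V: "subspace V" "int (dim V) = aff_dim L"
    unfolding V_def using affine_diffs_subspace_subtract[OF L(1,3)] aff_dim_dim_affine_diffs[OF L(1,3)] by simp_all
  define W where "W = {y. \<forall>x\<in>V. orthogonal x y}"
  have W: "subspace W" unfolding W_def by (rule subspace_orthogonal_to_vectors)
  have "dim W + dim V = DIM('v)"
    using dim_subspace_orthogonal_to_vectors[OF V(1) subspace_UNIV] by (simp add: W_def)
  then have "dim W = 2" using V(2) L(2) by linarith
  then obtain Bs where Bs: "Bs \<subseteq> W" "pairwise orthogonal Bs" "\<And>x. x \<in> Bs \<Longrightarrow> norm x = 1"
    "card Bs = 2" "span Bs = W"
    using orthonormal_basis_subspace[OF W] by metis
  obtain a b where ab: "Bs = {a, b}" "a \<noteq> b" using Bs(4) by (auto simp: card_2_iff)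
  have in_W: "w \<in> W \<longleftrightarrow> (\<forall>x\<in>L. w \<bullet> (x - l) = 0)" for w
    by (auto simp: W_def V_def orthogonal_def inner_commute)
  have "\<exists>p q. w = p *\<^sub>R a + q *\<^sub>R b" if "\<And>x. x \<in> L \<Longrightarrow> w \<bullet> (x - l) = 0" for w
  proof -
    have "w \<in> span {a, b}" using that in_W Bs(5) ab(1) by blast
    then show ?thesis
      by (auto simp: span_breakdown_eq algebra_simps)
  qed
  moreover have "a \<bullet> b = 0" using Bs(2) ab by (auto simp: pairwise_def orthogonal_def)
  moreover have "a \<in> W" "b \<in> W" using Bs(1) ab by auto
  ultimately show ?thesis using that[of a b] Bs(3) ab(1) in_W by blast
qed

text \<open>Each case is available in standard position; what remains is to choose the rigid motion
  \<open>T\<close> and to carry the hypotheses on leaves and obliqueness through it.\<close>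

theorem theorem29:
  fixes A :: "('p::{t2_space,second_countable_topology}, real^'m) chart set"
    and I :: "real set"
    and f :: "'p \<times> real \<Rightarrow> 'm euclid_n1"
  assumes manifold: "smooth_atlas A" "connected (UNIV :: 'p set)"
    and interval: "open_interval I"
    and hypersurface: "immersion (product_atlas A I) f"
    and enneper: "enneper_type A I f"
  shows
   "(\<forall>c. leaves_in I f (concentric_hyperspheres c) \<and> oblique A I f (concentric_hyperspheres c) \<longrightarrow>
       (\<exists>T F. euclidean_isometry T \<and> parallel_family_map 1 inner unit_sphere A I F \<and>
          (\<forall>p\<in>UNIV \<times> I. T (f p) = \<Phi>_sphere (F p)))) \<and>
    (\<forall>v. v \<noteq> 0 \<and>
       leaves_in I f (parallel_hyperplanes v) \<and> oblique A I f (parallel_hyperplanes v) \<longrightarrow>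
       (\<exists>T F. euclidean_isometry T \<and> parallel_family_map 0 inner UNIV A I F \<and>
          (\<forall>p\<in>UNIV \<times> I. T (f p) = \<Phi>_flat (F p)))) \<and>
    (\<forall>L. affine L \<and> aff_dim L = int CARD('m) \<and> simply_connected (UNIV \<times> I :: ('p \<times> real) set) \<and>
       leaves_in I f (hyperplane_pencil L) \<and> oblique A I f (hyperplane_pencil L) \<longrightarrow>
       (\<exists>T F. euclidean_isometry T \<and> parallel_family_map (-1) lorentz hyperbolic A I F \<and>
          (\<forall>p\<in>UNIV \<times> I. T (f p) = \<Phi>_hyperbolic (F p))))"
proof (intro conjI allI impI; elim conjE)
  interpret product_manifold A I using manifold interval by unfold_locales
  interpret enneper_hypersurface A I f by (rule enneper_hypersurfaceI[OF hypersurface enneper])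
  note obl = obliqueD[OF hypersurface]
  fix c
  assume leaves: "leaves_in I f (concentric_hyperspheres c)" and ob: "oblique A I f (concentric_hyperspheres c)"
  \<comment> \<open>Spheres need only a translation, so the orthogonal part is the identity.\<close>
  define f' where "f' = (\<lambda>p. f p - c)"
  note id = orthogonal_transformation_id[where 'a = "'m euclid_n1"]
  interpret f': enneper_hypersurface A I f' unfolding f'_def by (rule isometric_image[OF id])
  have FD: "FD (chart_rep U \<phi> f') z = FD (chart_rep U \<phi> f) z" if "(U, \<phi>) \<in> A" "z \<in> \<phi> ` U \<times> I" for U \<phi> z
    unfolding f'_def isometric_image_FD[OF id that] by simp
  have radius: "\<exists>r>0. sphere c r \<in> concentric_hyperspheres c \<and> f ` leaf s \<subseteq> sphere c r" if s: "s \<in> I" for s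
    using leaves s unfolding leaves_in_def concentric_hyperspheres_def by blast
  have oblique': "chart_rep U \<phi> f' z \<notin> range (FD (chart_rep U \<phi> f') z) \<and>
      (\<exists>Z. chart_rep U \<phi> f' z \<bullet> FD (chart_rep U \<phi> f') z Z \<noteq> 0)"
    if U: "(U, \<phi>) \<in> A" and z: "z \<in> \<phi> ` U \<times> I" for U \<phi> z
  proof -
    obtain x s where x: "x \<in> U" "s \<in> I" "z = (\<phi> x, s)" using z by auto
    obtain r where r: "r > 0" "sphere c r \<in> concentric_hyperspheres c" "f ` leaf s \<subseteq> sphere c r"
      using radius[OF x(2)] by blast
    have "normal_vector (sphere c r) (f (x, s)) (f (x, s) - c)"
      using r(1) unfolding normal_vector_def by blast
    from obl[OF ob r(2) x(2) r(3) U x(1) this] show ?thesis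
      unfolding FD[OF U z] unfolding x(3) chart_rep_apply[OF U x(1)] by (simp add: f'_def)
  qed
  have "\<exists>F. parallel_family_map 1 inner {x. x \<bullet> x = 1} A I F \<and>
    (\<forall>x. \<forall>s\<in>I. f' (x, s) = exp (snd (F (x, s))) *\<^sub>R fst (F (x, s)))"
  proof (rule f'.concentric_case)
    show "DIM('m euclid_n1) = DIM(real^'m) + 2" by simp
    fix s assume "s \<in> I"
    then obtain r where r: "r > 0" "f ` leaf s \<subseteq> sphere c r" using radius by blast
    then have "norm (f' (x, s)) = r" for x
      by (auto simp: f'_def leaf_def dist_norm norm_minus_commute image_subset_iff)
    then show "\<exists>r>0. \<forall>x. norm (f' (x, s)) = r" using r(1) by blast
  qed (use oblique' in blast)+
  then obtain F where F: "parallel_family_map 1 inner unit_sphere A I F"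
    "\<And>x s. s \<in> I \<Longrightarrow> f' (x, s) = exp (snd (F (x, s))) *\<^sub>R fst (F (x, s))"
    unfolding unit_sphere_def by blast
  then show "\<exists>T F. euclidean_isometry T \<and> parallel_family_map 1 inner unit_sphere A I F \<and>
      (\<forall>p\<in>UNIV \<times> I. T (f p) = \<Phi>_sphere (F p))"
    using orthogonal_transformation_imp_isometry[OF id, of c]
    by (intro exI[of _ "\<lambda>y. y - c"] exI[of _ F]) (auto simp: \<Phi>_sphere_def f'_def case_prod_beta)
next
  interpret product_manifold A I using manifold interval by unfold_locales
  interpret enneper_hypersurface A I f by (rule enneper_hypersurfaceI[OF hypersurface enneper])
  note obl = obliqueD[OF hypersurface]
  fix v :: "'m euclid_n1"
  assume v: "v \<noteq> 0" and leaves: "leaves_in I f (parallel_hyperplanes v)" and ob: "oblique A I f (parallel_hyperplanes v)"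
  \<comment> \<open>\<open>v\<close> may have any length, so its normalisation is what gets
    reflected to the last basis vector; the factors \<open>norm v\<close> below undo the
    scaling.\<close>
  have "norm (inverse (norm v) *\<^sub>R v) = norm ((0, 0, 1) :: 'm euclid_n1)" using v by (simp add: norm_Pair)
  then obtain T :: "'m euclid_n1 \<Rightarrow> 'm euclid_n1" where T: "orthogonal_transformation T"
    "T (inverse (norm v) *\<^sub>R v) = (0, 0, 1)"
    by (rule orthogonal_transformation_reflection)
  have last: "snd (snd (T u)) = inverse (norm v) * (v \<bullet> u)" for u
  proof -
    have "snd (snd (T u)) = T (inverse (norm v) *\<^sub>R v) \<bullet> T u" unfolding T(2) by (simp add: inner_prod_def)
    also have "\<dots> = (inverse (norm v) *\<^sub>R v) \<bullet> u"
      using T(1) unfolding orthogonal_transformation_def by blast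
    finally show ?thesis by simp
  qed
  define f' where "f' = (\<lambda>p. T (f p - 0))"
  have enn': "enneper_hypersurface A I f'" unfolding f'_def by (rule isometric_image[OF T(1)])
  have FD: "FD (chart_rep U \<phi> f') z = (\<lambda>Z. T (FD (chart_rep U \<phi> f) z Z))" if "(U, \<phi>) \<in> A" "z \<in> \<phi> ` U \<times> I" for U \<phi> z
    unfolding f'_def by (rule isometric_image_FD[OF T(1) that])
  have height: "\<exists>d. {y. v \<bullet> y = d} \<in> parallel_hyperplanes v \<and> f ` leaf s \<subseteq> {y. v \<bullet> y = d}" if s: "s \<in> I" for s
    using leaves s unfolding leaves_in_def parallel_hyperplanes_def by blast
  have oblique': "(0, 0, 1) \<notin> range (FD (chart_rep U \<phi> f') z) \<and>
      (\<exists>Z. snd (snd (FD (chart_rep U \<phi> f') z Z)) \<noteq> 0)"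
    if U: "(U, \<phi>) \<in> A" and z: "z \<in> \<phi> ` U \<times> I" for U \<phi> z
  proof -
    obtain x s where x: "x \<in> U" "s \<in> I" "z = (\<phi> x, s)" using z by auto
    obtain d where d: "{y. v \<bullet> y = d} \<in> parallel_hyperplanes v" "f ` leaf s \<subseteq> {y. v \<bullet> y = d}"
      using height[OF x(2)] by blast
    have "normal_vector {y. v \<bullet> y = d} (f (x, s)) v" using v unfolding normal_vector_def by blast
    note o = obl[OF ob d(1) x(2) d(2) U x(1) this, folded x(3)]
    have "(0, 0, 1) \<notin> range (FD (chart_rep U \<phi> f') z)"
    proof
      assume "(0, 0, 1) \<in> range (FD (chart_rep U \<phi> f') z)"
      then obtain Z where "T (inverse (norm v) *\<^sub>R v) = T (FD (chart_rep U \<phi> f) z Z)"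
        unfolding FD[OF U z] T(2) by blast
      then have "inverse (norm v) *\<^sub>R v = FD (chart_rep U \<phi> f) z Z"
        using injD[OF orthogonal_transformation_inj[OF T(1)]] by blast
      then have "norm v *\<^sub>R inverse (norm v) *\<^sub>R v = FD (chart_rep U \<phi> f) z (norm v *\<^sub>R Z)"
        using linear_scale[OF linear_f[OF U z]] by simp
      then have "v = FD (chart_rep U \<phi> f) z (norm v *\<^sub>R Z)" using v by simp
      then show False using o(1) by blast
    qed
    moreover obtain Z where "v \<bullet> FD (chart_rep U \<phi> f) z Z \<noteq> 0" using o(2) by blast
    then have "snd (snd (FD (chart_rep U \<phi> f') z Z)) \<noteq> 0" unfolding FD[OF U z] last using v by simp
    ultimately show ?thesis by blast
  qed
  have "\<exists>F. parallel_family_map 0 inner UNIV A I F \<and> (\<forall>x. \<forall>s\<in>I. f' (x, s) = \<Phi>_flat (F (x, s)))"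
  proof (rule parallel_hyperplanes_case[OF enn'])
    show "DIM(real^'m) = CARD('m)" by simp
    fix s assume "s \<in> I"
    then obtain d where "f ` leaf s \<subseteq> {y. v \<bullet> y = d}" using height by blast
    then have "v \<bullet> f (x, s) = d" for x by (auto simp: leaf_def)
    then show "\<exists>d. \<forall>x. snd (snd (f' (x, s))) = d" by (simp add: f'_def last)
  qed (use oblique' in blast)+
  then obtain F where F: "parallel_family_map 0 inner UNIV A I F" "\<And>x s. s \<in> I \<Longrightarrow> f' (x, s) = \<Phi>_flat (F (x, s))"
    by blast
  then show "\<exists>T F. euclidean_isometry T \<and> parallel_family_map 0 inner UNIV A I F \<and>
      (\<forall>p\<in>UNIV \<times> I. T (f p) = \<Phi>_flat (F p))"
    using orthogonal_transformation_imp_isometry[OF T(1), of 0]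
    by (intro exI[of _ "\<lambda>y. T (y - 0)"] exI[of _ F]) (auto simp: f'_def)
next
  interpret product_manifold A I using manifold interval by unfold_locales
  interpret enneper_hypersurface A I f by (rule enneper_hypersurfaceI[OF hypersurface enneper])
  note obl = obliqueD[OF hypersurface]
  fix L :: "'m euclid_n1 set"
  assume L: "affine L" "aff_dim L = int CARD('m)"
    and leaves: "leaves_in I f (hyperplane_pencil L)" and ob: "oblique A I f (hyperplane_pencil L)"
  have "L \<noteq> {}" using L(2) by auto
  then obtain l where l: "l \<in> L" by blast
  have "aff_dim L + 2 = int DIM('m euclid_n1)" using L(2) by simp
  from affine_codim_2_normals[OF L(1) this l] obtain a b where ab: "norm a = 1" "norm b = 1" "a \<bullet> b = 0"
    "\<And>x. x \<in> L \<Longrightarrow> a \<bullet> (x - l) = 0" "\<And>x. x \<in> L \<Longrightarrow> b \<bullet> (x - l) = 0"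
    and normals: "\<And>w. (\<And>x. x \<in> L \<Longrightarrow> w \<bullet> (x - l) = 0) \<Longrightarrow> \<exists>p q. w = p *\<^sub>R a + q *\<^sub>R b"
    by metis
  have "norm ((0, 1, 0) :: 'm euclid_n1) = 1" "norm ((0, 0, 1) :: 'm euclid_n1) = 1"
    "((0, 1, 0) :: 'm euclid_n1) \<bullet> (0, 0, 1) = 0" by (simp_all add: norm_Pair inner_prod_def)
  from orthogonal_transformation_pair[OF ab(1-3) this] obtain T :: "'m euclid_n1 \<Rightarrow> 'm euclid_n1"
    where T: "orthogonal_transformation T" "T a = (0, 1, 0)" "T b = (0, 0, 1)" by metis
  have T_inner: "T u \<bullet> T w = u \<bullet> w" for u w
    using T(1) unfolding orthogonal_transformation_def by blast
  \<comment> \<open>Identifies a plane with the normals of the pencil; \<open>T\<close> sends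
    \<open>n \<omega>\<close> to (0, \<omega>), the form of normal used in standard
    position.\<close>
  define n where "n = (\<lambda>\<omega>::real \<times> real. fst \<omega> *\<^sub>R a + snd \<omega> *\<^sub>R b)"
  have Tn: "T (n \<omega>) = (0, \<omega>)" for \<omega>
  proof -
    interpret linear T by (rule orthogonal_transformation_linear[OF T(1)])
    show ?thesis by (simp add: n_def add scale T(2,3))
  qed
  have component: "\<omega> \<bullet> snd (T u) = n \<omega> \<bullet> u" for \<omega> u
    using T_inner[of "n \<omega>" u] by (simp add: Tn inner_prod_def)
  define f' where "f' = (\<lambda>p. T (f p - l))"
  have enn': "enneper_hypersurface A I f'" unfolding f'_def by (rule isometric_image[OF T(1)])
  have FD: "FD (chart_rep U \<phi> f') z = (\<lambda>Z. T (FD (chart_rep U \<phi> f) z Z))" if "(U, \<phi>) \<in> A" "z \<in> \<phi> ` U \<times> I" for U \<phi> z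
    unfolding f'_def by (rule isometric_image_FD[OF T(1) that])
  have oblique': "(0, \<omega>) \<notin> range (FD (chart_rep U \<phi> f') (\<phi> x, s)) \<and>
      (\<exists>Z. \<omega> \<bullet> snd (FD (chart_rep U \<phi> f') (\<phi> x, s) Z) \<noteq> 0)"
    if s: "s \<in> I" and \<omega>: "\<omega> \<noteq> 0" "\<And>x. \<omega> \<bullet> snd (f' (x, s)) = 0" and U: "(U, \<phi>) \<in> A" "x \<in> U" for U \<phi> x s \<omega>
  proof -
    \<comment> \<open>The member of the pencil with normal \<open>n \<omega>\<close>: it passes
      through \<open>l\<close> and so contains \<open>L\<close>, and it contains the leaf by the
      choice of \<omega>.\<close>
    let ?S = "{y. n \<omega> \<bullet> y = n \<omega> \<bullet> l}"
    have z: "(\<phi> x, s) \<in> \<phi> ` U \<times> I" using U s by auto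
    have n0: "n \<omega> \<noteq> 0"
      using Tn[of \<omega>] \<omega>(1) linear_0[OF orthogonal_transformation_linear[OF T(1)]] by (auto simp: zero_prod_def)
    have "L \<subseteq> ?S"
    proof
      fix y assume "y \<in> L"
      then have "n \<omega> \<bullet> (y - l) = 0" using ab(4,5) by (simp add: n_def inner_add_left)
      then show "y \<in> ?S" by (simp add: inner_diff_right)
    qed
    then have S: "?S \<in> hyperplane_pencil L"
      using n0 unfolding hyperplane_pencil_def affine_hyperplane_def by blast
    have "n \<omega> \<bullet> (f (x, s) - l) = 0" for x using \<omega>(2)[of x] by (simp add: f'_def component)
    then have "f ` leaf s \<subseteq> ?S" by (auto simp: leaf_def inner_diff_right)
    moreover have "normal_vector ?S (f (x, s)) (n \<omega>)" using n0 unfolding normal_vector_def by blast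
    ultimately have o: "n \<omega> \<notin> range (FD (chart_rep U \<phi> f) (\<phi> x, s))"
      "\<exists>Z. n \<omega> \<bullet> FD (chart_rep U \<phi> f) (\<phi> x, s) Z \<noteq> 0"
      using obl[OF ob S s _ U] by blast+
    have "(0, \<omega>) \<notin> range (FD (chart_rep U \<phi> f') (\<phi> x, s))"
      using o(1) injD[OF orthogonal_transformation_inj[OF T(1)]] unfolding FD[OF U(1) z] Tn[symmetric] by blast
    then show ?thesis using o(2) by (simp add: FD[OF U(1) z] component)
  qed
  have "\<exists>F. parallel_family_map (-1) lorentz hyperbolic A I F \<and> (\<forall>x. \<forall>s\<in>I. f' (x, s) = \<Phi>_hyperbolic (F (x, s)))"
  proof (rule hyperplane_pencil_case[OF enn'])
    show "DIM(real^'m) = CARD('m)" by simp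
    fix s assume "s \<in> I"
    then obtain S where S: "S \<in> hyperplane_pencil L" "f ` leaf s \<subseteq> S" using leaves unfolding leaves_in_def by blast
    then obtain u d where u: "u \<noteq> 0" "S = {y. u \<bullet> y = d}" "L \<subseteq> S"
      unfolding hyperplane_pencil_def affine_hyperplane_def by blast
    have ul: "u \<bullet> l = d" using u l by blast
    have "u \<bullet> (x - l) = 0" if "x \<in> L" for x using u that ul by (auto simp: inner_diff_right)
    then obtain p q where "u = p *\<^sub>R a + q *\<^sub>R b" using normals by blast
    then have un: "u = n (p, q)" by (simp add: n_def)
    have "u \<bullet> f (x, s) = d" for x using S(2) u(2) by (auto simp: leaf_def)
    then have "(p, q) \<bullet> snd (f' (x, s)) = 0" for x
      unfolding f'_def component un[symmetric] using ul by (simp add: inner_diff_right)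
    moreover have "(p, q) \<noteq> 0" using u(1) un by (auto simp: n_def zero_prod_def)
    ultimately show "\<exists>\<omega>. \<omega> \<noteq> 0 \<and> (\<forall>x. \<omega> \<bullet> snd (f' (x, s)) = 0)" by blast
  qed (use oblique' in blast)+
  then obtain F where F: "parallel_family_map (-1) lorentz hyperbolic A I F" "\<And>x s. s \<in> I \<Longrightarrow> f' (x, s) = \<Phi>_hyperbolic (F (x, s))"
    by blast
  then show "\<exists>T F. euclidean_isometry T \<and> parallel_family_map (-1) lorentz hyperbolic A I F \<and>
      (\<forall>p\<in>UNIV \<times> I. T (f p) = \<Phi>_hyperbolic (F p))"
    using orthogonal_transformation_imp_isometry[OF T(1), of l]
    by (intro exI[of _ "\<lambda>y. T (y - l)"] exI[of _ F]) (auto simp: f'_def)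
qed

end
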